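(* Let $c,d$ be integers with $d\geq 1$, $c\equiv 1\pmod{12}$ and $\gcd(c,d)=1$. Then there exists a prime $p\equiv c\pmod{12d}$ such that the polynomial $y^8+360y^4-48$ has no root in $\mathbb{F}_p$. *)

theory Defs
  imports "HOL-Number_Theory.Number_Theory"
begin

end

theory Submission
  imports Defs "HOL-Complex_Analysis.Complex_Analysis" "HOL-Real_Asymp.Real_Asymp"
begin

text \<open>
  Let $p \equiv 1 \pmod{12}$ be prime. A root $y$ modulo $p$ satisfies $y^4 = 4t(2-t)^3$ for a square root
  $t$ of $3$; as $2(2-t) = (t-1)^2$, this makes $2t$ and hence $\sqrt{-3}$ a square modulo $p$. Writing
  $p = u^2 + 3v^2$, quadratic reciprocity identifies the Legendre symbol of $\sqrt{-3} \equiv u/v$ with the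
  value \<open>eta\<close> at a prime above $p$ of a quadratic character modulo $12$ of the ring $Z[\omega]$ of
  Eisenstein integers. So a prime $p \equiv c \pmod{12d}$ at which this value is $-1$ is needed. With the
  weights $(s-1) p^{-s} \log p$, the primes $p \equiv c$ have a positive total as $s \to 1$ by Dirichlet's
  theorem, whereas the same sum twisted by \<open>eta\<close> tends to $0$, because $L(s, \eta \cdot \psi \circ N)$ is
  holomorphic and nonzero at $1$ for every Dirichlet character $\psi$ modulo $12d$.

  No logarithm of an $L$-function is taken: $(s-1) L'/L$ tends to the order of the zero at $1$, and
  positivity forces this order to be $0$. For real Dirichlet characters positivity does not suffice, and
  Monsky's argument with Lambert series is used instead.
\<close>

section \<open>Dirichlet series over rings with unique factorization\<close>

text \<open>With t^2 = 3 the polynomial factors as (y^4 + 180 - 104 t)(y^4 + 180 + 104 t), and 104 t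
  - 180 = 4 t (2 - t)^3. As p = 1 (mod 4), there is i with i^2 = -1, and t = i s with s^2 = -3; then
  2 t = (1 + i)^2 s, which is how s becomes a square. Up to sign s is u/v, so its Legendre symbol is
  that of u v. The decisive property of \<open>eta\<close> is that it is no function of the norm:
  conjugation changes its sign at elements of norm 3 modulo 4. Hence its product with any Dirichlet
  character of the norm sums to 0 over the residue classes, whatever d is; this cancellation carries
  the series to Re s > 1/2, past the point 1. Positivity suffices for \<open>eta\<close> because the
  two primes above a prime p = 1 (mod 12) have equal \<open>eta\<close>. Their sum a_p is then 2 or
  -2, so that a_p^2 + 2 Re (\<psi>(p) a_p) >= 0, and a zero of order k at 1 makes the mean value 1 -
  2 k, which forces k = 0. A real Dirichlet character has values 1 and -1 and yields only 1 - k >=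
  0, which leaves k = 1 open.\<close>

lemma norm_of_nat_powr: "norm (of_nat n powr s :: complex) = real n powr Re s"
  by (subst norm_powr_real_powr) auto

text \<open>Mean value inequality on [m, \<infinity>): the derivative -s x^(-s-1) has norm at most
  |s| m^(-Re s - 1) there, because Re s >= 0.\<close>

lemma norm_powr_diff_le:
  fixes A B m :: real and s :: complex
  assumes "m > 0" "A \<ge> m" "B \<ge> m" "Re s \<ge> 0"
  shows "norm (of_real A powr (-s) - of_real B powr (-s)) \<le> norm s * \<bar>A - B\<bar> * m powr (- Re s - 1)"
proof -
  define f where "f = (\<lambda>x::real. (of_real x :: complex) powr (-s))"
  define f' where "f' = (\<lambda>x::real. -s * of_real x powr (-s-1))"
  have der: "(f has_vector_derivative f' x) (at x within {m..})" if "x \<in> {m..}" for x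
    unfolding f_def f'_def using that assms
    by (intro has_vector_derivative_real_field has_field_derivative_powr) auto
  have "norm (f A - f B) \<le> (norm s * m powr (- Re s - 1)) * norm (A - B)"
  proof (rule differentiable_bound[where S = "{m..}" and f' = "\<lambda>x h. h *\<^sub>R f' x"])
    fix x assume x: "x \<in> {m..}"
    show "(f has_derivative (\<lambda>h. h *\<^sub>R f' x)) (at x within {m..})"
      using der[OF x] by (simp add: has_vector_derivative_def)
    have "x powr (-Re s - 1) \<le> m powr (-Re s - 1)"
      using x assms by (intro powr_mono2') auto
    then have *: "norm (f' x) \<le> norm s * m powr (- Re s - 1)"
      using x assms unfolding f'_def
      by (simp add: norm_mult norm_powr_real_powr mult_left_mono)
    show "onorm (\<lambda>h. h *\<^sub>R f' x) \<le> norm s * m powr (- Re s - 1)"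
      by (rule onorm_bound) (use * in \<open>auto simp: mult.commute mult_left_mono\<close>)
  qed (use assms in auto)
  then show ?thesis by (simp add: f_def mult_ac)
qed

text \<open>Since the coefficients of a block add up to $0$, every term of the block may be compared with the
  same power of \<open>X0 u\<close>, which gains a factor \<open>W u powr (-1/2)\<close>.\<close>

lemma block_series_holomorphic:
  fixes c :: "'r \<Rightarrow> complex" and X :: "'u \<Rightarrow> 'r \<Rightarrow> real" and X0 W :: "'u \<Rightarrow> real" and k K :: real
  assumes fin: "finite R" and sum0: "(\<Sum>r\<in>R. c r) = 0"
    and W1: "\<And>u. W u \<ge> 1" and k: "0 < k" "k \<le> 1" and K: "K \<ge> 0"
    and X0: "\<And>u. X0 u \<ge> k * W u"
    and X: "\<And>u r. r \<in> R \<Longrightarrow> c r \<noteq> 0 \<Longrightarrow> X u r \<ge> k * W u"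
    and D: "\<And>u r. r \<in> R \<Longrightarrow> c r \<noteq> 0 \<Longrightarrow> \<bar>X u r - X0 u\<bar> \<le> K * W u powr (1/2)"
    and summ: "\<And>\<kappa>. \<kappa> > 1 \<Longrightarrow> (\<lambda>u. W u powr (-\<kappa>)) summable_on UNIV"
  shows "(\<lambda>s. \<Sum>\<^sub>\<infinity>u. \<Sum>r\<in>R. c r * of_real (X u r) powr (-s)) holomorphic_on {s. Re s > 1/2}"
    and "Re s > 1/2 \<Longrightarrow> (\<lambda>u. \<Sum>r\<in>R. c r * of_real (X u r) powr (-s)) summable_on UNIV"
proof -
  define g where "g = (\<lambda>u s. \<Sum>r\<in>R. c r * of_real (X u r) powr (-s))"
  have bound: "norm (g u s) \<le> (\<Sum>r\<in>R. norm (c r)) * (B * K * k powr (-B-1)) * W u powr (-(1+\<delta>))"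
    if s: "Re s \<ge> 1/2 + \<delta>" "norm s \<le> B" "\<delta> > 0" for u s \<delta> B
  proof -
    have kW: "0 < k * W u" using k W1[of u] by simp
    have B: "B \<ge> 0" using s by (meson norm_ge_zero order_trans)
    have ReB: "Re s \<le> B" using s complex_Re_le_cmod order_trans by blast
    have "(k * W u) powr (-Re s - 1) = k powr (-Re s - 1) * W u powr (-Re s - 1)"
      using k W1[of u] by (simp add: powr_mult)
    \<comment> \<open>This makes the bound uniform in s: as k <= 1, its power is largest at the
      smallest exponent -B-1, whereas W u >= 1 calls for the largest one.\<close>
    also have "\<dots> \<le> k powr (-B-1) * W u powr (-(1+\<delta>) - 1/2)"
      using k W1[of u] s ReB
      by (intro mult_mono powr_mono' powr_mono) auto
    finally have pw: "(k * W u) powr (-Re s - 1) \<le> k powr (-B-1) * W u powr (-(1+\<delta>) - 1/2)" .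
    have "g u s = (\<Sum>r\<in>R. c r * (of_real (X u r) powr (-s) - of_real (X0 u) powr (-s)))"
      using sum0 by (simp add: g_def algebra_simps sum_subtractf flip: sum_distrib_left sum_distrib_right)
    also have "norm \<dots> \<le> (\<Sum>r\<in>R. norm (c r) * (B * K * k powr (-B-1) * W u powr (-(1+\<delta>))))"
    proof (rule sum_norm_le)
      fix r assume r: "r \<in> R"
      show "norm (c r * (of_real (X u r) powr (-s) - of_real (X0 u) powr (-s)))
              \<le> norm (c r) * (B * K * k powr (-B-1) * W u powr (-(1+\<delta>)))"
      \<comment> \<open>No lower bound for \<open>X u r\<close> is available when
        \<open>c r = 0\<close>: the block of Eisenstein integers at the origin contains 0, of norm
        0, where the character vanishes.\<close>
      proof (cases "c r = 0")
        case False
        have "norm (of_real (X u r) powr (-s) - of_real (X0 u) powr (-s))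
                \<le> norm s * \<bar>X u r - X0 u\<bar> * (k * W u) powr (- Re s - 1)"
          using kW X0 X[OF r False] s by (intro norm_powr_diff_le) auto
        also have "\<dots> \<le> B * (K * W u powr (1/2)) * (k powr (-B-1) * W u powr (-(1+\<delta>) - 1/2))"
          using s B K D[OF r False] pw by (intro mult_mono) auto
        also have "\<dots> = B * K * k powr (-B-1) * (W u powr (1/2) * W u powr (-(1+\<delta>) - 1/2))"
          by (simp add: mult_ac)
        also have "W u powr (1/2) * W u powr (-(1+\<delta>) - 1/2) = W u powr (-(1+\<delta>))"
          using W1[of u] by (simp add: powr_add[symmetric] algebra_simps)
        finally show ?thesis by (simp add: norm_mult mult_left_mono)
      qed auto
    qed
    also have "\<dots> = (\<Sum>r\<in>R. norm (c r)) * (B * K * k powr (-B-1)) * W u powr (-(1+\<delta>))"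
      by (simp only: sum_distrib_right mult.assoc)
    finally show ?thesis .
  qed
  have sm: "(\<lambda>u. C * W u powr (-(1+\<delta>))) summable_on UNIV" if "\<delta> > 0" for C \<delta>
    using that by (intro summable_on_cmult_right summ) auto
  show "(\<lambda>u. \<Sum>r\<in>R. c r * of_real (X u r) powr (-s)) summable_on UNIV" if s: "Re s > 1/2" for s
  proof -
    define \<delta> where "\<delta> = Re s - 1/2"
    have le: "norm (g u s) \<le> (\<Sum>r\<in>R. norm (c r)) * (norm s * K * k powr (-norm s-1)) * W u powr (-(1+\<delta>))" for u
      by (intro bound) (use s in \<open>auto simp: \<delta>_def\<close>)
    have "(\<lambda>u. norm (g u s)) summable_on UNIV"
      by (rule Infinite_Sum.abs_summable_on_comparison_test'[OF sm le]) (use s in \<open>simp add: \<delta>_def\<close>)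
    then show ?thesis unfolding g_def by (rule abs_summable_summable)
  qed
  have "(\<lambda>s. \<Sum>\<^sub>\<infinity>u. g u s) field_differentiable at s0" if s0: "Re s0 > 1/2" for s0
  proof -
    define \<delta> where "\<delta> = (Re s0 - 1/2) / 2"
    have \<delta>: "\<delta> > 0" using s0 by (simp add: \<delta>_def)
    have cb: "Re s \<ge> 1/2 + \<delta> \<and> norm s \<le> norm s0 + \<delta>" if "s \<in> cball s0 \<delta>" for s
    proof
      have "\<bar>Re s0 - Re s\<bar> \<le> norm (s0 - s)" using abs_Re_le_cmod[of "s0 - s"] by simp
      moreover have "norm (s0 - s) \<le> \<delta>" using that by (simp add: dist_norm)
      ultimately have "\<bar>Re s0 - Re s\<bar> \<le> (Re s0 - 1/2) / 2" unfolding \<delta>_def by (rule order_trans)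
      then show "Re s \<ge> 1/2 + \<delta>" unfolding \<delta>_def by argo
      have "norm s \<le> norm s0 + norm (s - s0)" by (metis norm_triangle_sub)
      with that show "norm s \<le> norm s0 + \<delta>" by (auto simp: dist_norm norm_minus_commute)
    qed
    \<comment> \<open>On a ball reaching halfway to the line Re s = 1/2 the bound depends on u
      alone, so the M-test applies and the limit of the finite sums is holomorphic.\<close>
    have ul: "uniform_limit (cball s0 \<delta>) (\<lambda>U s. \<Sum>u\<in>U. g u s) (\<lambda>s. \<Sum>\<^sub>\<infinity>u. g u s) (finite_subsets_at_top UNIV)"
      by (rule Weierstrass_m_test_general[OF _ sm[OF \<delta>]], rule bound) (use cb \<delta> in auto)
    have hol: "g u holomorphic_on T" for u T
    proof -
      have "(\<lambda>s. of_real (X u r) powr (-s)) holomorphic_on T" for r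
        by (cases "X u r = 0") (auto intro!: holomorphic_intros)
      then show ?thesis unfolding g_def by (intro holomorphic_intros)
    qed
    have ev: "\<forall>\<^sub>F n in finite_subsets_at_top UNIV. continuous_on (cball s0 \<delta>) (\<lambda>s. \<Sum>u\<in>n. g u s) \<and> (\<lambda>s. \<Sum>u\<in>n. g u s) holomorphic_on ball s0 \<delta>"
      by (intro always_eventually allI conjI holomorphic_on_imp_continuous_on holomorphic_intros hol)
    have "(\<lambda>s. \<Sum>\<^sub>\<infinity>u. g u s) holomorphic_on ball s0 \<delta>"
      by (rule holomorphic_uniform_limit[OF ev ul]) auto
    then show ?thesis
      using \<delta> by (meson centre_in_ball holomorphic_on_imp_differentiable_at open_ball)
  qed
  then show "(\<lambda>s. \<Sum>\<^sub>\<infinity>u. \<Sum>r\<in>R. c r * of_real (X u r) powr (-s)) holomorphic_on {s. Re s > 1/2}"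
    unfolding g_def holomorphic_on_def by (blast intro: field_differentiable_at_within)
qed

text \<open>If L = (s - 1)^k g with g nonzero at 1, then (s - 1) L'/L = k + (s - 1) g'/g. The point
  \<open>s0\<close> excludes that L vanishes identically: the half-plane is connected, so a zero at
  1 has finite order.\<close>

lemma zero_order_residue:
  assumes hol: "L holomorphic_on {s. Re s > 1/2}" and nz: "Re s0 > 1/2" "L s0 \<noteq> 0"
  obtains k :: nat where
    "((\<lambda>x::real. of_real (x - 1) * (deriv L (of_real x) / L (of_real x))) \<longlongrightarrow> of_nat k) (at_right 1)"
    "eventually (\<lambda>x::real. L (of_real x) \<noteq> 0) (at_right 1)" "L 1 \<noteq> 0 \<Longrightarrow> k = 0"
proof -
  let ?S = "{s. Re s > 1/2}"
  have S: "open ?S" "connected ?S"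
    using open_halfspace_Re_gt[of "1/2"] convex_connected[OF convex_halfspace_Re_gt[of "1/2"]] by simp_all
  have tr: "filterlim (\<lambda>x::real. complex_of_real x) (at 1) (at_right 1)"
  proof -
    have "filterlim (\<lambda>x::real. complex_of_real x) (nhds (of_real 1)) (at_right 1)"
      by (intro tendsto_intros)
    then show ?thesis
      unfolding filterlim_at by (auto simp: eventually_at intro!: exI[of _ 1])
  qed
  have main: "\<exists>k::nat. ((\<lambda>w. (w - 1) * (deriv L w / L w)) \<longlongrightarrow> of_nat k) (at 1) \<and>
                 eventually (\<lambda>w. L w \<noteq> 0) (at 1) \<and> (L 1 \<noteq> 0 \<longrightarrow> k = 0)"
  proof (cases "L 1 = 0")
    case False
    have c: "isCont L 1" "isCont (deriv L) 1"
      using S hol by (auto intro!: holomorphic_on_imp_continuous_on holomorphic_deriv continuous_on_interior simp: interior_open)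
    have "((\<lambda>w. (w - 1) * (deriv L w / L w)) \<longlongrightarrow> (1 - 1) * (deriv L 1 / L 1)) (at 1)"
      using c False by (intro tendsto_intros) (auto simp: isCont_def)
    moreover have "eventually (\<lambda>w. L w \<noteq> 0) (at 1)"
      using c(1) False tendsto_imp_eventually_ne unfolding isCont_def by blast
    ultimately show ?thesis by (intro exI[of _ 0]) auto
  next
    case True
    have nc: "\<not> L constant_on ?S"
    proof
      assume "L constant_on ?S"
      then obtain y where y: "\<And>x. x \<in> ?S \<Longrightarrow> L x = y" unfolding constant_on_def by blast
      then show False using y[of 1] y[of s0] True nz by auto
    qed
    have one: "(1::complex) \<in> ?S" by simp
    obtain g r n where g: "0 < n" "0 < r" "ball 1 r \<subseteq> ?S" "g holomorphic_on ball 1 r"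
      "\<And>w. w \<in> ball 1 r \<Longrightarrow> L w = (w - 1)^n * g w" "\<And>w. w \<in> ball 1 r \<Longrightarrow> g w \<noteq> 0"
      by (rule holomorphic_factor_zero_nonconstant[OF hol S one True nc]) metis
    have ev: "eventually (\<lambda>w. w \<in> ball 1 r - {1}) (at (1::complex))"
      using g(2) by (auto simp: eventually_at dist_commute intro!: exI[of _ r])
    have eq: "(w - 1) * (deriv L w / L w) = of_nat n + (w - 1) * (deriv g w / g w)"
      if w: "w \<in> ball 1 r - {1}" for w
    proof -
      have dg: "(g has_field_derivative deriv g w) (at w)"
        using g w by (auto intro!: holomorphic_derivI[of _ "ball 1 r"])
      have "((\<lambda>w. (w - 1)^n * g w) has_field_derivative
              (of_nat n * (w - 1)^(n-1) * g w + deriv g w * (w - 1)^n)) (at w)"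
        by (rule derivative_eq_intros refl dg | simp)+
      then have "(L has_field_derivative
              (of_nat n * (w - 1)^(n-1) * g w + deriv g w * (w - 1)^n)) (at w)"
        by (rule has_field_derivative_transform_within_open[where S = "ball 1 r"]) (use w g in auto)
      then have "deriv L w = of_nat n * (w - 1)^(n-1) * g w + deriv g w * (w - 1)^n"
        by (rule DERIV_imp_deriv)
      moreover have "(w - 1)^n = (w - 1) * (w - 1)^(n-1)" using g(1) by (simp add: power_eq_if)
      moreover define z Q where "z = w - 1" and "Q = (w - 1)^(n-1)"
      ultimately have "deriv L w = of_nat n * Q * g w + deriv g w * (z * Q)" "L w = z * Q * g w" "z \<noteq> 0" "Q \<noteq> 0"
        using w g(5)[of w] by auto
      then show ?thesis using w g(6)[of w] unfolding z_def[symmetric] by (simp add: field_simps)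
    qed
    have c: "isCont g 1" "isCont (deriv g) 1"
      using g by (auto intro!: holomorphic_on_imp_continuous_on holomorphic_deriv continuous_on_interior[of "ball 1 r"])
    have "((\<lambda>w. of_nat n + (w - 1) * (deriv g w / g w)) \<longlongrightarrow> of_nat n + (1 - 1) * (deriv g 1 / g 1)) (at 1)"
      using c g(2) g(6)[of 1] by (intro tendsto_intros) (auto simp: isCont_def)
    then have "((\<lambda>w. (w - 1) * (deriv L w / L w)) \<longlongrightarrow> of_nat n + (1 - 1) * (deriv g 1 / g 1)) (at 1)"
      by (rule Lim_transform_eventually) (use ev in eventually_elim, use eq in auto)
    moreover have "eventually (\<lambda>w. L w \<noteq> 0) (at 1)"
      using ev by eventually_elim (use g in auto)
    ultimately show ?thesis using True by (intro exI[of _ n]) auto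
  qed
  then obtain k :: nat where k: "((\<lambda>w. (w - 1) * (deriv L w / L w)) \<longlongrightarrow> of_nat k) (at 1)"
     "eventually (\<lambda>w. L w \<noteq> 0) (at 1)" "L 1 \<noteq> 0 \<Longrightarrow> k = 0" by blast
  show ?thesis
    by (rule that[of k])
       (use filterlim_compose[OF k(1) tr] k(3) eventually_compose_filterlim[OF k(2) tr] in \<open>auto\<close>)
qed


section \<open>Logarithmic derivatives of Dirichlet series\<close>

locale normed_factorial =
  fixes N :: "'a::factorial_semiring \<Rightarrow> nat"
  assumes N_mult: "N (a * b) = N a * N b"
    and N_eq_1_iff: "N a = 1 \<longleftrightarrow> is_unit a"
    and N_eq_0_iff: "N a = 0 \<longleftrightarrow> a = 0"
    and N_summable: "\<kappa> > 1 \<Longrightarrow> (\<lambda>a. real (N a) powr (-\<kappa>)) summable_on UNIV"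
begin

lemma N_0: "N 0 = 0" and N_1: "N 1 = 1"
  using N_eq_0_iff N_eq_1_iff by auto

lemma N_power: "N (a ^ k) = N a ^ k"
  by (induction k) (auto simp: N_mult N_1)

lemma N_prod: "N (\<Prod>x\<in>A. g x) = (\<Prod>x\<in>A. N (g x))"
  by (induction A rule: infinite_finite_induct) (auto simp: N_mult N_1)

lemma N_normalize: "N (normalize a) = N a"
proof (cases "a = 0")
  case False
  have "N a = N (unit_factor a) * N (normalize a)"
    by (metis N_mult unit_factor_mult_normalize)
  also have "N (unit_factor a) = 1"
    using False by (simp only: N_eq_1_iff) auto
  finally show ?thesis by simp
qed auto

lemma N_prime_ge_2:
  assumes "prime p" shows "N p \<ge> 2"
proof -
  have "N p \<noteq> 0" "N p \<noteq> 1" using assms N_eq_0_iff N_eq_1_iff by auto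
  then show ?thesis by linarith
qed

definition prime_powers :: "('a \<times> nat) set" where
  "prime_powers = {(p, k). prime p \<and> k \<ge> 1}"

text \<open>This is the identity log = \<Lambda> * 1: a prime p contributes log N p once for each k
  up to its multiplicity in a. The predicate \<open>prime\<close> admits only normalized elements,
  so that each class of associated primes counts once.\<close>

lemma ln_N_eq:
  assumes "a \<noteq> 0"
  shows "finite {(p, k) \<in> prime_powers. p ^ k dvd a}"
    and "(\<Sum>(p, k) \<in> {(p, k) \<in> prime_powers. p ^ k dvd a}. ln (real (N p))) = ln (real (N a))"
proof -
  have eq: "{(p, k) \<in> prime_powers. p ^ k dvd a} = (SIGMA p:prime_factors a. {1..multiplicity p a})"
  proof (intro equalityI subsetI)
    fix x assume "x \<in> {(p, k) \<in> prime_powers. p ^ k dvd a}"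
    then obtain p k where x: "x = (p, k)" "prime p" "k \<ge> 1" "p ^ k dvd a"
      by (auto simp: prime_powers_def)
    have "p dvd a" using x(3,4) by (metis dvd_power dvd_trans less_le_trans zero_less_one)
    moreover have "k \<le> multiplicity p a"
      using x assms by (subst power_dvd_iff_le_multiplicity[symmetric]) auto
    ultimately show "x \<in> (SIGMA p:prime_factors a. {1..multiplicity p a})"
      using x assms by (auto simp: prime_factors_dvd)
  next
    fix x assume "x \<in> (SIGMA p:prime_factors a. {1..multiplicity p a})"
    then show "x \<in> {(p, k) \<in> prime_powers. p ^ k dvd a}"
      by (auto simp: prime_powers_def prime_factors_dvd intro: multiplicity_dvd')
  qed
  show "finite {(p, k) \<in> prime_powers. p ^ k dvd a}" unfolding eq by auto
  have "N a = N (prod_mset (prime_factorization a))"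
    by (metis N_normalize assms prod_mset_prime_factorization_weak)
  also have "\<dots> = (\<Prod>p\<in>prime_factors a. N p ^ count (prime_factorization a) p)"
    by (simp add: prod_mset_multiplicity N_prod N_power)
  also have "\<dots> = (\<Prod>p\<in>prime_factors a. N p ^ multiplicity p a)"
    by (intro prod.cong) (auto simp: count_prime_factorization_prime in_prime_factors_imp_prime)
  finally have "real (N a) = (\<Prod>p\<in>prime_factors a. real (N p) ^ multiplicity p a)" by simp
  then have "ln (real (N a)) = (\<Sum>p\<in>prime_factors a. ln (real (N p) ^ multiplicity p a))"
    by (simp only:) (intro ln_prod, auto simp: N_eq_0_iff)
  also have "\<dots> = (\<Sum>p\<in>prime_factors a. \<Sum>k\<in>{1..multiplicity p a}. ln (real (N p)))"
    by (intro sum.cong refl) (auto simp: ln_realpow N_eq_0_iff)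
  also have "\<dots> = (\<Sum>(p, k) \<in> (SIGMA p:prime_factors a. {1..multiplicity p a}). ln (real (N p)))"
    by (subst sum.Sigma) auto
  finally show "(\<Sum>(p, k) \<in> {(p, k) \<in> prime_powers. p ^ k dvd a}. ln (real (N p))) = ln (real (N a))"
    unfolding eq by simp
qed

lemma ln_N_le: "\<epsilon> > 0 \<Longrightarrow> ln (real (N a)) \<le> real (N a) powr \<epsilon> / \<epsilon>"
  by (cases "N a = 0") (auto intro: ln_powr_bound)

lemma ln_N_nonneg: "ln (real (N a)) \<ge> 0"
  by (cases "N a = 0") auto

lemma N_ln_summable:
  assumes "\<kappa> > 1"
  shows "(\<lambda>a. ln (real (N a)) * real (N a) powr (-\<kappa>)) summable_on UNIV"
proof -
  \<comment> \<open>Half of the room above 1 absorbs the logarithm, the other half keeps the sum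
    convergent.\<close>
  define \<epsilon> where "\<epsilon> = (\<kappa> - 1) / 2"
  have \<epsilon>: "\<epsilon> > 0" "\<kappa> - \<epsilon> > 1" using assms by (auto simp: \<epsilon>_def field_simps)
  show ?thesis
  proof (rule summable_on_comparison_test)
    show "(\<lambda>a. (1/\<epsilon>) * real (N a) powr (-(\<kappa> - \<epsilon>))) summable_on UNIV"
      by (intro summable_on_cmult_right N_summable \<epsilon>)
    fix a
    have "ln (real (N a)) * real (N a) powr (-\<kappa>) \<le> (real (N a) powr \<epsilon> / \<epsilon>) * real (N a) powr (-\<kappa>)"
      by (intro mult_right_mono ln_N_le \<epsilon>) auto
    also have "\<dots> = (1/\<epsilon>) * real (N a) powr (-(\<kappa> - \<epsilon>))"
      by (simp add: powr_add[symmetric] field_simps)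
    finally show "ln (real (N a)) * real (N a) powr (-\<kappa>) \<le> (1/\<epsilon>) * real (N a) powr (-(\<kappa> - \<epsilon>))" .
  qed (use ln_N_nonneg in auto)
qed

text \<open>The powers k >= 2 are summed at the exponent 1 itself, so that one number bounds their
  part in the logarithmic derivative for every x > 1. The geometric series over k is at most 2 (N
  p)^(-2), since N p >= 2.\<close>

lemma higher_prime_powers_summable:
  "(\<lambda>(p, k). ln (real (N p)) * real (N p) powr (- real k)) summable_on {(p, k). prime p \<and> k \<ge> 2}"
proof -
  have eq: "{(p, k). prime p \<and> k \<ge> (2::nat)} = (SIGMA p:{p. prime p}. {2..})" by auto
  show ?thesis unfolding eq
  proof (rule summable_on_SigmaI)
    fix p :: 'a assume p: "p \<in> {p. prime p}"
    define x where "x = 1 / real (N p)"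
    have x: "0 < x" "x \<le> 1/2" "norm x < 1" using N_prime_ge_2[of p] p by (auto simp: x_def field_simps)
    have "((\<lambda>k. x ^ k) has_sum x ^ 2 / (1 - x)) {2..}"
    proof -
      have "((\<lambda>k. x\<^sup>2 * x ^ k) has_sum (x\<^sup>2 * (1 / (1 - x)))) UNIV"
        by (intro has_sum_cmult_right norm_summable_imp_has_sum)
           (use x geometric_sums[of x] in \<open>auto simp: summable_geometric_iff norm_power[symmetric]\<close>)
      also have "(\<lambda>k. x\<^sup>2 * x ^ k) = (\<lambda>k. x ^ (k + 2))" by (auto simp: power_add mult_ac power2_eq_square)
      also have "((\<lambda>k. x ^ (k + 2)) has_sum (x\<^sup>2 * (1 / (1 - x)))) UNIV \<longleftrightarrow> ?thesis"
        by (subst has_sum_reindex_bij_betw[where B = "{2..}"])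
           (auto intro!: bij_betwI[where g = "\<lambda>k. k - 2"])
      finally show ?thesis .
    qed
    then have "((\<lambda>k. ln (real (N p)) * x ^ k) has_sum (ln (real (N p)) * (x ^ 2 / (1 - x)))) {2..}"
      by (rule has_sum_cmult_right)
    also have "(\<lambda>k. ln (real (N p)) * x ^ k) = (\<lambda>k. case (p, k) of (p, k) \<Rightarrow> ln (real (N p)) * real (N p) powr (- real k))"
      using x unfolding x_def
      by (auto simp: powr_minus powr_realpow power_divide field_simps)
    finally show "((\<lambda>k. case (p, k) of (p, k) \<Rightarrow> ln (real (N p)) * real (N p) powr (- real k)) has_sum
        (ln (real (N p)) * ((1 / real (N p)) ^ 2 / (1 - 1 / real (N p))))) {2..}" by (simp add: x_def)
  next
    show "(\<lambda>p. ln (real (N p)) * ((1 / real (N p)) ^ 2 / (1 - 1 / real (N p)))) summable_on {p. prime p}"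
    proof (rule summable_on_comparison_test)
      show "(\<lambda>p. 2 * (ln (real (N p)) * real (N p) powr (-2))) summable_on {p. prime p}"
        by (intro summable_on_cmult_right summable_on_subset_banach[OF N_ln_summable]) auto
      fix p :: 'a assume "p \<in> {p. prime p}"
      then have p: "real (N p) \<ge> 2" using N_prime_ge_2[of p] by auto
      have "(1 / real (N p)) ^ 2 / (1 - 1 / real (N p)) \<le> (1 / real (N p)) ^ 2 / (1/2)"
        using p by (intro divide_left_mono) (auto simp: field_simps)
      also have "\<dots> = 2 * real (N p) powr (-2)"
        using p by (simp add: powr_minus powr_numeral power_divide field_simps)
      finally have "ln (real (N p)) * ((1 / real (N p)) ^ 2 / (1 - 1 / real (N p)))
         \<le> ln (real (N p)) * (2 * real (N p) powr (-2))"
        by (rule mult_left_mono) (rule ln_N_nonneg)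
      then show "ln (real (N p)) * ((1 / real (N p)) ^ 2 / (1 - 1 / real (N p)))
         \<le> 2 * (ln (real (N p)) * real (N p) powr (-2))"
        by (simp add: mult_ac)
      show "0 \<le> ln (real (N p)) * ((1 / real (N p)) ^ 2 / (1 - 1 / real (N p)))"
        using p ln_N_nonneg[of p] by (intro mult_nonneg_nonneg) (auto simp: field_simps)
    qed
  qed (use ln_N_nonneg in auto)
qed

end

definition dirichlet_series :: "('a \<Rightarrow> nat) \<Rightarrow> ('a \<Rightarrow> complex) \<Rightarrow> complex \<Rightarrow> complex" where
  "dirichlet_series N f s = (\<Sum>\<^sub>\<infinity>a. f a * of_nat (N a) powr (-s))"

definition prime_log_sum :: "('a::factorial_semiring \<Rightarrow> nat) \<Rightarrow> ('a \<Rightarrow> complex) \<Rightarrow> real \<Rightarrow> complex" where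
  "prime_log_sum N f x = (\<Sum>\<^sub>\<infinity>p\<in>{p. prime p}. f p * of_real (ln (real (N p)) * real (N p) powr (-x)))"

text \<open>Being trivial on units, f is in effect a function on the nonzero principal ideals. The
  series below run over all elements nevertheless: 0 drops out because \<open>0 powr s = 0\<close>,
  and each ideal is counted once per unit, a constant factor which disappears in L'/L.\<close>

locale normed_character = normed_factorial N for N :: "'a::factorial_semiring \<Rightarrow> nat" +
  fixes f :: "'a \<Rightarrow> complex"
  assumes f_mult: "f (a * b) = f a * f b"
    and f_norm: "norm (f a) \<le> 1"
    and f_unit: "is_unit u \<Longrightarrow> f u = 1"
begin

abbreviation "dseries \<equiv> dirichlet_series N f"

abbreviation "prime_sum \<equiv> prime_log_sum N f"

lemma f_1: "f 1 = 1"
  by (rule f_unit) auto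

lemma f_power: "f (a ^ k) = f a ^ k"
  by (induction k) (auto simp: f_mult f_1)

lemma dseries_abs_summable:
  assumes "Re s > 1"
  shows "(\<lambda>a. norm (f a * of_nat (N a) powr (-s))) summable_on UNIV"
proof (rule Infinite_Sum.abs_summable_on_comparison_test'[OF N_summable[OF assms]])
  fix a
  show "norm (f a * of_nat (N a) powr (-s)) \<le> real (N a) powr (- Re s)"
    using f_norm[of a] by (simp add: norm_mult norm_of_nat_powr mult_left_le_one_le)
qed

lemma dseries_has_sum:
  assumes "Re s > 1"
  shows "((\<lambda>a. f a * of_nat (N a) powr (-s)) has_sum dseries s) UNIV"
  unfolding dirichlet_series_def by (rule has_sum_infsum[OF abs_summable_summable[OF dseries_abs_summable[OF assms]]])

text \<open>The finite partial sums converge uniformly on a ball around \<open>s0\<close>, and for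
  holomorphic functions this carries over to the derivatives.\<close>

lemma deriv_dseries_has_sum:
  assumes s0: "Re s0 > 1"
  shows "((\<lambda>a. - f a * of_real (ln (real (N a))) * of_nat (N a) powr (-s0)) has_sum deriv dseries s0) UNIV"
proof -
  define \<delta> where "\<delta> = (Re s0 - 1) / 2"
  have \<delta>: "\<delta> > 0" using s0 by (simp add: \<delta>_def)
  define g where "g = (\<lambda>a s. f a * of_nat (N a) powr (-s))"
  have cb: "Re s \<ge> 1 + \<delta>" if "s \<in> ball s0 \<delta>" for s
  proof -
    have "\<bar>Re s0 - Re s\<bar> \<le> norm (s0 - s)" using abs_Re_le_cmod[of "s0 - s"] by simp
    moreover have "norm (s0 - s) \<le> \<delta>" using that by (simp add: dist_norm)
      ultimately have "\<bar>Re s0 - Re s\<bar> \<le> (Re s0 - 1) / 2" unfolding \<delta>_def by (rule order_trans)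
      then show "Re s \<ge> 1 + \<delta>" unfolding \<delta>_def by argo
  qed
  have "uniform_limit (ball s0 \<delta>) (\<lambda>A s. \<Sum>a\<in>A. g a s) (\<lambda>s. \<Sum>\<^sub>\<infinity>a. g a s) (finite_subsets_at_top UNIV)"
  proof (rule Weierstrass_m_test_general[OF _ N_summable])
    fix a s assume s: "s \<in> ball s0 \<delta>"
    have "norm (g a s) \<le> real (N a) powr (- Re s)"
      using f_norm[of a] by (simp add: g_def norm_mult norm_of_nat_powr mult_left_le_one_le)
    also have "\<dots> \<le> real (N a) powr (-(1 + \<delta>))"
      using cb[OF s] by (cases "N a = 0") (auto intro!: powr_mono)
    finally show "norm (g a s) \<le> real (N a) powr (-(1 + \<delta>))" .
  qed (use \<delta> in auto)
  then have ul: "uniform_limit (ball s0 \<delta>) (\<lambda>A s. \<Sum>a\<in>A. g a s) dseries (finite_subsets_at_top UNIV)"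
    unfolding dirichlet_series_def[abs_def] g_def .
  have der: "(g a has_field_derivative (- f a * of_real (ln (real (N a))) * of_nat (N a) powr (-s))) (at s)" for a s
  \<comment> \<open>At a = 0 the term is constantly 0, as \<open>0 powr z = 0\<close>, and so is the
    claimed derivative.\<close>
  proof (cases "N a = 0")
    case True
    then show ?thesis by (simp add: g_def)
  next
    case False
    have "((\<lambda>s. of_nat (N a) powr (-s)) has_field_derivative (- Ln (of_nat (N a)) * of_nat (N a) powr (-s))) (at s)"
      using False by (auto intro!: derivative_eq_intros simp: powr_def)
    moreover have "Ln (of_nat (N a)) = of_real (ln (real (N a)))"
      using False by (subst Ln_of_real[symmetric]) auto
    ultimately show ?thesis
      unfolding g_def by (auto intro!: derivative_eq_intros)
  qed
  have hol: "g a holomorphic_on A" for a A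
    using der by (meson field_differentiable_at_within field_differentiable_def holomorphic_on_def)
  have "((\<lambda>A. deriv (\<lambda>s. \<Sum>a\<in>A. g a s) s0) \<longlongrightarrow> deriv dseries s0) (finite_subsets_at_top UNIV)"
    by (rule deriv_complex_uniform_limit[OF ul])
       (use \<delta> in \<open>auto intro!: always_eventually holomorphic_intros hol\<close>)
  moreover have "deriv (\<lambda>s. \<Sum>a\<in>A. g a s) s0 = (\<Sum>a\<in>A. - f a * of_real (ln (real (N a))) * of_nat (N a) powr (-s0))" for A
    by (rule DERIV_imp_deriv) (intro derivative_intros der)
  ultimately show ?thesis unfolding has_sum_def by simp
qed

text \<open>The term of p^k in -L'/L. Pairs (p, k) index the prime powers, which takes the place of
  the von Mangoldt function.\<close>

definition pp_term :: "real \<Rightarrow> 'a \<times> nat \<Rightarrow> complex" where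
  "pp_term x = (\<lambda>(p, k). f p ^ k * of_real (ln (real (N p)) * real (N p) powr (- (real k * x))))"

lemma of_nat_powr_of_real: "of_nat n powr (- of_real x :: complex) = of_real (real n powr (-x))"
  by (metis of_nat_0_le_iff of_real_of_nat_eq powr_of_real of_real_minus)

text \<open>Both sides of $-L' = S \cdot L$ are the sum over all triples $(p, k, b)$ of the term for $a = p^k b$.\<close>

lemma log_derivative:
  assumes x: "x > 1"
  shows "pp_term x summable_on prime_powers"
    and "(\<Sum>\<^sub>\<infinity>pk\<in>prime_powers. pp_term x pk) * dseries (of_real x) = - deriv dseries (of_real x)"
proof -
  let ?A = "UNIV - {0 :: 'a}"
  define Dv where "Dv = (\<lambda>a. {(p, k) \<in> prime_powers. p ^ k dvd a})"
  define g where "g = (\<lambda>(a, (p, k :: nat)). f a * of_real (ln (real (N p)) * real (N a) powr (-x)))"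
  define G where "G = (\<lambda>(a :: 'a, (p, k :: nat)). ln (real (N p)) * real (N a) powr (-x))"
  \<comment> \<open>Absolute convergence over the pairs, with f replaced by its bound 1: it allows
    the sum to be taken in either order.\<close>
  have "G summable_on Sigma ?A Dv"
  proof (rule summable_on_SigmaI)
    fix a assume a: "a \<in> ?A"
    have "((\<lambda>y. G (a, y)) has_sum (\<Sum>y\<in>Dv a. G (a, y))) (Dv a)"
      using ln_N_eq(1)[of a] a by (intro has_sum_finite) (auto simp: Dv_def)
    also have "(\<Sum>y\<in>Dv a. G (a, y)) = (\<Sum>(p, k)\<in>Dv a. ln (real (N p))) * real (N a) powr (-x)"
      unfolding sum_distrib_right by (intro sum.cong) (auto simp: G_def)
    also have "(\<Sum>(p, k)\<in>Dv a. ln (real (N p))) = ln (real (N a))"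
      using ln_N_eq(2)[of a] a unfolding Dv_def by auto
    finally show "((\<lambda>y. G (a, y)) has_sum (ln (real (N a)) * real (N a) powr (-x))) (Dv a)" .
  next
    show "(\<lambda>a. ln (real (N a)) * real (N a) powr (-x)) summable_on ?A"
      by (rule summable_on_subset_banach[OF N_ln_summable[OF x]]) auto
  qed (use ln_N_nonneg in \<open>auto simp: G_def\<close>)
  then have gabs: "(\<lambda>z. norm (g z)) summable_on Sigma ?A Dv"
  proof (rule Infinite_Sum.abs_summable_on_comparison_test')
    fix z assume "z \<in> Sigma ?A Dv"
    show "norm (g z) \<le> G z"
      using f_norm ln_N_nonneg
      by (auto simp: g_def G_def norm_mult abs_mult mult_left_le_one_le split: prod.splits)
  qed
  then obtain S where S: "(g has_sum S) (Sigma ?A Dv)"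
    using abs_summable_summable summable_on_def by blast
  have "((\<lambda>a. f a * of_real (ln (real (N a)) * real (N a) powr (-x))) has_sum S) ?A"
  proof (rule has_sum_SigmaD[OF S])
    fix a assume a: "a \<in> ?A"
    have "((\<lambda>y. g (a, y)) has_sum (\<Sum>y\<in>Dv a. g (a, y))) (Dv a)"
      using ln_N_eq(1)[of a] a by (intro has_sum_finite) (auto simp: Dv_def)
    also have "(\<Sum>y\<in>Dv a. g (a, y)) = f a * of_real ((\<Sum>(p, k)\<in>Dv a. ln (real (N p))) * real (N a) powr (-x))"
      unfolding sum_distrib_right sum_distrib_left of_real_sum by (intro sum.cong) (auto simp: g_def)
    also have "(\<Sum>(p, k)\<in>Dv a. ln (real (N p))) = ln (real (N a))"
      using ln_N_eq(2)[of a] a unfolding Dv_def by auto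
    finally show "((\<lambda>y. g (a, y)) has_sum (f a * of_real (ln (real (N a)) * real (N a) powr (-x)))) (Dv a)" .
  qed
  then have "((\<lambda>a. f a * of_real (ln (real (N a)) * real (N a) powr (-x))) has_sum S) UNIV"
    by (subst has_sum_cong_neutral[where T = ?A and g = "\<lambda>a. f a * of_real (ln (real (N a)) * real (N a) powr (-x))"]) (auto simp: N_0)
  then have "((\<lambda>a. - (f a * of_real (ln (real (N a)) * real (N a) powr (-x)))) has_sum (-S)) UNIV"
    by (rule has_sum_uminusI)
  moreover have "((\<lambda>a. - (f a * of_real (ln (real (N a)) * real (N a) powr (-x)))) has_sum deriv dseries (of_real x)) UNIV"
    using deriv_dseries_has_sum[of "of_real x"] x by (simp add: of_nat_powr_of_real mult_ac)
  ultimately have S_eq: "S = - deriv dseries (of_real x)"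
    using has_sum_unique by fastforce
  define \<phi> where "\<phi> = (\<lambda>((p :: 'a, k :: nat), b). (p ^ k * b, (p, k)))"
  have bij: "bij_betw \<phi> (prime_powers \<times> ?A) (Sigma ?A Dv)"
  proof -
    have "inj_on (\<lambda>((p, k), b). (p ^ k * b, (p, k))) (prime_powers \<times> ?A)"
      by (auto simp: inj_on_def prime_powers_def)
    moreover have "(\<lambda>((p, k), b). (p ^ k * b, (p, k))) ` (prime_powers \<times> ?A) = Sigma ?A Dv"
    proof (intro equalityI subsetI)
      fix y assume "y \<in> Sigma ?A Dv"
      then obtain a p k where y: "y = (a, (p, k))" "a \<noteq> 0" "(p, k) \<in> prime_powers" "p ^ k dvd a"
        by (auto simp: Dv_def)
      then obtain b where "a = p ^ k * b" by blast
      with y show "y \<in> (\<lambda>((p, k), b). (p ^ k * b, (p, k))) ` (prime_powers \<times> ?A)"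
        by (intro image_eqI[of _ _ "((p, k), b)"]) auto
    qed (auto simp: prime_powers_def Dv_def)
    ultimately show ?thesis by (simp add: bij_betw_def \<phi>_def)
  qed
  define h where "h = (\<lambda>(pk, b). pp_term x pk * (f b * of_real (real (N b) powr (-x))))"
  have gh: "g (\<phi> y) = h y" if yA: "y \<in> prime_powers \<times> ?A" for y
  proof -
    obtain p k b where y: "y = ((p, k), b)" "N p \<noteq> 0"
      using yA N_eq_0_iff by (auto simp: prime_powers_def)
    have "real (N (p ^ k * b)) powr (-x) = real (N p) powr (-(real k * x)) * real (N b) powr (-x)"
    proof -
      have "(real (N p) ^ k) powr (-x) = real (N p) powr (-(real k * x))"
        using y(2) by (simp add: powr_realpow[symmetric] powr_powr)
      then show ?thesis by (simp add: N_mult N_power powr_mult)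
    qed
    then show ?thesis
      by (simp add: y \<phi>_def g_def h_def pp_term_def f_mult f_power mult_ac)
  qed
  have h: "(h has_sum S) (prime_powers \<times> ?A)" "(\<lambda>y. norm (h y)) summable_on (prime_powers \<times> ?A)"
  proof -
    have "((\<lambda>y. g (\<phi> y)) has_sum S) (prime_powers \<times> ?A)"
      using S by (rule iffD2[OF has_sum_reindex_bij_betw[OF bij]])
    then show "(h has_sum S) (prime_powers \<times> ?A)"
      by (rule iffD1[OF has_sum_cong[OF gh], rotated])
    have "(\<lambda>y. norm (g (\<phi> y))) summable_on (prime_powers \<times> ?A)"
      using gabs by (rule iffD2[OF summable_on_reindex_bij_betw[OF bij]])
    then show "(\<lambda>y. norm (h y)) summable_on (prime_powers \<times> ?A)"
      by (rule iffD1[OF summable_on_cong, rotated]) (simp only: gh)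
  qed
  \<comment> \<open>Summability of the first factor alone comes from the slice b = 1, where
    \<open>f 1 = 1\<close> and \<open>N 1 = 1\<close>.\<close>
  have "h summable_on (\<lambda>pk. (pk, 1)) ` prime_powers"
    by (rule summable_on_subset_banach[OF abs_summable_summable[OF h(2)]]) auto
  then have "(h \<circ> (\<lambda>pk. (pk, 1))) summable_on prime_powers"
    by (subst (asm) summable_on_reindex) (auto simp: inj_on_def)
  then show summ: "pp_term x summable_on prime_powers"
    by (simp add: h_def o_def f_1 N_1)
  have "((\<lambda>b. f b * of_real (real (N b) powr (-x))) has_sum dseries (of_real x)) UNIV"
    using dseries_has_sum[of "of_real x"] x by (simp add: of_nat_powr_of_real)
  then have dA: "((\<lambda>b. f b * of_real (real (N b) powr (-x))) has_sum dseries (of_real x)) ?A"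
    by (subst has_sum_cong_neutral[where T = UNIV and g = "\<lambda>b. f b * of_real (real (N b) powr (-x))"]) (auto simp: N_0)
  have "((\<lambda>pk. pp_term x pk * dseries (of_real x)) has_sum S) prime_powers"
    by (rule has_sum_SigmaD[OF h(1)]) (use has_sum_cmult_right[OF dA] in \<open>simp add: h_def\<close>)
  moreover have "((\<lambda>pk. pp_term x pk * dseries (of_real x)) has_sum ((\<Sum>\<^sub>\<infinity>pk\<in>prime_powers. pp_term x pk) * dseries (of_real x))) prime_powers"
    by (intro has_sum_cmult_left has_sum_infsum summ)
  ultimately show "(\<Sum>\<^sub>\<infinity>pk\<in>prime_powers. pp_term x pk) * dseries (of_real x) = - deriv dseries (of_real x)"
    using S_eq has_sum_unique by blast
qed

lemma prime_sum_summable: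
  assumes "x > 1"
  shows "(\<lambda>p. f p * of_real (ln (real (N p)) * real (N p) powr (-x))) summable_on A"
proof -
  have "(\<lambda>p. f p * of_real (ln (real (N p)) * real (N p) powr (-x))) summable_on UNIV"
  proof (rule abs_summable_summable, rule Infinite_Sum.abs_summable_on_comparison_test'[OF N_ln_summable[OF assms]])
    fix p
    show "norm (f p * of_real (ln (real (N p)) * real (N p) powr (-x))) \<le> ln (real (N p)) * real (N p) powr (-x)"
      using f_norm[of p] ln_N_nonneg[of p] by (simp add: norm_mult abs_mult mult_left_le_one_le)
  qed
  then show ?thesis by (rule summable_on_subset_banach) auto
qed

text \<open>A bound independent of x is what matters: it disappears after multiplication by x -
  1.\<close>

lemma prime_sum_approx:
  obtains C where "\<And>x. x > 1 \<Longrightarrow> norm ((\<Sum>\<^sub>\<infinity>pk\<in>prime_powers. pp_term x pk) - prime_sum x) \<le> C"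
proof
  let ?I = "{(p :: 'a, k :: nat). prime p \<and> k \<ge> 2}"
  define H where "H = (\<lambda>(p :: 'a, k). ln (real (N p)) * real (N p) powr (- real k))"
  fix x :: real assume x: "x > 1"
  have I: "prime_powers = (\<lambda>p. (p, 1)) ` {p. prime p} \<union> ?I"
    by (auto simp: prime_powers_def)
  have s1: "pp_term x summable_on (\<lambda>p. (p, 1)) ` {p. prime p}" and s2: "pp_term x summable_on ?I"
    by (rule summable_on_subset_banach[OF log_derivative(1)[OF x]]; use I in blast)+
  have "(\<Sum>\<^sub>\<infinity>pk\<in>prime_powers. pp_term x pk) = infsum (pp_term x) ((\<lambda>p. (p, 1)) ` {p. prime p}) + infsum (pp_term x) ?I"
    unfolding I by (rule infsum_Un_disjoint[OF s1 s2]) auto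
  also have "infsum (pp_term x) ((\<lambda>p. (p, 1)) ` {p. prime p}) = prime_sum x"
    unfolding prime_log_sum_def by (subst infsum_reindex) (auto simp: inj_on_def o_def pp_term_def)
  finally have "(\<Sum>\<^sub>\<infinity>pk\<in>prime_powers. pp_term x pk) - prime_sum x = infsum (pp_term x) ?I" by simp
  also have "norm \<dots> \<le> infsum H ?I"
  proof (rule norm_infsum_le[OF has_sum_infsum[OF s2]])
    show "(H has_sum infsum H ?I) ?I"
      unfolding H_def by (rule has_sum_infsum[OF higher_prime_powers_summable])
    fix y assume "y \<in> ?I"
    then obtain p k where y: "y = (p, k)" "prime p" "k \<ge> 2" by auto
    have "real (N p) \<ge> 1" using N_prime_ge_2[OF y(2)] by simp
    then have 1: "real (N p) powr (-(real k * x)) \<le> real (N p) powr (- real k)"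
      using x y by (intro powr_mono) (auto simp: mult_le_cancel_left1)
    have 2: "norm (f p ^ k) \<le> 1" using f_norm[of p] by (simp add: norm_power power_le_one)
    have "norm (pp_term x y) \<le> 1 * (ln (real (N p)) * real (N p) powr (- real k))"
      unfolding y pp_term_def prod.case norm_mult using 1 2 ln_N_nonneg[of p]
      by (intro mult_mono) (auto simp: abs_mult norm_mult mult_left_mono)
    then show "norm (pp_term x y) \<le> H y" by (simp add: y H_def)
  qed
  finally show "norm ((\<Sum>\<^sub>\<infinity>pk\<in>prime_powers. pp_term x pk) - prime_sum x) \<le> infsum H ?I" .
qed

text \<open>As x grows, only the elements of norm 1 survive: there the terms are 1, and the
  remaining ones are at most 2^(2-x) N^(-2). So the series approaches the number of units, which is
  at least 1.\<close>

lemma dseries_nonzero: "\<exists>x>1. dseries (of_real x) \<noteq> 0"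
proof -
  have sm2: "(\<lambda>a. real (N a) powr (-2)) summable_on UNIV" by (rule N_summable) simp
  define C where "C = (\<Sum>\<^sub>\<infinity>a. real (N a) powr (-2))"
  let ?U = "{a. N a = 1}"
  have bound: "norm (dseries (of_real x) - infsum (\<lambda>a. 1 :: complex) ?U) \<le> 2 powr (2 - x) * C" if x: "x > 2" for x
  proof -
    let ?t = "\<lambda>a. f a * of_real (real (N a) powr (-x))"
    have t: "(?t has_sum dseries (of_real x)) UNIV"
      using dseries_has_sum[of "of_real x"] x by (simp add: of_nat_powr_of_real)
    have t1: "?t summable_on ?U" "?t summable_on (- ?U)"
      by (rule summable_on_subset_banach[OF has_sum_imp_summable[OF t]]; simp)+
    have "dseries (of_real x) = infsum ?t (?U \<union> - ?U)"
      using infsumI[OF t] by simp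
    also have "\<dots> = infsum ?t ?U + infsum ?t (-?U)"
      by (rule infsum_Un_disjoint[OF t1]) auto
    also have "infsum ?t ?U = infsum (\<lambda>a. 1) ?U"
    proof (intro infsum_cong)
      fix a assume "a \<in> ?U"
      then have "N a = 1" "is_unit a" using N_eq_1_iff by auto
      then show "?t a = 1" using f_unit by simp
    qed
    finally have "dseries (of_real x) - infsum (\<lambda>a. 1 :: complex) ?U = infsum ?t (-?U)" by simp
    also have "norm \<dots> \<le> infsum (\<lambda>a. 2 powr (2 - x) * real (N a) powr (-2)) (-?U)"
    proof (rule norm_infsum_le[OF has_sum_infsum[OF t1(2)] has_sum_infsum])
      show "(\<lambda>a. 2 powr (2 - x) * real (N a) powr (-2)) summable_on (-?U)"
        by (intro summable_on_cmult_right summable_on_subset_banach[OF sm2]) auto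
      fix a assume a: "a \<in> - ?U"
      show "norm (?t a) \<le> 2 powr (2 - x) * real (N a) powr (-2)"
      proof (cases "N a = 0")
        case False
        with a have N2: "real (N a) \<ge> 2" by simp
        have "norm (?t a) \<le> 1 * real (N a) powr (-x)"
          unfolding norm_mult by (intro mult_mono f_norm) auto
        also have "\<dots> = real (N a) powr (2 - x) * real (N a) powr (-2)"
          by (simp add: powr_add[symmetric])
        also have "\<dots> \<le> 2 powr (2 - x) * real (N a) powr (-2)"
          using x N2 by (intro mult_right_mono powr_mono2') auto
        finally show ?thesis .
      qed auto
    qed
    also have "\<dots> = 2 powr (2 - x) * infsum (\<lambda>a. real (N a) powr (-2)) (-?U)"
      by (rule infsum_cmult_right) (intro summable_on_subset_banach[OF sm2], auto)
    also have "\<dots> \<le> 2 powr (2 - x) * C"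
      unfolding C_def
      by (intro mult_left_mono infsum_mono2 sm2 summable_on_subset_banach[OF sm2]) auto
    finally show ?thesis .
  qed
  \<comment> \<open>Finiteness of the unit group follows from \<open>N_summable\<close>: over the
    units the convergent sum is a sum of ones.\<close>
  have "finite ?U"
  proof -
    have "(\<lambda>a. real (N a) powr (-2)) summable_on ?U" by (rule summable_on_subset_banach[OF sm2]) auto
    also have "?this \<longleftrightarrow> (\<lambda>a::'a. 1 :: real) summable_on ?U" by (intro summable_on_cong) auto
    finally show ?thesis using infsum_diverge_constant[of ?U "1::real"] by fastforce
  qed
  then have cU: "infsum (\<lambda>a. 1 :: complex) ?U = of_nat (card ?U)" "card ?U \<ge> 1"
    by (auto simp: Suc_le_eq card_gt_0_iff simp: N_1 intro!: exI[of _ 1])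
  have "((\<lambda>x. 2 powr (2 - x) * C) \<longlongrightarrow> 0) at_top" by real_asymp
  then have "eventually (\<lambda>x. 2 powr (2 - x) * C < 1) at_top"
    by (rule order_tendstoD) simp
  then have "eventually (\<lambda>x. 2 powr (2 - x) * C < 1 \<and> x > 2) at_top"
    using eventually_gt_at_top[of 2] by eventually_elim auto
  then obtain x where x: "2 powr (2 - x) * C < 1" "x > 2"
    by (metis (mono_tags, lifting) eventually_happens trivial_limit_at_top_linorder)
  have "dseries (of_real x) \<noteq> 0"
  proof
    assume "dseries (of_real x) = 0"
    then have "real (card ?U) < 1" using bound[OF x(2)] x(1) cU(1) by simp
    then show False using cU(2) by simp
  qed
  then show ?thesis using x(2) by (intro exI[of _ x]) auto
qed

text \<open>From L = q D, with D the series, -D'/D = q'/q - L'/L, and the prime sum differs from the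
  left side by a bounded amount. The factor q is there for the zeta function, whose pole at 1 it
  removes; m is then the order of the zero of q.\<close>

theorem prime_sum_residue:
  assumes hol: "L holomorphic_on {s. Re s > 1/2}"
    and qhol: "q holomorphic_on {s. Re s > 1}" and qnz: "\<And>s. Re s > 1 \<Longrightarrow> q s \<noteq> 0"
    and L: "\<And>s. Re s > 1 \<Longrightarrow> L s = q s * dseries s"
    and qlim: "((\<lambda>x::real. of_real (x - 1) * (deriv q (of_real x) / q (of_real x))) \<longlongrightarrow> m) (at_right 1)"
  obtains k :: nat where "((\<lambda>x. of_real (x - 1) * prime_sum x) \<longlongrightarrow> m - of_nat k) (at_right 1)"
    "L 1 \<noteq> 0 \<Longrightarrow> k = 0"
proof -
  obtain x0 where x0: "x0 > 1" "dseries (of_real x0) \<noteq> 0" using dseries_nonzero by blast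
  have nz: "Re (of_real x0) > 1/2" "L (of_real x0) \<noteq> 0"
    using x0 L[of "of_real x0"] qnz[of "of_real x0"] by auto
  obtain k :: nat where k:
    "((\<lambda>x::real. of_real (x - 1) * (deriv L (of_real x) / L (of_real x))) \<longlongrightarrow> of_nat k) (at_right 1)"
    "eventually (\<lambda>x::real. L (of_real x) \<noteq> 0) (at_right 1)" "L 1 \<noteq> 0 \<Longrightarrow> k = 0"
    by (rule zero_order_residue[OF hol nz]) blast
  obtain C where C: "\<And>x. x > 1 \<Longrightarrow> norm ((\<Sum>\<^sub>\<infinity>pk\<in>prime_powers. pp_term x pk) - prime_sum x) \<le> C"
    using prime_sum_approx by blast
  define R where "R = (\<lambda>x. (\<Sum>\<^sub>\<infinity>pk\<in>prime_powers. pp_term x pk) - prime_sum x)"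
  have gt1: "eventually (\<lambda>x::real. x > 1) (at_right 1)"
    by (auto simp: eventually_at_filter)
  have R0: "((\<lambda>x. of_real (x - 1) * R x) \<longlongrightarrow> 0) (at_right 1)"
  proof (rule Lim_null_comparison)
    show "eventually (\<lambda>x. norm (of_real (x - 1) * R x) \<le> (x - 1) * C) (at_right 1)"
      using gt1 by eventually_elim (use C in \<open>auto simp: R_def norm_mult norm_of_real simp del: of_real_diff intro!: mult_left_mono\<close>)
    have "((\<lambda>x. (x - 1) * C) \<longlongrightarrow> (1 - 1) * C) (at_right 1)" by (intro tendsto_intros)
    then show "((\<lambda>x. (x - 1) * C) \<longlongrightarrow> 0) (at_right 1)" by simp
  qed
  let ?H = "{s. Re s > 1}"
  have oH: "open ?H" by (rule open_halfspace_Re_gt)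
  have Lq: "(\<lambda>s. L s / q s) holomorphic_on ?H"
    by (intro holomorphic_intros holomorphic_on_subset[OF hol] qhol qnz) auto
  \<comment> \<open>Holomorphy of the series for Re s > 1 is inherited from L / q.\<close>
  have dhol: "dseries holomorphic_on ?H"
    using Lq by (rule holomorphic_transform) (use L qnz in auto)
  have dL: "deriv L s = deriv q s * dseries s + q s * deriv dseries s" if s: "Re s > 1" for s
  proof -
    have "(q has_field_derivative deriv q s) (at s)" "(dseries has_field_derivative deriv dseries s) (at s)"
      using holomorphic_derivI[OF qhol oH] holomorphic_derivI[OF dhol oH] s by auto
    then have "((\<lambda>s. q s * dseries s) has_field_derivative deriv q s * dseries s + q s * deriv dseries s) (at s)"
      by (auto intro!: derivative_eq_intros)
    then have "(L has_field_derivative deriv q s * dseries s + q s * deriv dseries s) (at s)"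
      by (rule has_field_derivative_transform_within_open[OF _ oH]) (use s L in auto)
    then show ?thesis by (rule DERIV_imp_deriv)
  qed
  have "((\<lambda>x. of_real (x - 1) * (deriv q (of_real x) / q (of_real x)) - of_real (x - 1) * (deriv L (of_real x) / L (of_real x))
           - of_real (x - 1) * R x) \<longlongrightarrow> m - of_nat k - 0) (at_right 1)"
    by (intro tendsto_intros k R0 qlim)
  moreover have "eventually (\<lambda>x. of_real (x - 1) * (deriv q (of_real x) / q (of_real x))
        - of_real (x - 1) * (deriv L (of_real x) / L (of_real x)) - of_real (x - 1) * R x
           = of_real (x - 1) * prime_sum x) (at_right 1)"
    using gt1 k(2)
  proof eventually_elim
    case (elim x)
    let ?S = "\<Sum>\<^sub>\<infinity>pk\<in>prime_powers. pp_term x pk"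
    have x: "Re (of_real x) > 1" using elim by simp
    have nz: "q (of_real x) \<noteq> 0" "dseries (of_real x) \<noteq> 0" using qnz[OF x] L[OF x] elim by auto
    have "deriv L (of_real x) = deriv q (of_real x) * dseries (of_real x) - q (of_real x) * (?S * dseries (of_real x))"
      using log_derivative(2)[OF elim(1)] dL[OF x] by simp
    then have "deriv L (of_real x) / L (of_real x) = deriv q (of_real x) / q (of_real x) - ?S"
      using L[OF x] nz by (simp add: field_simps)
    moreover have "z * A - z * (A - S) - z * (S - P) = z * P" for z A S P :: complex
      by (simp add: algebra_simps)
    ultimately show ?case unfolding R_def by (simp only:)
  qed
  ultimately have "((\<lambda>x. of_real (x - 1) * prime_sum x) \<longlongrightarrow> m - of_nat k - 0) (at_right 1)"
    by (rule Lim_transform_eventually)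
  then show ?thesis using that k(3) by auto
qed

corollary prime_sum_residue_nonpos:
  assumes hol: "L holomorphic_on {s. Re s > 1/2}" and L: "\<And>s. Re s > 1 \<Longrightarrow> L s = dseries s"
  obtains k :: nat where "((\<lambda>x. of_real (x - 1) * prime_sum x) \<longlongrightarrow> - of_nat k) (at_right 1)"
    "L 1 \<noteq> 0 \<Longrightarrow> k = 0"
  by (rule prime_sum_residue[OF hol, of "\<lambda>_. 1" 0]) (use L in auto)

end

section \<open>Characters of finite abelian groups and Dirichlet characters\<close>

text \<open>A character of H extends to the subgroup generated by H and x by h x^k -> \<rho>(h) w^k.
  With n the least positive exponent such that x^n lies in H, the one constraint on w is w^n =
  \<rho>(x^n).\<close>

lemma (in comm_group) character_extension:
  fixes \<rho> :: "'a \<Rightarrow> complex"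
  assumes fin: "finite (carrier G)" and H: "subgroup H G"
    and mult: "\<And>y z. y \<in> H \<Longrightarrow> z \<in> H \<Longrightarrow> \<rho> (y \<otimes> z) = \<rho> y * \<rho> z"
    and nz: "\<And>y. y \<in> H \<Longrightarrow> \<rho> y \<noteq> 0"
    and x: "x \<in> carrier G"
    and n: "(n::nat) > 0" "x [^] n \<in> H" "\<And>k::nat. k > 0 \<Longrightarrow> x [^] k \<in> H \<Longrightarrow> n \<le> k"
    and w: "w ^ n = \<rho> (x [^] n)"
  obtains H' \<rho>' where "subgroup H' G" "H \<subseteq> H'" "x \<in> H'"
    "\<And>y z. y \<in> H' \<Longrightarrow> z \<in> H' \<Longrightarrow> \<rho>' (y \<otimes> z) = \<rho>' y * \<rho>' z"
    "\<And>y. y \<in> H' \<Longrightarrow> \<rho>' y \<noteq> 0" "\<And>y. y \<in> H \<Longrightarrow> \<rho>' y = \<rho> y" "\<rho>' x = w"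
proof -
  have Hc: "y \<in> carrier G" if "y \<in> H" for y using subgroup.mem_carrier[OF H that] .
  have one: "\<one> \<in> H" by (rule subgroup.one_closed[OF H])
  have chi1: "\<rho> \<one> = 1" using mult[OF one one] nz[OF one] by simp
  have w0: "w \<noteq> 0" using w nz[OF n(2)] n(1) by (auto simp: power_0_left)
  have pow: "\<rho> (y [^] (q::nat)) = \<rho> y ^ q \<and> y [^] q \<in> H" if "y \<in> H" for y q
    using that H by (induction q) (auto simp: chi1 one mult subgroup.m_closed)
  \<comment> \<open>The remainder of k modulo n is again an exponent that leads into H; by
    minimality it is 0.\<close>
  have dvd: "n dvd k" if k: "x [^] k \<in> H" for k
  proof -
    have "x [^] k = (x [^] n) [^] (k div n) \<otimes> x [^] (k mod n)"
      using x by (simp add: nat_pow_pow nat_pow_mult)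
    then have "inv ((x [^] n) [^] (k div n)) \<otimes> x [^] k = x [^] (k mod n)"
      using x by (simp add: m_assoc[symmetric])
    then have "x [^] (k mod n) \<in> H"
      using subgroup.m_closed[OF H subgroup.m_inv_closed[OF H conjunct2[OF pow[OF n(2), of "k div n"]]] k] by simp
    then show ?thesis using n(3)[of "k mod n"] n(1) by (metis mod_less_divisor mod_eq_0_iff_dvd neq0_conv not_le)
  qed
  \<comment> \<open>Well-definedness: two representations differ by x^(k' - k) in H, where n divides
    k' - k, so \<rho> takes the value w^(k' - k) there.\<close>
  have wd: "\<rho> h * w ^ k = \<rho> h' * w ^ k'"
    if "h \<in> H" "h' \<in> H" "h \<otimes> x [^] k = h' \<otimes> x [^] k'" "k \<le> k'" for h h' and k k' :: nat
  proof -
    have "h \<otimes> x [^] k = h' \<otimes> x [^] (k' - k) \<otimes> x [^] k"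
      using that x Hc by (simp add: m_assoc nat_pow_mult)
    then have hh: "h = h' \<otimes> x [^] (k' - k)" using that x Hc by simp
    then have "inv h' \<otimes> h = x [^] (k' - k)" using that x Hc by (simp add: m_assoc[symmetric])
    then have xH: "x [^] (k' - k) \<in> H" using subgroup.m_closed[OF H subgroup.m_inv_closed[OF H that(2)] that(1)] by simp
    then obtain q where q: "k' - k = n * q" using dvd by blast
    have "x [^] (k' - k) = (x [^] n) [^] q" using x q by (simp add: nat_pow_pow)
    then have "\<rho> (x [^] (k' - k)) = w ^ (k' - k)" using pow[OF n(2), of q] w q by (simp add: power_mult)
    then have "\<rho> h = \<rho> h' * w ^ (k' - k)" using hh mult[OF that(2) xH] by simp
    then show ?thesis using that(4) by (simp add: mult.assoc flip: power_add)
  qed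
  then have wd': "\<rho> h * w ^ k = \<rho> h' * w ^ k'"
    if "h \<in> H" "h' \<in> H" "h \<otimes> x [^] k = h' \<otimes> x [^] k'" for h h' and k k' :: nat
    using that by (metis linorder_linear)
  define H' where "H' = {h \<otimes> x [^] k |h k. h \<in> H \<and> k \<in> (UNIV :: nat set)}"
  define \<rho>' where "\<rho>' = (\<lambda>y. THE v. \<exists>h k. h \<in> H \<and> y = h \<otimes> x [^] (k::nat) \<and> v = \<rho> h * w ^ k)"
  have chi': "\<rho>' (h \<otimes> x [^] k) = \<rho> h * w ^ k" if "h \<in> H" for h and k :: nat
    unfolding \<rho>'_def
  proof (rule the_equality)
    show "\<exists>ha ka. ha \<in> H \<and> h \<otimes> x [^] k = ha \<otimes> x [^] ka \<and> \<rho> h * w ^ k = \<rho> ha * w ^ ka"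
      using that by blast
  next
    fix v assume "\<exists>h' k'. h' \<in> H \<and> h \<otimes> x [^] k = h' \<otimes> x [^] (k'::nat) \<and> v = \<rho> h' * w ^ k'"
    then show "v = \<rho> h * w ^ k" using wd'[OF that] by auto
  qed
  have prod: "(h \<otimes> x [^] k) \<otimes> (h' \<otimes> x [^] k') = (h \<otimes> h') \<otimes> x [^] (k + k')"
    if "h \<in> H" "h' \<in> H" for h h' and k k' :: nat
    using that x Hc by (simp add: m_ac flip: nat_pow_mult)
  show ?thesis
  proof (rule that[of H' \<rho>'])
    show "subgroup H' G"
    proof
      show "H' \<subseteq> carrier G" using x Hc by (auto simp: H'_def)
    next
      fix y z assume "y \<in> H'" "z \<in> H'"
      then obtain h k h' k' where hk: "h \<in> H" "y = h \<otimes> x [^] (k::nat)" "h' \<in> H" "z = h' \<otimes> x [^] (k'::nat)"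
        by (auto simp: H'_def)
      then have "y \<otimes> z = (h \<otimes> h') \<otimes> x [^] (k + k')" by (simp add: prod)
      then show "y \<otimes> z \<in> H'" using subgroup.m_closed[OF H hk(1,3)] unfolding H'_def by blast
    next
      have "\<one> = \<one> \<otimes> x [^] (0::nat)" by simp
      then show "\<one> \<in> H'" using one unfolding H'_def by blast
    next
      fix y assume "y \<in> H'"
      then obtain h k where y: "h \<in> H" "y = h \<otimes> x [^] (k::nat)" by (auto simp: H'_def)
      \<comment> \<open>Only natural exponents occur in \<open>H'\<close>, so x^(-k) is written as
        x^m with k + m a multiple of the group order.\<close>
      define m where "m = Coset.order G * k - k"
      have "Coset.order G > 0" using fin by (simp add: order_gt_0_iff_finite)
      then have m: "k + m = Coset.order G * k" by (simp add: m_def)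
      have "x [^] (k + m) = \<one>"
        using x fin by (simp add: m pow_order_eq_1 flip: nat_pow_pow)
      then have "y \<otimes> (inv h \<otimes> x [^] m) = \<one>"
        using y H Hc x prod[OF y(1), of "inv h" k m] by (simp add: subgroup.m_inv_closed)
      then have "inv y = inv h \<otimes> x [^] m"
        using y x Hc by (metis comm_inv_char inv_closed m_closed nat_pow_closed)
      then show "inv y \<in> H'" using y H by (auto simp: H'_def subgroup.m_inv_closed)
    qed
    have "h = h \<otimes> x [^] (0::nat)" if "h \<in> H" for h using Hc[OF that] by simp
    then show "H \<subseteq> H'" unfolding H'_def by blast
    have "x = \<one> \<otimes> x [^] (1::nat)" using x by simp
    then show "x \<in> H'" using one unfolding H'_def by blast
    show "\<rho>' (y \<otimes> z) = \<rho>' y * \<rho>' z" if yz: "y \<in> H'" "z \<in> H'" for y z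
    proof -
      obtain h k h' k' where "h \<in> H" "y = h \<otimes> x [^] (k::nat)" "h' \<in> H" "z = h' \<otimes> x [^] (k'::nat)"
        using yz by (auto simp: H'_def)
      then show ?thesis using H by (simp add: prod chi' mult subgroup.m_closed power_add)
    qed
    show "\<rho>' y \<noteq> 0" if "y \<in> H'" for y
      using that chi' nz w0 by (auto simp: H'_def)
    show "\<rho>' y = \<rho> y" if "y \<in> H" for y
      using chi'[OF that, of 0] that Hc by simp
    show "\<rho>' x = w" using chi'[OF one, of 1] x by (simp add: chi1)
  qed
qed

text \<open>The trivial character of the trivial subgroup is extended to the powers of a, with a
  value other than 1 at a, and from there one element at a time until the whole group is reached.
  The later extensions keep the value at a.\<close>

lemma (in comm_group) exists_separating_character:
  assumes fin: "finite (carrier G)" and a: "a \<in> carrier G" "a \<noteq> \<one>"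
  obtains \<rho> :: "'a \<Rightarrow> complex" where
    "\<And>y z. y \<in> carrier G \<Longrightarrow> z \<in> carrier G \<Longrightarrow> \<rho> (y \<otimes> z) = \<rho> y * \<rho> z"
    "\<And>y. y \<in> carrier G \<Longrightarrow> \<rho> y \<noteq> 0" "\<rho> a \<noteq> 1"
proof -
  have least: "\<exists>n::nat. n > 0 \<and> x [^] n \<in> H \<and> (\<forall>k::nat. k > 0 \<longrightarrow> x [^] k \<in> H \<longrightarrow> n \<le> k)"
    if H: "subgroup H G" and x: "x \<in> carrier G" for H x
  proof -
    let ?P = "\<lambda>n::nat. n > 0 \<and> x [^] n \<in> H"
    have "?P (Coset.order G)"
      using x fin H by (simp add: pow_order_eq_1 subgroup.one_closed order_gt_0_iff_finite)
    then have "?P (LEAST n. ?P n)" by (rule LeastI)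
    moreover have "(LEAST n. ?P n) \<le> k" if "k > 0" "x [^] k \<in> H" for k
      using that by (intro Least_le) auto
    ultimately show ?thesis by (intro exI[of _ "LEAST n. ?P n"]) auto
  qed
  define P where "P = (\<lambda>H (\<rho> :: 'a \<Rightarrow> complex). subgroup H G \<and> a \<in> H \<and> \<rho> a \<noteq> 1 \<and>
     (\<forall>y\<in>H. \<forall>z\<in>H. \<rho> (y \<otimes> z) = \<rho> y * \<rho> z) \<and> (\<forall>y\<in>H. \<rho> y \<noteq> 0))"
  have "\<exists>H \<rho>. P H \<rho>"
  proof -
    have H: "subgroup {\<one>} G" by (rule triv_subgroup)
    obtain n :: nat where n: "n > 0" "a [^] n \<in> {\<one>}" "\<And>k. k > 0 \<Longrightarrow> a [^] k \<in> {\<one>} \<Longrightarrow> n \<le> k"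
      using least[OF H a(1)] by blast
    have "n \<noteq> 1" using n a by auto
    \<comment> \<open>A primitive n-th root of unity; it differs from 1 since a is not the identity
      and thus n > 1.\<close>
    define w where "w = exp (2 * of_real pi * \<i> * of_nat 1 / of_nat n)"
    have w: "w ^ n = 1" "w \<noteq> 1"
      using \<open>n \<noteq> 1\<close> n(1) complex_root_unity[of n 1] complex_root_unity_eq_1[of n 1] by (auto simp: w_def)
    obtain H' \<rho>' where "subgroup H' G" "a \<in> H'" "\<And>y z. y \<in> H' \<Longrightarrow> z \<in> H' \<Longrightarrow> \<rho>' (y \<otimes> z) = \<rho>' y * \<rho>' z"
      "\<And>y. y \<in> H' \<Longrightarrow> \<rho>' y \<noteq> 0" "\<rho>' a = w"
      by (rule character_extension[OF fin H, of "\<lambda>_. 1" a n w]) (use a n w in auto)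
    then show ?thesis using w unfolding P_def by blast
  qed
  then obtain H \<rho> where "P H \<rho>" by blast
  then have "\<exists>\<rho>. P (carrier G) \<rho>"
  proof (induction "card (carrier G) - card H" arbitrary: H \<rho> rule: less_induct)
    case less
    then have H: "subgroup H G" "a \<in> H" "\<rho> a \<noteq> 1" "\<And>y z. y \<in> H \<Longrightarrow> z \<in> H \<Longrightarrow> \<rho> (y \<otimes> z) = \<rho> y * \<rho> z"
       "\<And>y. y \<in> H \<Longrightarrow> \<rho> y \<noteq> 0" by (auto simp: P_def)
    have sub: "H \<subseteq> carrier G" using H(1) by (rule subgroup.subset)
    show ?case
    proof (cases "H = carrier G")
      case True
      then show ?thesis using less by blast
    next
      case False
      then obtain x where x: "x \<in> carrier G" "x \<notin> H" using sub by blast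
      obtain n :: nat where n: "n > 0" "x [^] n \<in> H" "\<And>k. k > 0 \<Longrightarrow> x [^] k \<in> H \<Longrightarrow> n \<le> k"
        using least[OF H(1) x(1)] by blast
      \<comment> \<open>An n-th root of the value at x^n, which exists because that value is
        nonzero.\<close>
      define w where "w = exp (Ln (\<rho> (x [^] n)) / of_nat n)"
      have w: "w ^ n = \<rho> (x [^] n)"
        using n H(5)[OF n(2)] by (simp add: w_def flip: exp_of_nat_mult)
      obtain H' \<rho>' where H': "subgroup H' G" "H \<subseteq> H'" "x \<in> H'"
        "\<And>y z. y \<in> H' \<Longrightarrow> z \<in> H' \<Longrightarrow> \<rho>' (y \<otimes> z) = \<rho>' y * \<rho>' z"
        "\<And>y. y \<in> H' \<Longrightarrow> \<rho>' y \<noteq> 0" "\<And>y. y \<in> H \<Longrightarrow> \<rho>' y = \<rho> y"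
        by (rule character_extension[OF fin H(1,4,5) x(1) n w]) auto
      have "P H' \<rho>'" using H H' unfolding P_def by auto
      moreover have "H' \<subseteq> carrier G" using H'(1) by (rule subgroup.subset)
      then have "card H < card H'" "card H' \<le> card (carrier G)"
        using H' x fin by (auto intro!: psubset_card_mono card_mono finite_subset[of H' "carrier G"])
      ultimately show ?thesis using less(1)[of H' \<rho>'] by force
    qed
  qed
  then show ?thesis using that unfolding P_def by blast
qed

section \<open>Dirichlet characters modulo M and their orthogonality\<close>

definition dchars :: "nat \<Rightarrow> (nat \<Rightarrow> complex) set" where
  "dchars M = {\<psi>. \<psi> 1 = 1 \<and> (\<forall>m n. \<psi> (m * n) = \<psi> m * \<psi> n) \<and> (\<forall>n. \<psi> (n mod M) = \<psi> n) \<and>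
     (\<forall>n. \<not> coprime n M \<longrightarrow> \<psi> n = 0)}"

definition principal_dchar :: "nat \<Rightarrow> nat \<Rightarrow> complex" where
  "principal_dchar M n = (if coprime n M then 1 else 0)"

lemma dcharsD:
  assumes "\<psi> \<in> dchars M"
  shows "\<psi> 1 = 1" "\<psi> (m * n) = \<psi> m * \<psi> n" "\<psi> (n mod M) = \<psi> n" "\<not> coprime n M \<Longrightarrow> \<psi> n = 0"
  using assms by (auto simp: dchars_def)

lemma dchar_power: "\<psi> \<in> dchars M \<Longrightarrow> \<psi> (n ^ k) = \<psi> n ^ k"
  using dcharsD(1,2)[of \<psi> M] by (induction k) auto

lemma dchar_power_totient:
  assumes "\<psi> \<in> dchars M" "coprime n M"
  shows "\<psi> n ^ totient M = 1"
proof -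
  have "n ^ totient M mod M = 1 mod M"
    using euler_theorem[OF assms(2)] by (simp add: Cong.cong_def)
  then have "\<psi> (n ^ totient M) = \<psi> 1" by (metis assms(1) dcharsD(3))
  then show ?thesis using assms dcharsD(1)[OF assms(1)] by (simp add: dchar_power)
qed

lemma norm_dchar:
  assumes "\<psi> \<in> dchars M" "M > 0"
  shows "norm (\<psi> n) = (if coprime n M then 1 else 0)"
proof (cases "coprime n M")
  case True
  have "norm (\<psi> n) ^ totient M = 1"
    using dchar_power_totient[OF assms(1) True] by (metis norm_one norm_power)
  then have "norm (\<psi> n) = 1"
    using assms(2) by (metis norm_ge_zero power_eq_1_iff totient_gt_0_iff zero_less_iff_neq_zero real_norm_def abs_norm_cancel)
  then show ?thesis using True by simp
qed (use dcharsD(4)[OF assms(1)] in auto)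

lemma dchar_cnj_mult:
  assumes "\<psi> \<in> dchars M" "M > 0" "coprime n M"
  shows "cnj (\<psi> n) * \<psi> n = 1"
  using norm_dchar[OF assms(1,2), of n] assms(3) by (metis complex_norm_square mult.commute of_real_1 one_power2)

lemma principal_dchar_in: "M > 0 \<Longrightarrow> principal_dchar M \<in> dchars M"
  by (auto simp: dchars_def principal_dchar_def coprime_mult_left_iff)

lemma dchars_mult: "\<psi> \<in> dchars M \<Longrightarrow> \<phi> \<in> dchars M \<Longrightarrow> (\<lambda>n. \<psi> n * \<phi> n) \<in> dchars M"
  by (auto simp: dchars_def)

lemma dchars_cnj: "\<psi> \<in> dchars M \<Longrightarrow> (\<lambda>n. cnj (\<psi> n)) \<in> dchars M"
  by (auto simp: dchars_def)

text \<open>A character is determined by its values below M, and each value is 0 or a root of unity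
  of order dividing \<open>totient M\<close>.\<close>

lemma finite_dchars:
  assumes "M > 0" shows "finite (dchars M)"
proof -
  let ?V = "insert 0 {z :: complex. z ^ totient M = 1}"
  have fV: "finite ?V" using assms finite_roots_unity[of "totient M"] by (simp add: Suc_le_eq)
  have "inj_on (\<lambda>\<psi>. restrict \<psi> {..<M}) (dchars M)"
  proof (rule inj_onI, rule ext)
    fix \<psi> \<phi> n assume *: "\<psi> \<in> dchars M" "\<phi> \<in> dchars M" "restrict \<psi> {..<M} = restrict \<phi> {..<M}"
    have "n mod M < M" using assms by simp
    then have "\<psi> (n mod M) = \<phi> (n mod M)" using *(3) by (metis lessThan_iff restrict_apply')
    then show "\<psi> n = \<phi> n" using * by (simp add: dcharsD)
  qed
  moreover have "(\<lambda>\<psi>. restrict \<psi> {..<M}) ` dchars M \<subseteq> ({..<M} \<rightarrow>\<^sub>E ?V)"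
    using dchar_power_totient dcharsD(4) by (auto simp: PiE_def) blast
  ultimately show ?thesis
    using fV by (meson finite_PiE finite_lessThan inj_on_finite)
qed

text \<open>A character of the unit group of the residue ring that is not 1 at n is pulled back to
  the naturals and set to 0 off the units.\<close>

lemma dchars_separate:
  assumes M: "M > 1" and n: "coprime n M" "n mod M \<noteq> 1"
  obtains \<psi> where "\<psi> \<in> dchars M" "\<psi> n \<noteq> 1"
proof -
  interpret residues "int M" "residue_ring (int M)" using M by unfold_locales auto
  let ?G = "units_of (residue_ring (int M))"
  interpret G: comm_group ?G by (rule units_comm_group)
  have carr: "carrier ?G = {x. 0 < x \<and> x < int M \<and> coprime x (int M)}"
    by (simp add: units_of_carrier res_units_eq)
  have mul: "x \<otimes>\<^bsub>?G\<^esub> y = (x * y) mod int M" for x y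
    by (simp add: units_of_mult res_mult_eq)
  have one: "\<one>\<^bsub>?G\<^esub> = 1" by (simp add: units_of_one res_one_eq)
  have fin: "finite (carrier ?G)" unfolding carr by (rule finite_subset[of _ "{0..int M}"]) auto
  have incl: "int (k mod M) \<in> carrier ?G" if "coprime k M" for k
  proof -
    have "coprime (k mod M) M" using that M by simp
    moreover from this have "k mod M \<noteq> 0" using M by (intro notI) simp
    ultimately show ?thesis using M unfolding carr by (auto simp: coprime_int_iff simp del: of_nat_mod)
  qed
  have "int (n mod M) \<noteq> \<one>\<^bsub>?G\<^esub>" using n(2) by (simp add: one del: of_nat_mod)
  then obtain \<rho> :: "int \<Rightarrow> complex" where \<rho>:
    "\<And>y z. y \<in> carrier ?G \<Longrightarrow> z \<in> carrier ?G \<Longrightarrow> \<rho> (y \<otimes>\<^bsub>?G\<^esub> z) = \<rho> y * \<rho> z"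
    "\<And>y. y \<in> carrier ?G \<Longrightarrow> \<rho> y \<noteq> 0" "\<rho> (int (n mod M)) \<noteq> 1"
    using G.exists_separating_character[OF fin incl[OF n(1)]] by metis
  define \<psi> where "\<psi> = (\<lambda>k. if coprime k M then \<rho> (int (k mod M)) else 0)"
  have mult: "\<psi> (k * l) = \<psi> k * \<psi> l" for k l
  proof (cases "coprime k M \<and> coprime l M")
    case True
    have "int ((k * l) mod M) = int (k mod M) \<otimes>\<^bsub>?G\<^esub> int (l mod M)"
      unfolding mul by (simp add: zmod_int mod_mult_eq)
    then show ?thesis using True \<rho>(1)[OF incl incl, of k l] by (simp add: \<psi>_def)
  qed (auto simp: \<psi>_def)
  have "\<psi> 1 * \<psi> 1 = \<psi> 1" using mult[of 1 1] by simp
  moreover have "\<psi> 1 \<noteq> 0" using \<rho>(2)[OF incl[of 1]] by (simp add: \<psi>_def del: of_nat_mod)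
  ultimately have "\<psi> 1 = 1" by simp
  moreover have "\<psi> (k mod M) = \<psi> k" for k using M by (simp add: \<psi>_def)
  ultimately have "\<psi> \<in> dchars M" using mult by (simp add: dchars_def) (simp add: \<psi>_def)
  moreover have "\<psi> n \<noteq> 1" using \<rho>(3) n(1) by (simp add: \<psi>_def)
  ultimately show ?thesis using that by blast
qed

text \<open>Multiplication by some b with \<psi>(b) different from 1 permutes the residues and
  multiplies the sum by \<psi>(b).\<close>

lemma sum_dchar_residues:
  assumes M: "M > 1" and \<psi>: "\<psi> \<in> dchars M" "\<psi> \<noteq> principal_dchar M"
  shows "(\<Sum>r<M. \<psi> r) = 0"
proof -
  obtain b where b: "coprime b M" "\<psi> b \<noteq> 1"
    using \<psi> dcharsD(4)[OF \<psi>(1)] by (auto simp: principal_dchar_def fun_eq_iff split: if_splits)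
  have inj: "inj_on (\<lambda>r. (b * r) mod M) {..<M}"
  proof (rule inj_onI)
    fix r r' assume r: "r \<in> {..<M}" "r' \<in> {..<M}" "(b * r) mod M = (b * r') mod M"
    then have "[r = r'] (mod M)" using b(1) cong_mult_lcancel_nat[of b M r r'] by (simp add: Cong.cong_def)
    then show "r = r'" using r by (simp add: Cong.cong_def)
  qed
  have "(\<lambda>r. (b * r) mod M) ` {..<M} \<subseteq> {..<M}" using M by auto
  then have im: "(\<lambda>r. (b * r) mod M) ` {..<M} = {..<M}"
    using inj by (intro endo_inj_surj) auto
  have "(\<Sum>r<M. \<psi> r) = (\<Sum>r<M. \<psi> ((b * r) mod M))"
    by (subst im[symmetric], subst sum.reindex[OF inj]) simp
  also have "\<dots> = \<psi> b * (\<Sum>r<M. \<psi> r)" using \<psi>(1) by (simp add: dcharsD sum_distrib_left)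
  finally show ?thesis using b(2) by simp
qed

text \<open>The dual argument: pointwise multiplication by a character \<phi> with \<phi>(n)
  different from 1 permutes the characters, complex conjugation providing the inverse.\<close>

lemma sum_dchars:
  assumes M: "M > 1"
  shows "(\<Sum>\<psi>\<in>dchars M. \<psi> n) = (if n mod M = 1 then of_nat (card (dchars M)) else 0)"
proof (cases "n mod M = 1")
  case True
  have "\<psi> n = 1" if "\<psi> \<in> dchars M" for \<psi>
    using dcharsD(1,3)[OF that] True by metis
  then have "(\<Sum>\<psi>\<in>dchars M. \<psi> n) = (\<Sum>\<psi>\<in>dchars M. 1)" by (intro sum.cong) auto
  then show ?thesis using True by simp
next
  case False
  show ?thesis
  proof (cases "coprime n M")
    case True
    then obtain \<phi> where \<phi>: "\<phi> \<in> dchars M" "\<phi> n \<noteq> 1" using dchars_separate[OF M True False] by blast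
    have e: "cnj (\<phi> k) * (\<phi> k * \<psi> k) = \<psi> k" "\<phi> k * (cnj (\<phi> k) * \<psi> k) = \<psi> k" if "\<psi> \<in> dchars M" for \<psi> k
      using dchar_cnj_mult[OF \<phi>(1), of k] dcharsD(4)[OF that, of k] M
      by (cases "coprime k M"; simp add: mult.assoc[symmetric] mult.commute[of "\<phi> k"])+
    have "(\<Sum>\<psi>\<in>dchars M. \<psi> n) = (\<Sum>\<psi>\<in>dchars M. \<phi> n * \<psi> n)"
      by (rule sum.reindex_bij_witness[where i = "\<lambda>\<psi> k. \<phi> k * \<psi> k" and j = "\<lambda>\<psi> k. cnj (\<phi> k) * \<psi> k"])
         (use \<phi> e in \<open>auto simp: dchars_mult dchars_cnj\<close>)
    also have "\<dots> = \<phi> n * (\<Sum>\<psi>\<in>dchars M. \<psi> n)" by (simp add: sum_distrib_left)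
    finally show ?thesis using \<phi>(2) False by simp
  next
    case npc: False
    then show ?thesis using False dcharsD(4) by (simp add: sum.neutral)
  qed
qed

text \<open>The sum of \<psi>(r) over all characters and residues is evaluated in both orders: in
  one only the principal character contributes, in the other only r = 1.\<close>

lemma card_dchars:
  assumes M: "M > 1" shows "card (dchars M) = totient M"
proof -
  have "(\<Sum>\<psi>\<in>dchars M. \<Sum>r<M. \<psi> r) = (\<Sum>\<psi>\<in>dchars M. if \<psi> = principal_dchar M then of_nat (totient M) else (0::complex))"
  proof (intro sum.cong refl)
    fix \<psi> assume \<psi>: "\<psi> \<in> dchars M"
    have "(\<Sum>r<M. principal_dchar M r) = of_nat (card {r\<in>{..<M}. coprime r M})"
      by (simp add: principal_dchar_def flip: sum.inter_filter)
    also have "{r\<in>{..<M}. coprime r M} = totatives M"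
      using M by (auto simp: totatives_def intro: gr0I le_neq_implies_less)
    finally show "(\<Sum>r<M. \<psi> r) = (if \<psi> = principal_dchar M then of_nat (totient M) else 0)"
      using sum_dchar_residues[OF M \<psi>] by (auto simp: totient_def)
  qed
  also have "\<dots> = of_nat (totient M)"
    using M finite_dchars[of M] principal_dchar_in[of M] by simp
  finally have "of_nat (totient M) = (\<Sum>r<M. \<Sum>\<psi>\<in>dchars M. \<psi> r)" by (subst sum.swap) simp
  also have "\<dots> = (\<Sum>r<M. if r = 1 then of_nat (card (dchars M)) else 0)"
    by (intro sum.cong refl) (auto simp: sum_dchars[OF M])
  also have "\<dots> = of_nat (card (dchars M))" using M by simp
  finally show ?thesis by (simp only: of_nat_eq_iff)
qed

lemma dchars_orthogonality:
  assumes M: "M > 1" and c: "coprime c M"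
  shows "(\<Sum>\<psi>\<in>dchars M. cnj (\<psi> c) * \<psi> n) = (if [n = c] (mod M) then of_nat (totient M) else 0)"
proof -
  \<comment> \<open>With b an inverse of c modulo M, \<open>cnj (\<psi> c) = \<psi> b\<close>, which
    reduces the claim to the sum of all characters at b n.\<close>
  obtain b where b: "[c * b = 1] (mod M)" using cong_solve_coprime_nat[OF c] by auto
  have cb: "\<psi> c * \<psi> b = 1" if "\<psi> \<in> dchars M" for \<psi>
    using dcharsD[OF that] b M by (metis Cong.cong_def)
  have "cnj (\<psi> c) * \<psi> n = \<psi> (b * n)" if \<psi>: "\<psi> \<in> dchars M" for \<psi>
  proof -
    have "cnj (\<psi> c) = cnj (\<psi> c) * (\<psi> c * \<psi> b)" using cb[OF \<psi>] by simp
    also have "\<dots> = \<psi> b" using dchar_cnj_mult[OF \<psi> _ c] M by (simp add: mult.assoc[symmetric])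
    finally show ?thesis using \<psi> by (simp add: dcharsD)
  qed
  then have "(\<Sum>\<psi>\<in>dchars M. cnj (\<psi> c) * \<psi> n) = (\<Sum>\<psi>\<in>dchars M. \<psi> (b * n))" by simp
  also have "\<dots> = (if (b * n) mod M = 1 then of_nat (totient M) else 0)"
    by (simp add: sum_dchars[OF M] card_dchars[OF M])
  also have "(b * n) mod M = 1 \<longleftrightarrow> [n = c] (mod M)"
  proof -
    have "(b * n) mod M = 1 \<longleftrightarrow> [b * n = c * b] (mod M)" using b M by (auto simp: Cong.cong_def)
    also have "\<dots> \<longleftrightarrow> [n = c] (mod M)"
    proof -
      have "coprime b M" using b by (metis coprime_iff_invertible_nat mult.commute One_nat_def)
      then show ?thesis using cong_mult_lcancel_nat[of b M n c] by (simp add: mult.commute)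
    qed
    finally show ?thesis .
  qed
  finally show ?thesis .
qed

section \<open>The Riemann zeta function and Dirichlet L-functions\<close>

text \<open>The blocks are M u + 1, ..., M u + M, compared with their last element M (u + 1); the
  distance stays below M, well within the allowed multiple of W^(1/2). Residues run from 1 to M
  rather than from 0 so that no term has base 0.\<close>

lemma periodic_series_holomorphic:
  fixes c :: "nat \<Rightarrow> complex"
  assumes M: "M > 0" and per: "\<And>n. c (n mod M) = c n" and sum0: "(\<Sum>r\<in>{1..M}. c r) = 0"
    and bdd: "\<And>n. norm (c n) \<le> 1"
  defines "L \<equiv> (\<lambda>s. \<Sum>\<^sub>\<infinity>u::nat. \<Sum>r\<in>{1..M}. c r * of_real (real (M * u + r)) powr (-s))"
  shows "L holomorphic_on {s. Re s > 1/2}"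
    and "Re s > 1/2 \<Longrightarrow> (\<lambda>u::nat. \<Sum>r\<in>{1..M}. c r * of_real (real (M * u + r)) powr (-s)) summable_on UNIV"
    and "Re s > 1 \<Longrightarrow> L s = dirichlet_series (\<lambda>n::nat. n) c s"
proof -
  have powr_summable: "(\<lambda>u. real (u + 1) powr (-\<kappa>)) summable_on UNIV" if "\<kappa> > 1" for \<kappa> :: real
    using that summable_real_powr_iff[of "-\<kappa>"] summable_iff_shift[of "\<lambda>u. real u powr (-\<kappa>)" 1]
    by (subst summable_on_UNIV_nonneg_real_iff) auto
  have X: "real (M * u + r) \<ge> 1 * real (u + 1)" if "r \<in> {1..M}" for u r
  proof -
    have "u \<le> M * u" using M by simp
    then have "u + 1 \<le> M * u + r" using that unfolding atLeastAtMost_iff by linarith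
    then show ?thesis by (simp only: of_nat_le_iff mult_1)
  qed
  have X0: "real (M * (u + 1)) \<ge> 1 * real (u + 1)" for u
    using X[of M u] M by (simp add: distrib_left)
  have D: "\<bar>real (M * u + r) - real (M * (u + 1))\<bar> \<le> real M * real (u + 1) powr (1/2)" if "r \<in> {1..M}" for u r
  proof -
    have "\<bar>real (M * u + r) - real (M * (u + 1))\<bar> \<le> real M * 1"
    proof -
      have "real (M * (u + 1)) = real (M * u) + real M" "real (M * u + r) = real (M * u) + real r"
        by (simp_all add: distrib_left)
      then show ?thesis using that by simp
    qed
    also have "\<dots> \<le> real M * real (u + 1) powr (1/2)"
      by (intro mult_left_mono ge_one_powr_ge_zero) auto
    finally show ?thesis .
  qed
  note * = block_series_holomorphic[of "{1..M}" c "\<lambda>u. real (u + 1)" 1 "real M" "\<lambda>u. real (M * (u + 1))" "\<lambda>u r. real (M * u + r)"]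
  show "L holomorphic_on {s. Re s > 1/2}" unfolding L_def
    by (rule *) (use X X0 D sum0 powr_summable in auto)
  show "(\<lambda>u::nat. \<Sum>r\<in>{1..M}. c r * of_real (real (M * u + r)) powr (-s)) summable_on UNIV" if "Re s > 1/2"
    by (rule *) (use X X0 D sum0 powr_summable that in auto)
  show "L s = dirichlet_series (\<lambda>n::nat. n) c s" if s: "Re s > 1"
  proof -
    have "(\<lambda>n::nat. norm (c n * of_nat n powr (-s))) summable_on UNIV"
    proof (rule Infinite_Sum.abs_summable_on_comparison_test')
      show "(\<lambda>n. real n powr (- Re s)) summable_on UNIV"
        using s by (subst summable_on_UNIV_nonneg_real_iff) (auto simp: summable_real_powr_iff)
      show "norm (c n * of_nat n powr (-s)) \<le> real n powr (- Re s)" for n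
        using bdd[of n] by (simp add: norm_mult norm_of_nat_powr mult_left_le_one_le)
    qed
    then have "((\<lambda>n. c n * of_nat n powr (-s)) has_sum dirichlet_series (\<lambda>n::nat. n) c s) UNIV"
      unfolding dirichlet_series_def by (rule has_sum_infsum[OF abs_summable_summable])
    then have hs: "((\<lambda>n. c n * of_nat n powr (-s)) has_sum dirichlet_series (\<lambda>n::nat. n) c s) {1..}"
      by (subst has_sum_cong_neutral[where T = UNIV and g = "\<lambda>n. c n * of_nat n powr (-s)"]) (auto simp: not_le)
    have bij: "bij_betw (\<lambda>(u, r). M * u + r) (UNIV \<times> {1..M}) {1..}"
    \<comment> \<open>The shift by one reflects the choice of residues 1, ..., M.\<close>
    proof (rule bij_betwI[where g = "\<lambda>n. ((n - 1) div M, (n - 1) mod M + 1)"])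
      show "(\<lambda>(u, r). M * u + r) \<in> UNIV \<times> {1..M} \<rightarrow> {1..}" by auto
      show "(\<lambda>n. ((n - 1) div M, (n - 1) mod M + 1)) \<in> {1..} \<rightarrow> UNIV \<times> {1..M}"
        using M by (auto simp: Suc_le_eq)
      fix z assume "z \<in> (UNIV :: nat set) \<times> {1..M}"
      then obtain u r where z: "z = (u, r)" "1 \<le> r" "r \<le> M" by auto
      then obtain r' where r': "r = r' + 1" "r' < M" by (metis Suc_eq_plus1 Suc_le_D Suc_le_lessD One_nat_def)
      show "(((case z of (u, r) \<Rightarrow> M * u + r) - 1) div M, ((case z of (u, r) \<Rightarrow> M * u + r) - 1) mod M + 1) = z"
        using r' by (simp add: z)
    next
      fix n :: nat assume "n \<in> {1..}"
      then show "(case ((n - 1) div M, (n - 1) mod M + 1) of (u, r) \<Rightarrow> M * u + r) = n" by simp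
    qed
    have "((\<lambda>z. c (case z of (u, r) \<Rightarrow> M * u + r) * of_nat (case z of (u, r) \<Rightarrow> M * u + r) powr (-s))
             has_sum dirichlet_series (\<lambda>n::nat. n) c s) (UNIV \<times> {1..M})"
      using hs by (rule iffD2[OF has_sum_reindex_bij_betw[OF bij]])
    then have "((\<lambda>u. \<Sum>r\<in>{1..M}. c r * of_real (real (M * u + r)) powr (-s)) has_sum dirichlet_series (\<lambda>n::nat. n) c s) UNIV"
    proof (rule has_sum_SigmaD)
      fix u :: nat
      have "c (M * u + r) = c r" for r using per[of "M * u + r"] per[of r] by simp
      then have "(\<Sum>r\<in>{1..M}. c r * of_real (real (M * u + r)) powr (-s))
          = (\<Sum>r\<in>{1..M}. c (M * u + r) * of_nat (M * u + r) powr (-s))" by simp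
      then show "((\<lambda>r. c (case (u, r) of (u, r) \<Rightarrow> M * u + r) * of_nat (case (u, r) of (u, r) \<Rightarrow> M * u + r) powr (-s))
         has_sum (\<Sum>r\<in>{1..M}. c r * of_real (real (M * u + r)) powr (-s))) {1..M}"
        by (intro has_sum_finiteI) auto
    qed
    then show ?thesis unfolding L_def by (rule infsumI)
  qed
qed

interpretation nat_norm: normed_factorial "\<lambda>n::nat. n"
proof
  fix \<kappa> :: real assume "\<kappa> > 1"
  then show "(\<lambda>a. real a powr (-\<kappa>)) summable_on UNIV"
    by (subst summable_on_UNIV_nonneg_real_iff) (auto simp: summable_real_powr_iff)
qed auto

lemma dchar_normed_character:
  assumes "\<psi> \<in> dchars M" "M > 0"
  shows "normed_character (\<lambda>n::nat. n) \<psi>"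
proof unfold_locales
  show "\<psi> (a * b) = \<psi> a * \<psi> b" for a b by (rule dcharsD(2)[OF assms(1)])
  show "norm (\<psi> a) \<le> 1" for a using norm_dchar[OF assms, of a] by auto
  show "\<psi> u = 1" if "is_unit u" for u
  proof -
    have "u = 1" using that by simp
    then show ?thesis using dcharsD(1)[OF assms(1)] by (simp only:)
  qed
qed

text \<open>The zeta function enters through the alternating series 1 - 2^(-s) + 3^(-s) - ... = (1 -
  2^(1-s)) \<zeta>(s), whose coefficients have period 2 and sum 0. Its value at 1 is positive, so
  the limit is the order 1 of the zero of 1 - 2^(1-s).\<close>

lemma tendsto_residue_zeta:
  "((\<lambda>x. of_real (x - 1) * prime_log_sum (\<lambda>n::nat. n) (\<lambda>_. 1) x) \<longlongrightarrow> 1) (at_right 1)"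
proof -
  interpret one: normed_character "\<lambda>n::nat. n" "\<lambda>_. 1"
    by unfold_locales auto
  define c :: "nat \<Rightarrow> complex" where "c = (\<lambda>n. if odd n then 1 else -1)"
  define L where "L = (\<lambda>s. \<Sum>\<^sub>\<infinity>u::nat. \<Sum>r\<in>{1..2}. c r * of_real (real (2 * u + r)) powr (-s))"
  have two: "{1..2} = {1, 2::nat}" by auto
  have per: "c (n mod 2) = c n" for n by (auto simp: c_def odd_iff_mod_2_eq_one)
  have sum0: "(\<Sum>r\<in>{1..2}. c r) = 0" unfolding two by (simp add: c_def)
  have bdd: "norm (c n) \<le> 1" for n by (simp add: c_def)
  have two0: "(2::nat) > 0" by simp
  note P = periodic_series_holomorphic[OF two0 per sum0 bdd, folded L_def]
  define q :: "complex \<Rightarrow> complex" where "q = (\<lambda>s. 1 - 2 powr (1 - s))"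
  have Lq: "L s = q s * one.dseries s" if s: "Re s > 1" for s
  proof -
    note hs = one.dseries_has_sum[OF s, simplified]
    have "((\<lambda>n. of_nat (2 * n) powr (-s)) has_sum (2 powr (-s) * one.dseries s)) UNIV"
    proof -
      have "(of_nat (2 * n) :: complex) powr (-s) = 2 powr (-s) * of_nat n powr (-s)" for n
        using powr_times_real[of 2 "of_nat n" "-s"] by simp
      then show ?thesis using has_sum_cmult_right[OF hs] by simp
    qed
    then have ev: "((\<lambda>n. of_nat n powr (-s)) has_sum (2 powr (-s) * one.dseries s)) ((\<lambda>n. 2 * n) ` (UNIV :: nat set))"
      by (subst has_sum_reindex) (auto simp: inj_on_def o_def)
    then have "((\<lambda>n::nat. if even n then of_nat n powr (-s) else 0) has_sum (2 powr (-s) * one.dseries s)) UNIV"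
      by (subst has_sum_cong_neutral[where T = "(\<lambda>n. 2 * n) ` (UNIV :: nat set)" and g = "\<lambda>n. of_nat n powr (-s)"])
         (auto elim!: evenE)
    \<comment> \<open>Changing the sign of the even terms means subtracting them twice; together
      they are 2^(-s) times the full sum.\<close>
    then have "((\<lambda>n::nat. of_nat n powr (-s) + (-2) * (if even n then of_nat n powr (-s) else 0)) has_sum
        (one.dseries s + (-2) * (2 powr (-s) * one.dseries s))) UNIV"
      by (intro has_sum_add has_sum_cmult_right hs)
    moreover have "(\<lambda>n::nat. of_nat n powr (-s) + (-2) * (if even n then of_nat n powr (-s) else 0)) = (\<lambda>n. c n * of_nat n powr (-s))"
      by (auto simp: c_def)
    moreover have "one.dseries s + (-2) * (2 powr (-s) * one.dseries s) = q s * one.dseries s"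
    proof -
      have "2 powr (1 - s) = 2 * 2 powr (-s)"
        by (simp add: powr_diff powr_minus divide_simps)
      then show ?thesis unfolding q_def by (simp only:) (simp add: algebra_simps)
    qed
    ultimately have "((\<lambda>n::nat. c n * of_nat n powr (-s)) has_sum (q s * one.dseries s)) UNIV"
      by (simp only:)
    then have "dirichlet_series (\<lambda>n::nat. n) c s = q s * one.dseries s"
      unfolding dirichlet_series_def[of _ c] by (rule infsumI)
    then show ?thesis using P(3)[OF s] by (simp only: L_def)
  qed
  have qnz: "q s \<noteq> 0" if "Re s > 1" for s
  proof
    assume "q s = 0"
    then have "norm (2 powr (1 - s)) = 1" by (simp add: q_def)
    then have "2 powr (1 - Re s) = (1::real)" by (simp add: norm_powr_real_powr)
    moreover have "2 powr (1 - Re s) < 2 powr (0::real)" using that by (intro powr_less_mono) auto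
    ultimately show False by simp
  qed
  have dq: "(q has_field_derivative Ln 2 * 2 powr (1 - s)) (at s)" for s
    unfolding q_def by (auto intro!: derivative_eq_intros simp: powr_def)
  then have qhol: "q holomorphic_on A" for A
    by (meson field_differentiable_at_within field_differentiable_def holomorphic_on_def)
  have qlim: "((\<lambda>x::real. of_real (x - 1) * (deriv q (of_real x) / q (of_real x))) \<longlongrightarrow> 1) (at_right 1)"
  proof -
    have "((\<lambda>x::real. (x - 1) * (ln 2 * 2 powr (1 - x) / (1 - 2 powr (1 - x)))) \<longlongrightarrow> 1) (at_right 1)"
      by real_asymp
    then have "((\<lambda>x::real. complex_of_real ((x - 1) * (ln 2 * 2 powr (1 - x) / (1 - 2 powr (1 - x))))) \<longlongrightarrow> of_real 1) (at_right 1)"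
      by (rule tendsto_of_real)
    moreover have "complex_of_real ((x - 1) * (ln 2 * 2 powr (1 - x) / (1 - 2 powr (1 - x))))
        = of_real (x - 1) * (deriv q (of_real x) / q (of_real x))" for x :: real
    proof -
      have 1: "complex_of_real (2 powr (1 - x)) = 2 powr (1 - of_real x)"
        by (metis of_real_1 of_real_diff of_real_numeral powr_of_real zero_le_numeral)
      have "Ln 2 = complex_of_real (ln 2)" by (metis Ln_of_real of_real_numeral zero_less_numeral)
      moreover have "deriv q (of_real x) = Ln 2 * 2 powr (1 - of_real x)" by (rule DERIV_imp_deriv[OF dq])
      ultimately show ?thesis unfolding q_def by (simp add: 1)
    qed
    ultimately show ?thesis by simp
  qed
  have L1: "L 1 \<noteq> 0"
  proof -
    let ?t = "\<lambda>u::nat. \<Sum>r\<in>{1..2}. c r * of_real (real (2 * u + r)) powr (-1)"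
    have sm: "?t summable_on UNIV" using P(2)[of 1] by simp
    have re: "Re (?t u) = 1 / (2 * real u + 1) - 1 / (2 * real u + 2)" for u
    proof -
      have pm: "complex_of_real y powr (-1) = of_real (1 / y)" for y
        by (simp add: powr_minus field_simps)
      have "?t u = of_real (1 / real (2 * u + 1)) - of_real (1 / real (2 * u + 2))"
        unfolding two pm by (simp add: c_def add.commute)
      then have "Re (?t u) = 1 / real (2 * u + 1) - 1 / real (2 * u + 2)"
        by (simp only: minus_complex.sel Re_complex_of_real)
      then show ?thesis by (simp add: add_ac)
    qed
    \<comment> \<open>All blocks 1/(2u+1) - 1/(2u+2) are positive, and the first is already
      1/2.\<close>
    have "(\<Sum>u\<in>{0}. Re (?t u)) \<le> (\<Sum>\<^sub>\<infinity>u. Re (?t u))"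
    proof (rule finite_sum_le_infsum[OF summable_on_Re[OF sm]])
      show "Re (?t u) \<ge> 0" for u unfolding re by (simp add: frac_le)
    qed auto
    also have "\<dots> = Re (L 1)" unfolding L_def using infsum_Re[OF sm] by simp
    finally have "Re (L 1) \<ge> 1/2" by (simp only: re) simp
    then show ?thesis by auto
  qed
  obtain k :: nat where "((\<lambda>x. of_real (x - 1) * one.prime_sum x) \<longlongrightarrow> 1 - of_nat k) (at_right 1)"
    "L 1 \<noteq> 0 \<Longrightarrow> k = 0"
    by (rule one.prime_sum_residue[OF P(1) qhol qnz Lq qlim]) auto
  then show ?thesis using L1 by simp
qed

section \<open>Lambert series and nonvanishing at 1 for real characters\<close>

lemma abel_bound:
  fixes a b :: "nat \<Rightarrow> real"
  assumes A: "\<And>K. \<bar>\<Sum>m=1..K. a m\<bar> \<le> A" and dec: "\<And>m. m \<ge> 1 \<Longrightarrow> b (Suc m) \<le> b m"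
    and nonneg: "\<And>m. m \<ge> 1 \<Longrightarrow> b m \<ge> 0"
  shows "\<bar>\<Sum>m=1..K. a m * b m\<bar> \<le> A * b 1"
proof (cases "K \<ge> 1")
  case True
  \<comment> \<open>Abel summation: once the boundary term is subtracted, there remains a sum of
    partial sums of a times decrements of b, and these telescope to b 1 - b K.\<close>
  have "\<bar>(\<Sum>m=1..K. a m * b m) - (\<Sum>m=1..K. a m) * b K\<bar> \<le> A * (b 1 - b K)"
    using True
  proof (induction K rule: nat_induct_at_least)
    case (Suc K)
    have "(\<Sum>m=1..Suc K. a m * b m) - (\<Sum>m=1..Suc K. a m) * b (Suc K)
        = ((\<Sum>m=1..K. a m * b m) - (\<Sum>m=1..K. a m) * b K) + (\<Sum>m=1..K. a m) * (b K - b (Suc K))"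
      by (simp add: algebra_simps)
    also have "\<bar>\<dots>\<bar> \<le> A * (b 1 - b K) + A * (b K - b (Suc K))"
    proof (rule order_trans[OF abs_triangle_ineq add_mono])
      show "\<bar>(\<Sum>m=1..K. a m) * (b K - b (Suc K))\<bar> \<le> A * (b K - b (Suc K))"
        using A[of K] dec[OF Suc(1)] by (simp add: abs_mult mult_right_mono)
    qed (use Suc in auto)
    finally show ?case by (simp add: algebra_simps)
  qed auto
  moreover have "\<bar>(\<Sum>m=1..K. a m) * b K\<bar> \<le> A * b K"
    using A[of K] nonneg[OF True] by (simp add: abs_mult mult_right_mono)
  moreover have "A * (b 1 - b K) = A * b 1 - A * b K" by (rule right_diff_distrib)
  ultimately show ?thesis by linarith
next
  case False
  then have "K = 0" by simp
  have "A \<ge> 0" using A[of 0] by simp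
  then show ?thesis using nonneg[of 1] \<open>K = 0\<close> by simp
qed

text \<open>The terms j and m - 1 - j are paired; each pair is at least 2 r^(m-1) by the inequality
  of arithmetic and geometric means.\<close>

lemma sum_pow_lower_bound:
  fixes r :: real assumes "0 \<le> r"
  shows "(\<Sum>j<m. (r^2)^j) \<ge> real m * r ^ (m - 1)"
proof -
  have "(\<Sum>j<m. (r^2)^j) = (\<Sum>j<m. (r^2)^(m - 1 - j))"
    by (subst sum.nat_diff_reindex[symmetric]) simp
  then have "2 * (\<Sum>j<m. (r^2)^j) = (\<Sum>j<m. (r^2)^j + (r^2)^(m - 1 - j))"
    by (simp add: sum.distrib)
  also have "\<dots> \<ge> (\<Sum>j<m. 2 * r ^ (m - 1))"
  proof (rule sum_mono)
    fix j assume "j \<in> {..<m}"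
    then have "r ^ (m - 1) = r ^ j * r ^ (m - 1 - j)" by (simp flip: power_add)
    then show "2 * r ^ (m - 1) \<le> (r^2)^j + (r^2)^(m - 1 - j)"
      using sum_squares_bound[of "r ^ j" "r ^ (m - 1 - j)"] by (simp add: power_mult[symmetric] mult.commute[of 2])
  qed
  finally show ?thesis by simp
qed

text \<open>With s m = 1 + t + ... + t^(m-1) one has (1 - t) b m = 1/m - t^m / s m, and the decrease
  of b amounts to m (m+1) t^m <= s m s (m+1), a consequence of the inequality of means for both
  sums. These are the weights to which Abel summation is applied.\<close>

lemma lambert_coeff:
  fixes t :: real assumes t: "0 < t" "t < 1" and m: "m \<ge> 1"
  defines "b \<equiv> (\<lambda>m. 1 / (real m * (1 - t)) - t ^ m / (1 - t ^ m))"
  shows "b (Suc m) \<le> b m" "b m \<ge> 0"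
proof -
  define s where "s = (\<lambda>m. \<Sum>j<m. t ^ j)"
  have om: "1 - t ^ m = (1 - t) * s m" for m
    unfolding s_def by (simp add: one_diff_power_eq)
  have spos: "s m > 0" if "m \<ge> 1" for m
    unfolding s_def using that t by (intro sum_pos) (auto simp: lessThan_empty_iff)
  define r where "r = sqrt t"
  have r: "0 < r" "r < 1" "t = r ^ 2" using t by (auto simp: r_def)
  have slow: "s m \<ge> real m * r ^ (m - 1)" for m
    using sum_pow_lower_bound[of r m] r by (simp add: s_def)
  have "real m * real (Suc m) * t ^ m \<le> (real m * r ^ (m - 1)) * (real (Suc m) * r ^ m)"
  proof -
    have "t ^ m \<le> r ^ (m - 1) * r ^ m"
      unfolding r(3) power_mult[symmetric] power_add[symmetric] using r by (intro power_decreasing) auto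
    then have "real m * real (Suc m) * t ^ m \<le> real m * real (Suc m) * (r ^ (m - 1) * r ^ m)"
      by (intro mult_left_mono) auto
    then show ?thesis by (simp add: mult_ac)
  qed
  also have "\<dots> \<le> s m * s (Suc m)"
    using slow[of m] slow[of "Suc m"] r spos[OF m] by (intro mult_mono) auto
  finally have key: "real m * real (Suc m) * t ^ m \<le> s m * s (Suc m)" .
  have b_eq: "b m = (1 / real m - t ^ m / s m) / (1 - t)" if "m \<ge> 1" for m
    unfolding b_def om by (simp add: diff_divide_distrib mult.commute)
  have "t ^ m / s m - t ^ Suc m / s (Suc m) = t ^ m / (s m * s (Suc m))"
  proof -
    have "s (Suc m) - t * s m = 1"
    proof -
      have "s (Suc m) = 1 + t * s m"
        unfolding s_def by (subst sum.lessThan_Suc_shift) (simp add: sum_distrib_left)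
      then show ?thesis by simp
    qed
    then have "t ^ m * s (Suc m) - t ^ Suc m * s m = t ^ m" by (metis mult.assoc mult.commute mult.right_neutral power_Suc right_diff_distrib)
    moreover have "t ^ m / s m - t ^ Suc m / s (Suc m) = (t ^ m * s (Suc m) - t ^ Suc m * s m) / (s m * s (Suc m))"
      using spos[OF m] spos[of "Suc m"] by (simp add: field_simps)
    ultimately show ?thesis by simp
  qed
  also have "\<dots> \<le> 1 / (real m * real (Suc m))"
  proof -
    have "y / S \<le> 1 / Q" if "0 < Q" "0 < S" "Q * y \<le> S" for Q S y :: real
      using that by (simp add: field_simps)
    then show ?thesis using key m spos[OF m] spos[of "Suc m"] by simp
  qed
  also have "\<dots> = 1 / real m - 1 / real (Suc m)" using m by (simp add: field_simps)
  finally have "1 / real (Suc m) - t ^ Suc m / s (Suc m) \<le> 1 / real m - t ^ m / s m" by simp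
  then show "b (Suc m) \<le> b m" using b_eq[OF m] b_eq[of "Suc m"] t by (simp add: divide_right_mono)
  have "real m * t ^ m \<le> real m * r ^ (m - 1)"
    unfolding r(3) power_mult[symmetric] using r m by (intro mult_left_mono power_decreasing) auto
  then have "real m * t ^ m \<le> s m" using slow[of m] by linarith
  then have "t ^ m / s m \<le> 1 / real m" using m spos[OF m] by (simp add: field_simps)
  then show "b m \<ge> 0" using b_eq[OF m] t by simp
qed

locale real_dirichlet_character =
  fixes h :: "nat \<Rightarrow> real" and M :: nat
  assumes h1: "h 1 = 1" and h_mult: "h (m * n) = h m * h n" and h_val: "h n = -1 \<or> h n = 0 \<or> h n = 1"
    and h_per: "h (n mod M) = h n" and h_sum: "(\<Sum>r\<in>{1..M}. h r) = 0" and M: "M > 0"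
begin

lemma abs_h: "\<bar>h n\<bar> \<le> 1" using h_val[of n] by auto

text \<open>The convolution 1 * h, whose Dirichlet series is \<zeta>(s) L(s, h). It is nonnegative
  and at least 1 at squares, so that the sum of f n t^n is unbounded near t = 1.\<close>

definition f :: "nat \<Rightarrow> real" where "f n = (\<Sum>d | d dvd n. h d)"

lemma h_power: "h (n ^ k) = h n ^ k"
  using h1 by (induction k) (auto simp: h_mult)

lemma f_prime_power_mult:
  assumes p: "prime p" "\<not> p dvd m" and m: "m > 0"
  shows "f (p ^ k * m) = f m * (\<Sum>j\<le>k. h p ^ j)"
proof -
  have p0: "p > 0" using p prime_gt_0_nat by blast
  have inj: "inj_on (\<lambda>(d, j). p ^ j * d) ({d. d dvd m} \<times> {..k})"
  proof (rule inj_onI, clarify)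
    fix d j d' j' assume *: "d dvd m" "d' dvd m" "p ^ j * d = p ^ j' * d'"
    have nd: "\<not> p dvd d" "\<not> p dvd d'" using * p by (meson dvd_trans)+
    then have "multiplicity p (p ^ j * d) = j" "multiplicity p (p ^ j' * d') = j'"
      using p by (auto intro!: multiplicity_eqI multiplicity_prime_elem_times_other simp: prime_elem_multiplicity_mult_distrib)
    then have "j = j'" using *(3) by simp
    then show "d = d' \<and> j = j'" using *(3) p0 by simp
  qed
  have img: "(\<lambda>(d, j). p ^ j * d) ` ({d. d dvd m} \<times> {..k}) = {d. d dvd p ^ k * m}"
  proof (intro equalityI subsetI)
    fix x assume "x \<in> (\<lambda>(d, j). p ^ j * d) ` ({d. d dvd m} \<times> {..k})"
    then show "x \<in> {d. d dvd p ^ k * m}" by (auto intro!: mult_dvd_mono le_imp_power_dvd)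
  next
    fix x assume "x \<in> {d. d dvd p ^ k * m}"
    then obtain a d where x: "x = a * d" "a dvd p ^ k" "d dvd m" by (auto elim: dvd_productE)
    then obtain j where "j \<le> k" "a = p ^ j" using p divides_primepow_nat by blast
    with x show "x \<in> (\<lambda>(d, j). p ^ j * d) ` ({d. d dvd m} \<times> {..k})" by force
  qed
  have "f (p ^ k * m) = (\<Sum>(d, j) \<in> {d. d dvd m} \<times> {..k}. h (p ^ j * d))"
    unfolding f_def img[symmetric] by (subst sum.reindex[OF inj]) (simp add: case_prod_unfold)
  also have "\<dots> = (\<Sum>d | d dvd m. \<Sum>j\<le>k. h d * h p ^ j)"
    using m by (subst sum.Sigma) (auto simp: h_mult h_power mult.commute)
  also have "\<dots> = f m * (\<Sum>j\<le>k. h p ^ j)"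
    by (simp add: f_def sum_product)
  finally show ?thesis .
qed

text \<open>For h p = 1 the sum is k + 1, for h p = 0 it is 1 because \<open>0 ^ 0 = 1\<close>, and
  for h p = -1 it alternates between 1 and 0.\<close>

lemma geometric_nonneg: "(\<Sum>j\<le>k. h p ^ j) \<ge> 0" and geometric_even_ge_1: "(\<Sum>j\<le>2*l. h p ^ j) \<ge> 1"
proof -
  have alt: "(\<Sum>j\<le>k. (-1::real) ^ j) = (if even k then 1 else 0)" for k
    by (induction k) auto
  have zero: "(\<Sum>j\<le>k. (0::real) ^ j) = 1" for k by (induction k) auto
  show "(\<Sum>j\<le>k. h p ^ j) \<ge> 0" using h_val[of p] alt[of k] zero[of k] by auto
  show "(\<Sum>j\<le>2*l. h p ^ j) \<ge> 1" using h_val[of p] alt[of "2*l"] zero[of "2*l"] by auto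
qed

text \<open>A prime is removed together with its full power, so that the remaining factor is coprime
  to it.\<close>

lemma nat_prime_power_induct [consumes 1, case_names one step]:
  fixes n :: nat
  assumes n: "n > 0" and one: "P 1"
    and step: "\<And>p k m. prime p \<Longrightarrow> \<not> p dvd m \<Longrightarrow> m > 0 \<Longrightarrow> P m \<Longrightarrow> P (p ^ k * m)"
  shows "P n"
  using n
proof (induction n rule: less_induct)
  case (less n)
  show ?case
  proof (cases "n = 1")
    case False
    then obtain p where p: "prime p" "p dvd n" using prime_factor_nat by blast
    obtain m where m: "n = p ^ multiplicity p n * m" "\<not> p dvd m"
      by (rule multiplicity_decompose'[of n p]) (use p less in auto)
    have "multiplicity p n > 0" using p less by (simp add: prime_multiplicity_gt_zero_iff)
    then have "p ^ multiplicity p n > 1" using p prime_gt_1_nat one_less_power by blast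
    moreover have "m > 0" using m less by (intro gr0I) auto
    ultimately have "m < n" using m(1) by (metis mult.commute nat_mult_1_right mult_less_cancel1)
    then have "P m" using less \<open>m > 0\<close> by blast
    then show ?thesis using step[OF p(1) m(2) \<open>m > 0\<close>] m(1) by metis
  qed (use one in simp)
qed

lemma f_nonneg: "n > 0 \<Longrightarrow> f n \<ge> 0"
proof (induction n rule: nat_prime_power_induct)
  case one then show ?case by (simp add: f_def h1[simplified])
next
  case (step p k m)
  then show ?case using f_prime_power_mult[of p m k] geometric_nonneg by simp
qed

lemma f_square: "n > 0 \<Longrightarrow> f (n^2) \<ge> 1"
proof (induction n rule: nat_prime_power_induct)
  case one then show ?case by (simp add: f_def h1[simplified])
next
  case (step p k m)
  have "f ((p ^ k * m)^2) = f (p ^ (2 * k) * m^2)"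
    by (simp add: power_mult_distrib power_mult[symmetric] mult.commute)
  also have "\<dots> = f (m^2) * (\<Sum>j\<le>2*k. h p ^ j)"
    using step by (intro f_prime_power_mult) (auto simp: prime_dvd_power_iff)
  also have "\<dots> \<ge> 1 * 1"
    using step geometric_even_ge_1 by (intro mult_mono) (auto intro: order_trans[OF zero_le_one])
  finally show ?case by simp
qed

text \<open>Full periods sum to 0, and fewer than M terms of size at most 1 are left.\<close>

lemma partial_sum_bound: "\<bar>\<Sum>m=1..K. h m\<bar> \<le> real M"
proof (induction K rule: less_induct)
  case (less K)
  show ?case
  proof (cases "K < M")
    case True
    have "\<bar>\<Sum>m=1..K. h m\<bar> \<le> (\<Sum>m=1..K. \<bar>h m\<bar>)" by (rule sum_abs)
    also have "\<dots> \<le> (\<Sum>m=1..K. 1)" by (intro sum_mono abs_h)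
    finally show ?thesis using True by simp
  next
    case False
    have "(\<Sum>m=1..K. h m) = (\<Sum>m\<in>{1..M} \<union> {M+1..K}. h m)"
      using False by (intro sum.cong) auto
    also have "\<dots> = (\<Sum>m\<in>{M+1..K}. h m)" by (subst sum.union_disjoint) (auto simp: h_sum[simplified])
    also have "\<dots> = (\<Sum>m\<in>{1..K-M}. h (m + M))"
      using False by (intro sum.reindex_bij_witness[where j = "\<lambda>m. m - M" and i = "\<lambda>m. m + M"]) auto
    also have "\<dots> = (\<Sum>m\<in>{1..K-M}. h m)"
      by (intro sum.cong refl) (metis h_per mod_add_self2)
    finally show ?thesis using less[of "K - M"] M False by simp
  qed
qed

text \<open>Expanding t^m / (1 - t^m) as a geometric series and collecting the exponents n = m k
  turns the Lambert series into the sum of f n t^n. Dropping all n but squares leaves the lower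
  bound.\<close>

lemma lambert_sum:
  fixes t :: real assumes t: "0 < t" "t < 1"
  obtains T where "((\<lambda>m. h m * (t ^ m / (1 - t ^ m))) has_sum T) {1..}"
    "\<And>J. (\<Sum>j=1..J. t ^ (j^2)) \<le> T"
proof -
  let ?P = "{1..} \<times> {1..} :: (nat \<times> nat) set"
  have tm: "0 < t ^ m" "t ^ m < 1" if "m \<ge> 1" for m using t that by (auto simp: power_Suc_less_one power_less_one_iff)
  have geo: "((\<lambda>k. t ^ (m * k)) has_sum (t ^ m / (1 - t ^ m))) {1..}" if "m \<ge> 1" for m
    using has_sum_geometric_from_1[of "t ^ m"] tm[OF that] by (simp add: power_mult)
  have "(\<lambda>(m, k). t ^ (m * k)) summable_on ?P"
  proof (rule summable_on_SigmaI)
    show "((\<lambda>k. case (m, k) of (m, k) \<Rightarrow> t ^ (m * k)) has_sum (t ^ m / (1 - t ^ m))) {1..}" if "m \<in> {1..}" for m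
      using geo that by simp
    show "(\<lambda>m. t ^ m / (1 - t ^ m)) summable_on {1..}"
    proof (rule summable_on_comparison_test)
      have "(\<lambda>m. t ^ m) summable_on UNIV"
        using t by (subst summable_on_UNIV_nonneg_real_iff) (auto simp: summable_geometric_iff)
      then show "(\<lambda>m. 1 / (1 - t) * t ^ m) summable_on {1..}"
        by (intro summable_on_cmult_right) (rule summable_on_subset_banach, auto)
      fix m :: nat assume "m \<in> {1..}"
      then have "t ^ m \<le> t" using t power_decreasing[of 1 m t] by simp
      then show "t ^ m / (1 - t ^ m) \<le> 1 / (1 - t) * t ^ m"
        using t by (simp add: frac_le)
      show "0 \<le> t ^ m / (1 - t ^ m)" using tm[of m] \<open>m \<in> {1..}\<close> by simp
    qed
  qed (use t in auto)
  then have "(\<lambda>z. norm (case z of (m, k) \<Rightarrow> h m * t ^ (m * k))) summable_on ?P"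
    by (rule Infinite_Sum.abs_summable_on_comparison_test')
       (use t abs_h in \<open>auto simp: abs_mult mult_left_le_one_le\<close>)
  then obtain T where T: "((\<lambda>(m, k). h m * t ^ (m * k)) has_sum T) ?P"
    using abs_summable_summable summable_on_def by blast
  have 1: "((\<lambda>m. h m * (t ^ m / (1 - t ^ m))) has_sum T) {1..}"
    by (rule has_sum_SigmaD[OF T]) (use has_sum_cmult_right[OF geo] in simp)
  have bij: "bij_betw (\<lambda>(n, d). (d, n div d)) (SIGMA n:{1..}. {d. d dvd n}) ?P"
  proof (rule bij_betwI[where g = "\<lambda>(m, k). (m * k, m)"])
    show "(\<lambda>(n, d). (d, n div d)) \<in> (SIGMA n:{1..}. {d. d dvd n}) \<rightarrow> ?P"
      by (auto simp: Suc_le_eq div_greater_zero_iff dvd_imp_le intro: gr0I)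
  qed (auto simp: Suc_le_eq)
  have "((\<lambda>z. case (\<lambda>(n, d). (d, n div d)) z of (m, k) \<Rightarrow> h m * t ^ (m * k)) has_sum T) (SIGMA n:{1..}. {d. d dvd n})"
    using T by (rule iffD2[OF has_sum_reindex_bij_betw[OF bij]])
  then have 2: "((\<lambda>n. f n * t ^ n) has_sum T) {1..}"
  proof (rule has_sum_SigmaD)
    fix n :: nat assume n: "n \<in> {1..}"
    show "((\<lambda>d. case (\<lambda>(n, d). (d, n div d)) (n, d) of (m, k) \<Rightarrow> h m * t ^ (m * k)) has_sum (f n * t ^ n)) {d. d dvd n}"
      using n by (intro has_sum_finiteI) (auto simp: f_def sum_distrib_right intro!: sum.cong)
  qed
  have 3: "(\<Sum>j=1..J. t ^ (j^2)) \<le> T" for J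
  proof -
    have "(\<Sum>j=1..J. t ^ (j^2)) \<le> (\<Sum>j=1..J. f (j^2) * t ^ (j^2))"
      using f_square t by (intro sum_mono) (auto simp: Suc_le_eq)
    also have "\<dots> = (\<Sum>n\<in>(\<lambda>j. j^2) ` {1..J}. f n * t ^ n)"
      by (subst sum.reindex) (auto simp: inj_on_def)
    also have "\<dots> \<le> T"
      by (rule finite_sum_le_has_sum[OF 2]) (use f_nonneg t in \<open>auto simp: Suc_le_eq\<close>)
    finally show ?thesis .
  qed
  show ?thesis using that 1 3 by blast
qed

text \<open>Monsky's argument: if the series vanished, the Lambert series would stay bounded as $t \to 1$.\<close>

theorem L_one_nonzero: "\<not> (\<lambda>u. \<Sum>r\<in>{1..M}. h r / real (M * u + r)) sums 0"
proof
  assume L0: "(\<lambda>u. \<Sum>r\<in>{1..M}. h r / real (M * u + r)) sums 0"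
  have main: "(\<Sum>j=1..J. t ^ (j^2)) \<le> real M" if t: "0 < t" "t < 1" for t :: real and J
  proof -
    define c where "c = (\<lambda>m. t ^ m / (1 - t ^ m))"
    \<comment> \<open>If the sum of h m / m vanishes, then T is minus the sum of h m b m; as b
      decreases from b 1 = 1 and the partial sums of h are bounded by M, this is at most M in
      absolute value.\<close>
    define b where "b = (\<lambda>m. 1 / (real m * (1 - t)) - c m)"
    obtain T where T: "((\<lambda>m. h m * c m) has_sum T) {1..}" "(\<Sum>j=1..J. t ^ (j^2)) \<le> T"
      using lambert_sum[OF t] unfolding c_def by metis
    have "b 1 = 1" using t by (simp add: b_def c_def field_simps)
    then have ab: "\<bar>\<Sum>m=1..K. h m * b m\<bar> \<le> real M" for K
      using abel_bound[of h "real M" b K] partial_sum_bound lambert_coeff[OF t] by (auto simp: b_def c_def)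
    \<comment> \<open>The hypothesis concerns the series grouped by periods, so partial sums are
      taken at multiples of M.\<close>
    have grp: "(\<Sum>m=1..M*K. g m) = (\<Sum>u<K. \<Sum>r\<in>{1..M}. g (M * u + r))" for g :: "nat \<Rightarrow> real" and K
    proof (induction K)
      case (Suc K)
      have "(\<Sum>m=1..M*Suc K. g m) = (\<Sum>m\<in>{1..M*K} \<union> {M*K+1..M*K+M}. g m)"
        by (intro sum.cong) auto
      also have "\<dots> = (\<Sum>m=1..M*K. g m) + (\<Sum>m\<in>{M*K+1..M*K+M}. g m)"
        by (subst sum.union_disjoint) auto
      also have "(\<Sum>m\<in>{M*K+1..M*K+M}. g m) = (\<Sum>r\<in>{1..M}. g (M * K + r))"
        by (rule sum.reindex_bij_witness[where j = "\<lambda>m. m - M*K" and i = "\<lambda>r. M*K + r"]) auto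
      finally show ?case using Suc by simp
    qed auto
    have hM: "h (M * u + r) = h r" for u r by (metis h_per mod_mult_self4)
    have eq: "(\<Sum>m=1..M*K. h m * b m) = (\<Sum>u<K. \<Sum>r\<in>{1..M}. h r / real (M * u + r)) / (1 - t) - (\<Sum>m=1..M*K. h m * c m)" for K
    proof -
      have "(\<Sum>m=1..M*K. h m * b m) = (\<Sum>m=1..M*K. h m / real m) / (1 - t) - (\<Sum>m=1..M*K. h m * c m)"
        by (simp add: b_def sum_divide_distrib right_diff_distrib sum_subtractf)
      also have "(\<Sum>m=1..M*K. h m / real m) = (\<Sum>u<K. \<Sum>r\<in>{1..M}. h r / real (M * u + r))"
        by (subst grp) (simp only: hM)
      finally show ?thesis .
    qed
    have l1: "(\<lambda>K. (\<Sum>u<K. \<Sum>r\<in>{1..M}. h r / real (M * u + r)) / (1 - t)) \<longlonglongrightarrow> 0 / (1 - t)"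
      using L0 t unfolding sums_def by (intro tendsto_intros) auto
    have l2: "(\<lambda>K. \<Sum>m=1..M*K. h m * c m) \<longlonglongrightarrow> T"
    proof -
      have "filterlim (\<lambda>K. {1..M*K}) (finite_subsets_at_top {1..}) sequentially"
        unfolding filterlim_finite_subsets_at_top
      proof (intro allI impI)
        fix X :: "nat set" assume X: "finite X \<and> X \<subseteq> {1..}"
        show "\<forall>\<^sub>F K in sequentially. finite {1..M*K} \<and> X \<subseteq> {1..M*K} \<and> {1..M*K} \<subseteq> {1..}"
          using eventually_ge_at_top[of "Max (insert 0 X)"]
        proof eventually_elim
          case (elim K)
          have "x \<le> M * K" if "x \<in> X" for x
          proof -
            have "x \<le> K" using that X elim by (meson Max_ge finite_insert insertI2 order_trans)
            also have "K \<le> M * K" using M by simp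
            finally show ?thesis .
          qed
          then show ?case using X by auto
        qed
      qed
      then show ?thesis using T(1) unfolding has_sum_def by (rule filterlim_compose[rotated])
    qed
    have "(\<lambda>K. \<bar>\<Sum>m=1..M*K. h m * b m\<bar>) \<longlonglongrightarrow> \<bar>0 / (1 - t) - T\<bar>"
      unfolding eq by (intro tendsto_intros l1 l2)
    then have "\<bar>0 / (1 - t) - T\<bar> \<le> real M"
      by (rule LIMSEQ_le_const2) (use ab in auto)
    then show ?thesis using T(2) by simp
  qed
  \<comment> \<open>With M + 1 squares the left side tends to M + 1, beyond the bound M.\<close>
  have "((\<lambda>t::real. \<Sum>j=1..Suc M. t ^ (j^2)) \<longlongrightarrow> (\<Sum>j=1..Suc M. 1 ^ (j^2))) (at_left 1)"
    by (intro tendsto_intros)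
  moreover have "eventually (\<lambda>t::real. (\<Sum>j=1..Suc M. t ^ (j^2)) \<le> real M) (at_left 1)"
    using eventually_at_left_real[of 0 1] by (rule eventually_mono) (use main[where J = "Suc M"] in \<open>auto simp del: sum.cl_ivl_Suc\<close>)
  ultimately have "(\<Sum>j=1..Suc M. (1::real) ^ (j^2)) \<le> real M"
    by (intro tendsto_upperbound) auto
  then show False by simp
qed

end

section \<open>Mean values of Dirichlet characters over the primes\<close>

abbreviation nat_prime_sum :: "(nat \<Rightarrow> complex) \<Rightarrow> real \<Rightarrow> complex" where
  "nat_prime_sum \<equiv> prime_log_sum (\<lambda>n::nat. n)"

lemma eventually_gt_at_right_1: "eventually (\<lambda>x::real. x > 1) (at_right 1)"
  by (auto simp: eventually_at_filter)

lemma nat_prime_sum_has_sum: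
  assumes "\<psi> \<in> dchars M" "M > 0" "x > 1"
  shows "((\<lambda>p. \<psi> p * of_real (ln (real p) * real p powr (-x))) has_sum nat_prime_sum \<psi> x) {p. prime p}"
  unfolding prime_log_sum_def
  by (rule has_sum_infsum[OF normed_character.prime_sum_summable[OF dchar_normed_character[OF assms(1,2)] assms(3)]])

text \<open>The principal character differs from 1 only at the finitely many primes dividing M,
  which account for a bounded amount.\<close>

lemma residue_principal:
  assumes M: "M > 0"
  shows "((\<lambda>x. of_real (x - 1) * nat_prime_sum (principal_dchar M) x) \<longlongrightarrow> 1) (at_right 1)"
proof -
  interpret one: normed_character "\<lambda>n::nat. n" "\<lambda>_. 1"
    by unfold_locales auto
  let ?F = "{p. prime p \<and> p dvd M}"
  have fin: "finite ?F" using M by (auto intro: finite_subset[OF _ finite_divisors_nat[of M]])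
  have eq: "nat_prime_sum (principal_dchar M) x = nat_prime_sum (\<lambda>_. 1) x - (\<Sum>p\<in>?F. of_real (ln (real p) * real p powr (-x)))"
    if x: "x > 1" for x
  proof -
    have 1: "((\<lambda>p. 1 * of_real (ln (real p) * real p powr (-x))) has_sum nat_prime_sum (\<lambda>_. 1) x) {p. prime p}"
      unfolding prime_log_sum_def by (rule has_sum_infsum[OF one.prime_sum_summable[OF x]])
    have 2: "((\<lambda>p. if p dvd M then of_real (ln (real p) * real p powr (-x)) else 0) has_sum
           (\<Sum>p\<in>?F. of_real (ln (real p) * real p powr (-x)))) {p. prime p}"
      by (rule has_sum_finite_neutralI[OF fin]) auto
    have "((\<lambda>p. 1 * of_real (ln (real p) * real p powr (-x)) + - (if p dvd M then of_real (ln (real p) * real p powr (-x)) else 0)) has_sum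
       (nat_prime_sum (\<lambda>_. 1) x + - (\<Sum>p\<in>?F. of_real (ln (real p) * real p powr (-x))))) {p. prime p}"
      by (intro has_sum_add 1 has_sum_uminusI 2)
    moreover have "((\<lambda>p. 1 * of_real (ln (real p) * real p powr (-x)) + - (if p dvd M then of_real (ln (real p) * real p powr (-x)) else 0)) has_sum
       nat_prime_sum (principal_dchar M) x) {p. prime p}"
    proof (rule iffD1[OF has_sum_cong nat_prime_sum_has_sum[OF principal_dchar_in[OF M] M x]])
      fix p :: nat assume "p \<in> {p. prime p}"
      then have "coprime p M \<longleftrightarrow> \<not> p dvd M"
        by (metis coprime_absorb_left mem_Collect_eq not_prime_unit prime_imp_coprime)
      then show "principal_dchar M p * of_real (ln (real p) * real p powr (-x)) =
        1 * of_real (ln (real p) * real p powr (-x)) + - (if p dvd M then of_real (ln (real p) * real p powr (-x)) else 0)"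
        by (simp add: principal_dchar_def)
    qed
    ultimately show ?thesis using has_sum_unique by fastforce
  qed
  have "((\<lambda>x. of_real (x - 1) * nat_prime_sum (\<lambda>_. 1) x - of_real (x - 1) * (\<Sum>p\<in>?F. complex_of_real (ln (real p) * real p powr (-x))))
     \<longlongrightarrow> 1 - of_real (1 - 1) * (\<Sum>p\<in>?F. of_real (ln (real p) * real p powr (-1)))) (at_right 1)"
    by (intro tendsto_intros tendsto_residue_zeta) (auto simp: prime_gt_0_nat)
  then have "((\<lambda>x. of_real (x - 1) * nat_prime_sum (\<lambda>_. 1) x - of_real (x - 1) * (\<Sum>p\<in>?F. complex_of_real (ln (real p) * real p powr (-x))))
     \<longlongrightarrow> 1) (at_right 1)" by simp
  then show ?thesis
    by (rule Lim_transform_eventually)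
       (use eventually_gt_at_right_1 in eventually_elim, simp add: eq right_diff_distrib)
qed

text \<open>For z = exp(i \<phi>) this is the inequality 3 + 4 cos \<phi> + cos 2\<phi> = 2 (1 + cos
  \<phi>)^2 >= 0 of Mertens.\<close>

lemma re_341:
  assumes "norm z = 1" shows "3 + 4 * Re z + Re (z ^ 2) \<ge> 0"
proof -
  have "(Re z)\<^sup>2 + (Im z)\<^sup>2 = 1" using assms by (simp add: cmod_def)
  then have "3 + 4 * Re z + Re (z ^ 2) = 2 * (1 + Re z)\<^sup>2"
    by (simp add: power2_eq_square algebra_simps)
  then show ?thesis by simp
qed

text \<open>The limit is -k, with k the order of the zero at 1. If \<psi>^2 is not principal, the
  3-4-1 inequality gives 3 - 4 k - k' >= 0. If it is, \<psi>^2 has mean value 1 and the inequality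
  says no more than 4 - 4 k >= 0; there the nonvanishing of the real series at 1 is used.\<close>

lemma residue_dchar:
  assumes M: "M > 1" and \<psi>: "\<psi> \<in> dchars M" "\<psi> \<noteq> principal_dchar M"
  shows "((\<lambda>x. of_real (x - 1) * nat_prime_sum \<psi> x) \<longlongrightarrow> 0) (at_right 1)"
proof -
  have M0: "M > 0" using M by simp
  define L where "L = (\<lambda>\<psi> s. \<Sum>\<^sub>\<infinity>u::nat. \<Sum>r\<in>{1..M}. \<psi> r * complex_of_real (real (M * u + r)) powr (-s))"
  have sum0: "(\<Sum>r\<in>{1..M}. \<psi> r) = 0" if "\<psi> \<in> dchars M" "\<psi> \<noteq> principal_dchar M" for \<psi>
  proof -
    \<comment> \<open>The residues 0, ..., M - 1 are traded for 1, ..., M by periodicity.\<close>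
    have "\<psi> 0 + (\<Sum>r\<in>{1..M}. \<psi> r) = (\<Sum>r\<in>{0..M}. \<psi> r)" by (simp add: sum.atLeast_Suc_atMost)
    also have "\<dots> = (\<Sum>r<M. \<psi> r) + \<psi> M" by (simp add: atLeast0AtMost lessThan_Suc_atMost[symmetric])
    also have "\<psi> M = \<psi> 0" using dcharsD(3)[OF that(1), of M] by simp
    finally show ?thesis using sum_dchar_residues[OF M that] by simp
  qed
  note P = periodic_series_holomorphic[OF M0]
  have ex: "\<exists>k::nat. ((\<lambda>x. of_real (x - 1) * nat_prime_sum \<psi> x) \<longlongrightarrow> - of_nat k) (at_right 1) \<and> (L \<psi> 1 \<noteq> 0 \<longrightarrow> k = 0)"
    if psi: "\<psi> \<in> dchars M" "\<psi> \<noteq> principal_dchar M" for \<psi>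
  proof -
    have bdd: "norm (\<psi> n) \<le> 1" for n using norm_dchar[OF psi(1) M0, of n] by auto
    note PP = P[OF dcharsD(3)[OF psi(1)] sum0[OF psi] bdd]
    show ?thesis
      by (rule normed_character.prime_sum_residue_nonpos[OF dchar_normed_character[OF psi(1) M0], of "L \<psi>"])
         (use PP in \<open>auto simp: L_def\<close>)
  qed
  obtain k :: nat where k: "((\<lambda>x. of_real (x - 1) * nat_prime_sum \<psi> x) \<longlongrightarrow> - of_nat k) (at_right 1)" "L \<psi> 1 \<noteq> 0 \<longrightarrow> k = 0"
    using ex[OF \<psi>] by blast
  define \<psi>2 where "\<psi>2 = (\<lambda>n. \<psi> n * \<psi> n)"
  have \<psi>2: "\<psi>2 \<in> dchars M" unfolding \<psi>2_def by (intro dchars_mult \<psi>)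
  have "k = 0"
  proof (cases "\<psi>2 = principal_dchar M")
    case False
    obtain k' :: nat where k': "((\<lambda>x. of_real (x - 1) * nat_prime_sum \<psi>2 x) \<longlongrightarrow> - of_nat k') (at_right 1)"
      using ex[OF \<psi>2 False] by blast
    have nonneg: "Re (3 * nat_prime_sum (principal_dchar M) x + 4 * nat_prime_sum \<psi> x + nat_prime_sum \<psi>2 x) \<ge> 0"
      if x: "x > 1" for x
    proof -
      let ?w = "\<lambda>p. ln (real p) * real p powr (-x)"
      have "((\<lambda>p. 3 * (principal_dchar M p * of_real (?w p)) + 4 * (\<psi> p * of_real (?w p)) + \<psi>2 p * of_real (?w p)) has_sum
        (3 * nat_prime_sum (principal_dchar M) x + 4 * nat_prime_sum \<psi> x + nat_prime_sum \<psi>2 x)) {p. prime p}"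
        by (intro has_sum_add has_sum_cmult_right nat_prime_sum_has_sum[OF _ M0 x] principal_dchar_in M0 \<psi> \<psi>2)
      from has_sum_Re[OF this] show ?thesis
      proof (rule has_sum_nonneg)
        fix p :: nat assume "p \<in> {p. prime p}"
        then have w: "?w p \<ge> 0" using prime_gt_0_nat[of p] by simp
        have "0 \<le> Re (3 * principal_dchar M p + 4 * \<psi> p + \<psi>2 p)"
        proof (cases "coprime p M")
          case True
          then show ?thesis using re_341[of "\<psi> p"] norm_dchar[OF \<psi>(1) M0, of p]
            by (simp add: principal_dchar_def \<psi>2_def power2_eq_square)
        qed (use dcharsD(4)[OF \<psi>(1)] in \<open>auto simp: principal_dchar_def \<psi>2_def\<close>)
        then have "0 \<le> Re (3 * principal_dchar M p + 4 * \<psi> p + \<psi>2 p) * ?w p" using w by (rule mult_nonneg_nonneg)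
        also have "\<dots> = Re ((3 * principal_dchar M p + 4 * \<psi> p + \<psi>2 p) * of_real (?w p))"
          by (simp del: of_real_mult)
        also have "(3 * principal_dchar M p + 4 * \<psi> p + \<psi>2 p) * of_real (?w p) =
            3 * (principal_dchar M p * of_real (?w p)) + 4 * (\<psi> p * of_real (?w p)) + \<psi>2 p * of_real (?w p)"
          by (simp only: distrib_right mult.assoc)
        finally show "0 \<le> Re (3 * (principal_dchar M p * of_real (?w p)) + 4 * (\<psi> p * of_real (?w p)) + \<psi>2 p * of_real (?w p))" .
      qed
    qed
    have "((\<lambda>x. Re (3 * (of_real (x - 1) * nat_prime_sum (principal_dchar M) x) + 4 * (of_real (x - 1) * nat_prime_sum \<psi> x)
        + of_real (x - 1) * nat_prime_sum \<psi>2 x)) \<longlongrightarrow> Re (3 * 1 + 4 * (- of_nat k) + - of_nat k')) (at_right 1)"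
      by (intro tendsto_intros k k' residue_principal M0)
    moreover have "eventually (\<lambda>x. 0 \<le> Re (3 * (of_real (x - 1) * nat_prime_sum (principal_dchar M) x) + 4 * (of_real (x - 1) * nat_prime_sum \<psi> x)
        + of_real (x - 1) * nat_prime_sum \<psi>2 x)) (at_right 1)"
      using eventually_gt_at_right_1
    proof eventually_elim
      case (elim x)
      have "0 \<le> (x - 1) * Re (3 * nat_prime_sum (principal_dchar M) x + 4 * nat_prime_sum \<psi> x + nat_prime_sum \<psi>2 x)"
        using nonneg[OF elim] elim by (intro mult_nonneg_nonneg) auto
      also have "\<dots> = Re (of_real (x - 1) * (3 * nat_prime_sum (principal_dchar M) x + 4 * nat_prime_sum \<psi> x + nat_prime_sum \<psi>2 x))"
        by (simp del: of_real_diff)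
      finally show ?case by (simp only: distrib_left mult_ac)
    qed
    ultimately have "0 \<le> Re (3 * 1 + 4 * (- of_nat k) + - of_nat k' :: complex)"
      by (intro tendsto_lowerbound) auto
    then show ?thesis by simp
  next
    case True
    define h where "h = (\<lambda>n. Re (\<psi> n))"
    have val: "\<psi> n = -1 \<or> \<psi> n = 0 \<or> \<psi> n = 1" for n
    proof (cases "coprime n M")
      case cop: True
      have "\<psi> n * \<psi> n = 1" using fun_cong[OF True, of n] cop by (simp add: \<psi>2_def principal_dchar_def)
      then have "\<psi> n = 1 \<or> \<psi> n = -1" using square_eq_1_iff by blast
      then show ?thesis by auto
    qed (use dcharsD(4)[OF \<psi>(1)] in auto)
    have \<psi>h: "\<psi> n = of_real (h n)" for n using val[of n] by (auto simp: h_def)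
    interpret real_dirichlet_character h M
    proof
      show "h 1 = 1" by (simp only: h_def dcharsD(1)[OF \<psi>(1)] one_complex.sel)
      show "h (m * n) = h m * h n" for m n
        using \<psi>h[of m] \<psi>h[of n] by (simp only: h_def dcharsD(2)[OF \<psi>(1)]) (metis Re_complex_of_real of_real_mult)
      show "h n = -1 \<or> h n = 0 \<or> h n = 1" for n using val[of n] by (auto simp: h_def)
      show "h (n mod M) = h n" for n by (simp only: h_def dcharsD(3)[OF \<psi>(1)])
      show "(\<Sum>r\<in>{1..M}. h r) = 0" unfolding h_def Re_sum[symmetric] sum0[OF \<psi>] by simp
    qed (use M0 in auto)
    have "L \<psi> 1 \<noteq> 0"
    proof
      assume L1: "L \<psi> 1 = 0"
      have bdd: "norm (\<psi> n) \<le> 1" for n using norm_dchar[OF \<psi>(1) M0, of n] by auto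
      have "(\<lambda>u::nat. \<Sum>r\<in>{1..M}. \<psi> r * of_real (real (M * u + r)) powr (-1)) summable_on UNIV"
        by (rule P(2)[OF dcharsD(3)[OF \<psi>(1)] sum0[OF \<psi>] bdd]) simp
      from has_sum_infsum[OF this] have "((\<lambda>u::nat. \<Sum>r\<in>{1..M}. \<psi> r * of_real (real (M * u + r)) powr (-1)) has_sum 0) UNIV"
        using L1 unfolding L_def by (simp only:)
      from sums_Re[OF has_sum_imp_sums[OF this]]
      have "(\<lambda>u. Re (\<Sum>r\<in>{1..M}. \<psi> r * of_real (real (M * u + r)) powr (-1))) sums 0" by simp
      moreover have "Re (\<Sum>r\<in>{1..M}. \<psi> r * of_real (real (M * u + r)) powr (-1)) = (\<Sum>r\<in>{1..M}. h r / real (M * u + r))" for u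
      proof -
        have "\<psi> r * of_real (real (M * u + r)) powr (-1) = of_real (h r / real (M * u + r))" for r
          unfolding \<psi>h[of r] by (simp add: powr_minus field_simps)
        then show ?thesis by (simp only: Re_sum Re_complex_of_real)
      qed
      ultimately show False using L_one_nonzero by (simp only:)
    qed
    then show ?thesis using k(2) by blast
  qed
  then show ?thesis using k(1) by simp
qed

lemma has_sum_finite_sum:
  fixes f :: "'i \<Rightarrow> 'b \<Rightarrow> complex"
  assumes "\<And>i. i \<in> I \<Longrightarrow> (f i has_sum S i) A"
  shows "((\<lambda>x. \<Sum>i\<in>I. f i x) has_sum (\<Sum>i\<in>I. S i)) A"
  using assms by (induction I rule: infinite_finite_induct) (auto intro!: has_sum_add)

text \<open>By orthogonality the sum over the class of c is a combination of the twisted sums, of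
  which only the principal one has a nonzero mean value, with coefficient 1.\<close>

theorem dirichlet_density:
  assumes M: "M > 1" and c: "coprime c M"
  shows "((\<lambda>x. (x - 1) * (\<Sum>\<^sub>\<infinity>p\<in>{p. prime p \<and> [p = c] (mod M)}. ln (real p) * real p powr (-x)))
           \<longlongrightarrow> 1 / real (totient M)) (at_right 1)"
proof -
  have M0: "M > 0" using M by simp
  let ?S = "\<lambda>x. \<Sum>\<^sub>\<infinity>p\<in>{p. prime p \<and> [p = c] (mod M)}. ln (real p) * real p powr (-x)"
  have tot: "totient M > 0" using M0 by simp
  have eq: "(\<Sum>\<psi>\<in>dchars M. cnj (\<psi> c) * nat_prime_sum \<psi> x) = of_nat (totient M) * of_real (?S x)" if x: "x > 1" for x
  proof -
    let ?w = "\<lambda>p. ln (real p) * real p powr (-x)"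
    have "((\<lambda>p. \<Sum>\<psi>\<in>dchars M. cnj (\<psi> c) * (\<psi> p * of_real (?w p))) has_sum (\<Sum>\<psi>\<in>dchars M. cnj (\<psi> c) * nat_prime_sum \<psi> x)) {p. prime p}"
      by (intro has_sum_finite_sum has_sum_cmult_right nat_prime_sum_has_sum[OF _ M0 x])
    moreover have "(\<Sum>\<psi>\<in>dchars M. cnj (\<psi> c) * (\<psi> p * of_real (?w p))) = of_nat (totient M) * (if [p = c] (mod M) then of_real (?w p) else 0)" for p
    proof -
      have "(\<Sum>\<psi>\<in>dchars M. cnj (\<psi> c) * (\<psi> p * of_real (?w p))) = (\<Sum>\<psi>\<in>dchars M. cnj (\<psi> c) * \<psi> p) * of_real (?w p)"
        by (simp only: sum_distrib_right mult.assoc)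
      then show ?thesis by (simp add: dchars_orthogonality[OF M c])
    qed
    ultimately have "((\<lambda>p. of_nat (totient M) * (if [p = c] (mod M) then of_real (?w p) else 0)) has_sum
        (\<Sum>\<psi>\<in>dchars M. cnj (\<psi> c) * nat_prime_sum \<psi> x)) {p. prime p}" by (simp only:)
    moreover have "(of_real \<circ> ?w has_sum complex_of_real (?S x)) {p. prime p \<and> [p = c] (mod M)}"
      unfolding o_def by (intro has_sum_of_real has_sum_infsum summable_on_subset_banach[OF nat_norm.N_ln_summable[OF x]]) auto
    then have "((\<lambda>p. if [p = c] (mod M) then complex_of_real (?w p) else 0) has_sum of_real (?S x)) {p. prime p}"
      by (subst has_sum_cong_neutral[where T = "{p. prime p \<and> [p = c] (mod M)}" and g = "of_real \<circ> ?w"]) auto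
    then have "((\<lambda>p. of_nat (totient M) * (if [p = c] (mod M) then complex_of_real (?w p) else 0)) has_sum
        (of_nat (totient M) * of_real (?S x))) {p. prime p}" by (rule has_sum_cmult_right)
    ultimately show ?thesis using has_sum_unique by blast
  qed
  have lim: "((\<lambda>x. of_real (x - 1) * nat_prime_sum \<psi> x) \<longlongrightarrow> (if \<psi> = principal_dchar M then 1 else 0)) (at_right 1)"
    if "\<psi> \<in> dchars M" for \<psi>
    using residue_principal[OF M0] residue_dchar[OF M that] by auto
  have "((\<lambda>x. \<Sum>\<psi>\<in>dchars M. cnj (\<psi> c) * (of_real (x - 1) * nat_prime_sum \<psi> x)) \<longlongrightarrow>
      (\<Sum>\<psi>\<in>dchars M. cnj (\<psi> c) * (if \<psi> = principal_dchar M then 1 else 0))) (at_right 1)"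
    by (intro tendsto_intros lim)
  also have "(\<Sum>\<psi>\<in>dchars M. cnj (\<psi> c) * (if \<psi> = principal_dchar M then 1 else 0)) = 1"
    using principal_dchar_in[OF M0] finite_dchars[OF M0] c
    by (subst sum.remove[of _ "principal_dchar M"]) (auto simp: principal_dchar_def intro!: sum.neutral)
  finally have "((\<lambda>x. of_nat (totient M) * complex_of_real ((x - 1) * ?S x)) \<longlongrightarrow> 1) (at_right 1)"
  proof (rule Lim_transform_eventually)
    show "eventually (\<lambda>x. (\<Sum>\<psi>\<in>dchars M. cnj (\<psi> c) * (of_real (x - 1) * nat_prime_sum \<psi> x)) =
        of_nat (totient M) * complex_of_real ((x - 1) * ?S x)) (at_right 1)"
      using eventually_gt_at_right_1
    proof eventually_elim
      case (elim x)
      have "(\<Sum>\<psi>\<in>dchars M. cnj (\<psi> c) * (of_real (x - 1) * nat_prime_sum \<psi> x)) = of_real (x - 1) * (\<Sum>\<psi>\<in>dchars M. cnj (\<psi> c) * nat_prime_sum \<psi> x)"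
        by (simp only: sum_distrib_left mult_ac)
      also have "\<dots> = of_nat (totient M) * complex_of_real ((x - 1) * ?S x)"
        by (simp only: eq[OF elim] of_real_mult mult_ac)
      finally show ?case .
    qed
  qed
  then have "((\<lambda>x. Re (of_nat (totient M) * complex_of_real ((x - 1) * ?S x)) / real (totient M)) \<longlongrightarrow> Re 1 / real (totient M)) (at_right 1)"
    using tot by (intro tendsto_intros) auto
  moreover have "Re (of_nat (totient M) * complex_of_real ((x - 1) * ?S x)) / real (totient M) = (x - 1) * ?S x" for x
  proof -
    have "Re (of_nat (totient M) * complex_of_real y) = real (totient M) * y" for y by simp
    then show ?thesis using tot by (simp only:) simp
  qed
  ultimately show ?thesis by (simp only: one_complex.sel)
qed

section \<open>Eisenstein integers\<close>

text \<open>\<open>Eis a b\<close> stands for $a + b\omega$ with $\omega^2 + \omega + 1 = 0$.\<close>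

datatype eis = Eis (re: int) (om: int)

lemma eis_eq_iff: "z = w \<longleftrightarrow> re z = re w \<and> om z = om w"
  by (cases z; cases w) auto

instantiation eis :: comm_ring_1
begin

definition "0 = Eis 0 0"
definition "1 = Eis 1 0"
definition "z + w = Eis (re z + re w) (om z + om w)"
definition "z - w = Eis (re z - re w) (om z - om w)"
definition "- z = Eis (- re z) (- om z)"
definition "z * w = Eis (re z * re w - om z * om w) (re z * om w + om z * re w - om z * om w)"

instance
  by standard
     (auto simp: eis_eq_iff zero_eis_def one_eis_def plus_eis_def minus_eis_def uminus_eis_def times_eis_def algebra_simps)

end

lemma eis_sel [simp]:
  "re 0 = 0" "om 0 = 0" "re 1 = 1" "om 1 = 0"
  "re (z + w) = re z + re w" "om (z + w) = om z + om w"
  "re (z - w) = re z - re w" "om (z - w) = om z - om w"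
  "re (- z) = - re z" "om (- z) = - om z"
  "re (z * w) = re z * re w - om z * om w" "om (z * w) = re z * om w + om z * re w - om z * om w"
  by (auto simp: zero_eis_def one_eis_def plus_eis_def minus_eis_def uminus_eis_def times_eis_def)

lemma eis_of_nat [simp]: "re (of_nat n) = int n" "om (of_nat n) = 0"
  by (induction n) auto

lemma eis_of_int [simp]: "re (of_int n) = n" "om (of_int n) = 0"
  by (cases n rule: int_cases2; simp)+

definition eisnorm :: "eis \<Rightarrow> int" where
  "eisnorm z = re z ^ 2 - re z * om z + om z ^ 2"

definition eiscnj :: "eis \<Rightarrow> eis" where
  "eiscnj z = Eis (re z - om z) (- om z)"

lemma eiscnj_sel [simp]: "re (eiscnj z) = re z - om z" "om (eiscnj z) = - om z"
  by (auto simp: eiscnj_def)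

lemma eiscnj_mult: "eiscnj (z * w) = eiscnj z * eiscnj w"
  by (simp add: eis_eq_iff algebra_simps)

lemma eiscnj_cnj [simp]: "eiscnj (eiscnj z) = z"
  by (simp add: eis_eq_iff)

lemma eisnorm_mult: "eisnorm (z * w) = eisnorm z * eisnorm w"
  by (simp add: eisnorm_def power2_eq_square algebra_simps)

lemma eisnorm_cnj [simp]: "eisnorm (eiscnj z) = eisnorm z"
  by (simp add: eisnorm_def power2_eq_square algebra_simps)

lemma mult_eiscnj: "z * eiscnj z = of_int (eisnorm z)"
  by (simp add: eis_eq_iff eisnorm_def power2_eq_square algebra_simps)

lemma eisnorm_0 [simp]: "eisnorm 0 = 0" and eisnorm_1 [simp]: "eisnorm 1 = 1"
  by (auto simp: eisnorm_def)

lemma two_eisnorm: "2 * eisnorm z = re z ^ 2 + om z ^ 2 + (re z - om z) ^ 2"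
  by (simp add: eisnorm_def power2_eq_square algebra_simps)

lemma eisnorm_nonneg [simp]: "eisnorm z \<ge> 0"
proof -
  have "2 * eisnorm z \<ge> 0" unfolding two_eisnorm by (intro add_nonneg_nonneg) auto
  then show ?thesis by simp
qed

lemma eisnorm_eq_0_iff [simp]: "eisnorm z = 0 \<longleftrightarrow> z = 0"
proof
  assume "eisnorm z = 0"
  then have "re z ^ 2 + om z ^ 2 + (re z - om z) ^ 2 = 0" using two_eisnorm[of z] by simp
  then have "re z ^ 2 = 0" "om z ^ 2 = 0"
    using zero_le_power2[of "re z"] zero_le_power2[of "om z"] zero_le_power2[of "re z - om z"] by linarith+
  then show "z = 0" by (simp add: eis_eq_iff)
qed auto

lemma eisnorm_ge_1: "z \<noteq> 0 \<Longrightarrow> 1 \<le> eisnorm z"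
  using eisnorm_nonneg[of z] eisnorm_eq_0_iff[of z] by linarith

instance eis :: idom
proof
  fix z w :: eis assume "z \<noteq> 0" "w \<noteq> 0"
  then have "eisnorm (z * w) \<noteq> 0" by (simp add: eisnorm_mult)
  then show "z * w \<noteq> 0" using eisnorm_eq_0_iff by blast
qed

text \<open>For n > 0 this is x / n rounded to a nearest integer.\<close>

definition rnd :: "int \<Rightarrow> int \<Rightarrow> int" where
  "rnd x n = (2 * x + n) div (2 * n)"

lemma rnd_bound:
  assumes "n > 0" shows "\<bar>2 * (x - n * rnd x n)\<bar> \<le> n"
proof -
  define q where "q = rnd x n"
  have "(2 * n) * q + (2 * x + n) mod (2 * n) = 2 * x + n"
    unfolding q_def rnd_def by simp
  moreover have "0 \<le> (2 * x + n) mod (2 * n)" "(2 * x + n) mod (2 * n) < 2 * n" using assms by auto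
  ultimately show ?thesis unfolding q_def[symmetric] by (simp add: abs_le_iff algebra_simps)
qed

lemma rnd_mult: "n > 0 \<Longrightarrow> rnd (x * n) n = x"
proof -
  assume n: "n > 0"
  have "2 * (x * n) + n = n + x * (2 * n)" by (simp add: algebra_simps)
  then show ?thesis using n unfolding rnd_def by (simp only: div_mult_self1) simp
qed

instantiation eis :: euclidean_ring
begin

definition divide_eis :: "eis \<Rightarrow> eis \<Rightarrow> eis" where
  "divide_eis z w = (if w = 0 then 0 else
     Eis (rnd (re (z * eiscnj w)) (eisnorm w)) (rnd (om (z * eiscnj w)) (eisnorm w)))"

definition modulo_eis :: "eis \<Rightarrow> eis \<Rightarrow> eis" where
  "modulo_eis z w = z - z div w * w"

definition euclidean_size_eis :: "eis \<Rightarrow> nat" where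
  "euclidean_size_eis z = nat (eisnorm z)"

instance
proof
  fix z w :: eis
  show "z div 0 = 0" by (simp add: divide_eis_def)
  show "z * w div w = z" if "w \<noteq> 0"
  proof -
    have n: "eisnorm w > 0" using eisnorm_ge_1[OF that] by simp
    have eq: "z * w * eiscnj w = z * of_int (eisnorm w)" by (simp only: mult.assoc mult_eiscnj)
    have "re (z * w * eiscnj w) = re z * eisnorm w" "om (z * w * eiscnj w) = om z * eisnorm w"
      unfolding eq by simp_all
    then have "z * w div w = Eis (re z) (om z)"
      by (simp only: divide_eis_def if_not_P[OF that] rnd_mult[OF n])
    then show ?thesis by simp
  qed
  show "z div w * w + z mod w = z" by (simp add: modulo_eis_def)
  show "euclidean_size (0 :: eis) = 0" by (simp add: euclidean_size_eis_def)
  show "euclidean_size (z mod w) < euclidean_size w" if "w \<noteq> 0"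
  proof -
    define n where "n = eisnorm w"
    have n: "n > 0" using eisnorm_ge_1[OF that] by (simp add: n_def)
    \<comment> \<open>Multiplication by the conjugate of w clears denominators: the coordinates of e
      are n times the rounding errors, hence at most n/2 each. So N(e) <= 3 n^2 / 4, and division by
      N(w) = n leaves a remainder of norm at most 3 n / 4.\<close>
    define e where "e = (z mod w) * eiscnj w"
    define y where "y = z * eiscnj w"
    have e: "e = y - (z div w) * of_int n"
      by (simp only: e_def y_def modulo_eis_def left_diff_distrib mult.assoc mult_eiscnj n_def)
    have "z div w = Eis (rnd (re y) n) (rnd (om y) n)"
      by (simp only: divide_eis_def if_not_P[OF that] y_def n_def)
    then have "re e = re y - n * rnd (re y) n" "om e = om y - n * rnd (om y) n"
      unfolding e by (simp_all add: mult.commute)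
    then have re: "\<bar>2 * re e\<bar> \<le> n" and om: "\<bar>2 * om e\<bar> \<le> n"
      using rnd_bound[OF n] by simp_all
    have "4 * eisnorm e = (2 * re e)^2 + (2 * om e)^2 - (2 * re e) * (2 * om e)"
      by (simp add: eisnorm_def power2_eq_square)
    also have "\<dots> \<le> n^2 + n^2 + n * n"
    proof -
      have "(2 * re e)^2 \<le> n^2" "(2 * om e)^2 \<le> n^2" using power_mono[OF re, of 2] power_mono[OF om, of 2] by (simp_all only: abs_ge_zero power2_abs)
      moreover have "\<bar>(2 * re e) * (2 * om e)\<bar> \<le> n * n"
        unfolding abs_mult[of "2 * re e"] using re om by (intro mult_mono) auto
      ultimately show ?thesis by linarith
    qed
    finally have "4 * eisnorm e \<le> 3 * n * n" by (simp add: power2_eq_square)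
    then have "4 * eisnorm (z mod w) * n \<le> 3 * n * n"
      by (simp add: e_def eisnorm_mult n_def)
    then have "4 * eisnorm (z mod w) \<le> 3 * n" using n mult_le_cancel_right_pos by blast
    then show ?thesis using n eisnorm_nonneg[of "z mod w"] by (simp add: euclidean_size_eis_def n_def[symmetric])
  qed
  show "euclidean_size z \<le> euclidean_size (z * w)" if "w \<noteq> 0"
  proof -
    have "1 \<le> eisnorm w" using eisnorm_ge_1[OF that] .
    then have "eisnorm z * 1 \<le> eisnorm z * eisnorm w" by (intro mult_left_mono) auto
    then show ?thesis by (simp add: euclidean_size_eis_def eisnorm_mult nat_mono)
  qed
qed

end

text \<open>Any choice of representatives of the classes of associated elements will do.\<close>

definition eis_rep :: "eis \<Rightarrow> eis" where
  "eis_rep z = (if z = 0 then 0 else if z dvd 1 then 1 else (SOME w. z dvd w \<and> w dvd z))"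

lemma eis_rep_dvd: "z dvd eis_rep z" "eis_rep z dvd z"
proof -
  have "z dvd (SOME w. z dvd w \<and> w dvd z) \<and> (SOME w. z dvd w \<and> w dvd z) dvd z"
    by (rule someI[of _ z]) auto
  then show "z dvd eis_rep z" "eis_rep z dvd z" by (auto simp: eis_rep_def)
qed

text \<open>Associates have the same multiples and divisors, so \<open>SOME\<close> is applied to
  one and the same predicate.\<close>

lemma eis_rep_mult_unit: "u dvd 1 \<Longrightarrow> eis_rep (u * z) = eis_rep z"
proof -
  assume u: "u dvd 1"
  then have "u * z dvd w \<longleftrightarrow> z dvd w" "w dvd u * z \<longleftrightarrow> w dvd z" for w
    by (simp_all add: mult_unit_dvd_iff' dvd_mult_unit_iff')
  then show ?thesis using u by (auto simp: eis_rep_def)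
qed

instantiation eis :: normalization_euclidean_semiring
begin

definition normalize_eis :: "eis \<Rightarrow> eis" where "normalize_eis = eis_rep"

definition unit_factor_eis :: "eis \<Rightarrow> eis" where "unit_factor_eis z = z div eis_rep z"

instance
proof
  fix z w :: eis
  show "unit_factor (0 :: eis) = 0" by (simp add: unit_factor_eis_def)
  show "unit_factor z = z" if "z dvd 1"
    using that by (auto simp: unit_factor_eis_def eis_rep_def)
  show "unit_factor z dvd 1" if "z \<noteq> 0"
  proof -
    obtain k where k: "eis_rep z = z * k" using eis_rep_dvd(1)[of z] by blast
    have "z * 1 = (z div eis_rep z) * eis_rep z" using eis_rep_dvd(2)[of z] by simp
    also have "\<dots> = z * ((z div eis_rep z) * k)" by (subst (2) k) (simp only: mult_ac)
    finally have "1 = (z div eis_rep z) * k" using that mult_left_cancel by blast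
    then show ?thesis unfolding unit_factor_eis_def by (rule dvdI)
  qed
  show "unit_factor (z * w) = z * unit_factor w" if "z dvd 1"
    using that eis_rep_dvd[of w] by (simp add: unit_factor_eis_def eis_rep_mult_unit div_mult_swap)
  show "unit_factor z * normalize z = z"
    using eis_rep_dvd[of z] by (simp add: unit_factor_eis_def normalize_eis_def)
  show "normalize (0 :: eis) = 0" by (simp add: normalize_eis_def eis_rep_def)
qed

end

section \<open>Norms of Eisenstein integers and sums over the lattice\<close>

definition enorm :: "eis \<Rightarrow> nat" where "enorm z = nat (eisnorm z)"

lemma int_enorm [simp]: "int (enorm z) = eisnorm z" by (simp add: enorm_def)

lemma enorm_mult: "enorm (z * w) = enorm z * enorm w"
  by (simp add: enorm_def eisnorm_mult nat_mult_distrib)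

lemma enorm_eq_0_iff: "enorm z = 0 \<longleftrightarrow> z = 0"
  using eisnorm_nonneg[of z] eisnorm_eq_0_iff[of z] unfolding enorm_def by linarith

lemma enorm_eq_1_iff: "enorm z = 1 \<longleftrightarrow> z dvd 1"
proof
  assume "enorm z = 1"
  then have "eisnorm z = 1" by (simp add: enorm_def)
  then show "z dvd 1" using mult_eiscnj[of z] by (metis dvd_triv_left of_int_1)
next
  assume "z dvd 1"
  then obtain w where "1 = z * w" by blast
  then have "enorm z * enorm w = 1" by (metis enorm_mult enorm_def eisnorm_1 nat_1 One_nat_def)
  then show "enorm z = 1" by simp
qed

lemma enorm_cnj [simp]: "enorm (eiscnj z) = enorm z" by (simp add: enorm_def)

lemma int_powr_summable:
  assumes "\<kappa> > 1" shows "(\<lambda>a::int. (1 + real_of_int \<bar>a\<bar>) powr (-\<kappa>)) summable_on UNIV"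
proof -
  let ?f = "\<lambda>a::int. (1 + real_of_int \<bar>a\<bar>) powr (-\<kappa>)"
  have "summable (\<lambda>n. real (n + 1) powr (-\<kappa>))"
    using assms summable_real_powr_iff[of "-\<kappa>"] summable_iff_shift[of "\<lambda>u. real u powr (-\<kappa>)" 1] by auto
  then have nat: "(\<lambda>n::nat. (1 + real n) powr (-\<kappa>)) summable_on UNIV"
    by (subst summable_on_UNIV_nonneg_real_iff) (auto simp: add.commute)
  have "?f summable_on range int"
    by (subst summable_on_reindex) (use nat in \<open>auto simp: o_def\<close>)
  moreover have "?f summable_on range (\<lambda>n. - int n)"
    by (subst summable_on_reindex) (use nat in \<open>auto simp: o_def inj_on_def\<close>)
  ultimately have "?f summable_on (range int \<union> range (\<lambda>n. - int n))"
    by (rule summable_on_union)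
  also have "range int \<union> range (\<lambda>n. - int n) = UNIV"
    by (auto simp: image_iff) (metis int_cases2)
  finally show ?thesis .
qed

lemma int2_powr_summable:
  assumes "\<kappa> > 1"
  shows "(\<lambda>(a::int, b::int). ((1 + real_of_int \<bar>a\<bar>) * (1 + real_of_int \<bar>b\<bar>)) powr (-\<kappa>)) summable_on UNIV"
proof -
  let ?f = "\<lambda>a::int. (1 + real_of_int \<bar>a\<bar>) powr (-\<kappa>)"
  have "(\<lambda>(a, b). ?f a * ?f b) summable_on (SIGMA a:UNIV. UNIV)"
  proof (rule summable_on_SigmaI)
    fix a :: int
    have "((\<lambda>b. ?f a * ?f b) has_sum (?f a * infsum ?f UNIV)) UNIV"
      by (intro has_sum_cmult_right has_sum_infsum int_powr_summable assms)
    then show "((\<lambda>b. case (a, b) of (a, b) \<Rightarrow> ?f a * ?f b) has_sum (?f a * infsum ?f UNIV)) UNIV" by simp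
  next
    show "(\<lambda>a. ?f a * infsum ?f UNIV) summable_on UNIV"
      by (intro summable_on_cmult_left int_powr_summable assms)
  qed auto
  then show ?thesis by (simp add: powr_mult)
qed

lemma int_abs_le_square: "\<bar>a\<bar> \<le> (a::int)^2"
  using self_le_power[of "\<bar>a\<bar>" 2] by (cases "a = 0") auto

text \<open>Both follow from |re z|^2 + |om z|^2 <= 2 N(z) and N(z) >= 1. The product form reduces
  sums over the lattice to one-dimensional ones; the square form compares the norm with the weight
  of a block.\<close>

lemma enorm_lower_bound:
  assumes "z \<noteq> 0"
  shows "(1 + \<bar>re z\<bar>) * (1 + \<bar>om z\<bar>) \<le> 6 * eisnorm z" "(1 + \<bar>re z\<bar> + \<bar>om z\<bar>)^2 \<le> 9 * eisnorm z"
proof -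
  define a b where "a = \<bar>re z\<bar>" and "b = \<bar>om z\<bar>"
  have n1: "1 \<le> eisnorm z" using eisnorm_ge_1[OF assms] .
  have sq: "2 * x * y \<le> x^2 + y^2" for x y :: int
    using zero_le_power2[of "x - y"] by (simp add: power2_diff)
  have "a^2 + b^2 \<le> 2 * eisnorm z" unfolding two_eisnorm by (simp add: a_def b_def)
  moreover have "a \<le> a^2" "b \<le> b^2" using int_abs_le_square[of "re z"] int_abs_le_square[of "om z"] by (auto simp: a_def b_def)
  moreover have "(1 + a) * (1 + b) = 1 + a + b + a * b" "(1 + a + b)^2 = 1 + 2 * a + 2 * b + 2 * a * b + a^2 + b^2"
    by (simp_all add: power2_eq_square algebra_simps)
  moreover have "2 * a * b \<le> a^2 + b^2" by (rule sq)
  moreover have "2 * a * b = 2 * (a * b)" "a^2 \<ge> 0" "b^2 \<ge> 0" by simp_all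
  moreover have "2 * a \<le> 1 + a^2" "2 * b \<le> 1 + b^2"
    using sq[of a 1] sq[of b 1] by simp_all
  ultimately have "(1 + a) * (1 + b) \<le> 6 * eisnorm z" "(1 + a + b)^2 \<le> 9 * eisnorm z" using n1 by linarith+
  then show "(1 + \<bar>re z\<bar>) * (1 + \<bar>om z\<bar>) \<le> 6 * eisnorm z" "(1 + \<bar>re z\<bar> + \<bar>om z\<bar>)^2 \<le> 9 * eisnorm z"
    by (simp_all add: a_def b_def)
qed

lemma bij_Eis: "bij_betw (\<lambda>(a, b). Eis a b) UNIV UNIV"
  by (rule bij_betwI[where g = "\<lambda>z. (re z, om z)"]) auto

lemma enorm_summable:
  assumes "\<kappa> > 1" shows "(\<lambda>z. real (enorm z) powr (-\<kappa>)) summable_on UNIV"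
proof (subst summable_on_reindex_bij_betw[OF bij_Eis, symmetric], rule summable_on_comparison_test)
  show "(\<lambda>x. 6 powr \<kappa> * (case x of (a, b) \<Rightarrow> ((1 + real_of_int \<bar>a\<bar>) * (1 + real_of_int \<bar>b\<bar>)) powr (-\<kappa>))) summable_on UNIV"
    by (intro summable_on_cmult_right int2_powr_summable assms)
  fix x :: "int \<times> int"
  obtain a b where x: "x = (a, b)" by fastforce
  show "real (enorm (case x of (a, b) \<Rightarrow> Eis a b)) powr (-\<kappa>)
      \<le> 6 powr \<kappa> * (case x of (a, b) \<Rightarrow> ((1 + real_of_int \<bar>a\<bar>) * (1 + real_of_int \<bar>b\<bar>)) powr (-\<kappa>))"
  proof (cases "Eis a b = 0")
    case False
    have "real_of_int ((1 + \<bar>a\<bar>) * (1 + \<bar>b\<bar>)) \<le> real_of_int (6 * eisnorm (Eis a b))"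
      using enorm_lower_bound(1)[OF False] by (simp only: of_int_le_iff eis.sel)
    then have le: "(1 + real_of_int \<bar>a\<bar>) * (1 + real_of_int \<bar>b\<bar>) \<le> 6 * real (enorm (Eis a b))"
      by (simp add: enorm_def)
    have "(6 * real (enorm (Eis a b))) powr (-\<kappa>) \<le> ((1 + real_of_int \<bar>a\<bar>) * (1 + real_of_int \<bar>b\<bar>)) powr (-\<kappa>)"
      using assms le by (intro powr_mono2') (auto intro!: mult_pos_pos add_pos_nonneg)
    then have "6 powr \<kappa> * (6 powr (-\<kappa>) * real (enorm (Eis a b)) powr (-\<kappa>)) \<le> 6 powr \<kappa> * ((1 + real_of_int \<bar>a\<bar>) * (1 + real_of_int \<bar>b\<bar>)) powr (-\<kappa>)"
      by (simp add: powr_mult)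
    moreover have "6 powr \<kappa> * (6 powr (-\<kappa>) * y) = y" for y :: real
      by (simp add: mult.assoc[symmetric] powr_add[symmetric])
    ultimately show ?thesis by (simp add: x)
  qed (auto simp: x enorm_def)
qed auto

section \<open>A quadratic character of the Eisenstein integers\<close>

definition chi3 :: "int \<Rightarrow> int" where
  "chi3 x = (if x mod 3 = 1 then 1 else if x mod 3 = 2 then -1 else 0)"

definition chi4 :: "int \<Rightarrow> int" where
  "chi4 x = (if x mod 4 = 1 then 1 else if x mod 4 = 3 then -1 else 0)"

text \<open>The character modulo $4$ of the ring that is trivial on $\omega$ and restricts to \<open>chi4\<close> on the odd integers:
  exactly one of the associates $z$, $\omega z$, $\omega^2 z$ of an odd $z$ is congruent to $1$ modulo $2$.\<close>

definition rho4 :: "int \<Rightarrow> int \<Rightarrow> int" where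
  "rho4 x y = (if odd x \<and> even y then chi4 x else if even x \<and> odd y then chi4 (y - x)
     else if odd x \<and> odd y then chi4 (- y) else 0)"

text \<open>Reduction modulo the prime sqrt(-3) maps \<omega> to 1 and so z to re z + om z modulo 3.
  Either factor takes the value -1 at the unit -1; in the product the signs cancel, and all units
  get the value 1.\<close>

definition eta :: "eis \<Rightarrow> int" where
  "eta z = chi3 (re z + om z) * rho4 (re z) (om z)"

lemma int_mod_4_cases: "x mod 4 = 0 \<or> x mod 4 = 1 \<or> x mod 4 = 2 \<or> x mod 4 = (3::int)"
  by presburger

lemma chi3_mod: "chi3 (x mod 3) = chi3 x" by (simp add: chi3_def)

lemma chi3_cong: "[x = y] (mod 3) \<Longrightarrow> chi3 x = chi3 y"
  unfolding Cong.cong_def chi3_def by (simp only:)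

lemma chi3_mult: "chi3 (x * y) = chi3 x * chi3 y"
proof -
  have fin: "\<forall>a\<in>{0,1,2}. \<forall>b\<in>{0,1,2}. chi3 (a * b) = chi3 a * chi3 b"
    by (simp add: chi3_def)
  have mem: "x mod 3 \<in> {0,1,2}" for x :: int
  proof -
    have "x mod 3 = 0 \<or> x mod 3 = 1 \<or> x mod 3 = 2" by presburger
    then show ?thesis by simp
  qed
  have "chi3 (x * y) = chi3 ((x mod 3) * (y mod 3))"
    by (rule chi3_cong) (simp only: Cong.cong_def mod_mult_eq)
  also have "\<dots> = chi3 (x mod 3) * chi3 (y mod 3)" by (intro fin[rule_format] mem)
  finally show ?thesis by (simp only: chi3_mod)
qed

lemma rho4_cong:
  assumes "x mod 4 = x' mod 4" "y mod 4 = y' mod 4"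
  shows "rho4 x y = rho4 x' y'"
proof -
  have "even x \<longleftrightarrow> even x'" "even y \<longleftrightarrow> even y'" using assms by presburger+
  moreover have "(y - x) mod 4 = (y' - x') mod 4" by (rule mod_diff_cong[OF assms(2,1)])
  moreover have "(- y) mod 4 = (- y') mod 4" by (rule mod_minus_cong[OF assms(2)])
  ultimately show ?thesis unfolding rho4_def chi4_def using assms by (simp only:)
qed

text \<open>The arguments on the left are the coordinates of a product of two Eisenstein integers.
  Everything depends on residues modulo 4, which leaves 256 cases to be evaluated.\<close>

lemma rho4_mult: "rho4 (a * c - b * d) (a * d + b * c - b * d) = rho4 a b * rho4 c d"
proof -
  have fin: "\<forall>a\<in>{0,1,2,3}. \<forall>b\<in>{0,1,2,3}. \<forall>c\<in>{0,1,2,3}. \<forall>d\<in>{0,1,2,3}.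
     rho4 (a * c - b * d) (a * d + b * c - b * d) = rho4 a b * rho4 c d"
    by (simp add: rho4_def chi4_def chi3_def)
  have mem: "x mod 4 \<in> {0,1,2,3}" for x :: int using int_mod_4_cases[of x] by auto
  have "rho4 (a * c - b * d) (a * d + b * c - b * d)
      = rho4 ((a mod 4) * (c mod 4) - (b mod 4) * (d mod 4))
             ((a mod 4) * (d mod 4) + (b mod 4) * (c mod 4) - (b mod 4) * (d mod 4))"
    by (rule rho4_cong; intro mod_diff_cong mod_add_cong; simp only: mod_mult_eq)
  also have "\<dots> = rho4 (a mod 4) (b mod 4) * rho4 (c mod 4) (d mod 4)"
    by (intro fin[rule_format] mem)
  also have "\<dots> = rho4 a b * rho4 c d"
  proof -
    have "rho4 (x mod 4) (y mod 4) = rho4 x y" for x y by (rule rho4_cong) auto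
    then show ?thesis by (simp only:)
  qed
  finally show ?thesis .
qed

lemma eta_mult: "eta (z * w) = eta z * eta w"
proof -
  have "re (z * w) + om (z * w) = (re z + om z) * (re w + om w) - 3 * (om z * om w)"
    by (simp add: algebra_simps)
  then have "chi3 (re (z * w) + om (z * w)) = chi3 ((re z + om z) * (re w + om w))"
    by (simp only:) (rule chi3_cong, simp add: cong_iff_dvd_diff)
  then show ?thesis by (simp add: eta_def chi3_mult rho4_mult)
qed

lemma eisnorm_mod_3: "[eisnorm z = (re z + om z) ^ 2] (mod 3)"
proof -
  have "eisnorm z = (re z + om z) ^ 2 - 3 * (re z * om z)"
    by (simp add: eisnorm_def power2_eq_square algebra_simps)
  then show ?thesis by (simp add: cong_iff_dvd_diff)
qed

text \<open>The arguments on the left are the coordinates of the conjugate of z; the identity is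
  checked on residues modulo 4.\<close>

lemma chi4_eisnorm: "rho4 (re z - om z) (- om z) = chi4 (eisnorm z) * rho4 (re z) (om z)"
proof -
  have fin: "\<forall>a\<in>{0,1,2,3}. \<forall>b\<in>{0,1,2,3}. rho4 (a - b) (- b) = chi4 (a * a - a * b + b * b) * rho4 a b"
    by (simp add: rho4_def chi4_def chi3_def)
  define a b where "a = re z" and "b = om z"
  have mem: "x mod 4 \<in> {0,1,2,3}" for x :: int using int_mod_4_cases[of x] by auto
  have "rho4 (a - b) (- b) = rho4 (a mod 4 - b mod 4) (- (b mod 4))"
    by (rule rho4_cong; simp only: mod_simps)
  also have "\<dots> = chi4 ((a mod 4) * (a mod 4) - (a mod 4) * (b mod 4) + (b mod 4) * (b mod 4)) * rho4 (a mod 4) (b mod 4)"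
    by (intro fin[rule_format] mem)
  also have "chi4 ((a mod 4) * (a mod 4) - (a mod 4) * (b mod 4) + (b mod 4) * (b mod 4)) = chi4 (eisnorm z)"
  proof -
    have "((a mod 4) * (a mod 4) - (a mod 4) * (b mod 4) + (b mod 4) * (b mod 4)) mod 4 = (a * a - a * b + b * b) mod 4"
      by (intro mod_add_cong mod_diff_cong; simp only: mod_mult_eq)
    then show ?thesis
      unfolding chi4_def eisnorm_def a_def[symmetric] b_def[symmetric] power2_eq_square by (simp only:)
  qed
  also have "rho4 (a mod 4) (b mod 4) = rho4 a b" by (rule rho4_cong) auto
  finally show ?thesis by (simp add: a_def b_def)
qed

text \<open>Three things hang on this sign: the two primes above p cancel for p = 3 (mod 4), they
  agree for p = 1 (mod 4), and the twists of \<open>eta\<close> by characters of the norm sum to 0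
  over the residues.\<close>

lemma eta_cnj: "eta (eiscnj z) = chi4 (eisnorm z) * eta z"
proof -
  have "chi3 (re (eiscnj z) + om (eiscnj z)) = chi3 (re z + om z)"
    by (rule chi3_cong) (simp add: cong_iff_dvd_diff)
  then show ?thesis using chi4_eisnorm[of z] by (simp add: eta_def)
qed

text \<open>A unit has norm 1, so its coordinates are -1, 0 or 1; the six units that remain are
  evaluated one by one.\<close>

lemma eta_unit:
  assumes "z dvd 1" shows "eta z = 1"
proof -
  have "enorm z = 1" using assms enorm_eq_1_iff by blast
  then have n: "eisnorm z = 1" by (metis int_enorm of_nat_1)
  have sq: "re z ^ 2 + om z ^ 2 + (re z - om z) ^ 2 = 2" using two_eisnorm[of z] n by simp
  then have sq2: "re z ^ 2 \<le> 2" "om z ^ 2 \<le> 2"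
    using zero_le_power2[of "re z"] zero_le_power2[of "om z"] zero_le_power2[of "re z - om z"] by linarith+
  have lt2: "\<bar>x\<bar> < 2" if "x ^ 2 \<le> 2" for x :: int
  proof (rule ccontr)
    assume "\<not> \<bar>x\<bar> < 2"
    then have "2 ^ 2 \<le> \<bar>x\<bar> ^ 2" by (intro power_mono) auto
    then show False using that by simp
  qed
  have "re z \<in> {-1, 0, 1}" "om z \<in> {-1, 0, 1}" using lt2[OF sq2(1)] lt2[OF sq2(2)] by auto
  then have "(re z, om z) \<in> {(-1, 0), (1, 0), (0, 1), (0, -1), (1, 1), (-1, -1)}" using sq by auto
  moreover have "\<forall>(a, b)\<in>{(-1, 0), (1, 0), (0, 1), (0, -1), (1, 1), (-1, -1)}. chi3 (a + b) * rho4 a b = 1"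
    by (simp add: rho4_def chi4_def chi3_def)
  ultimately have "case (re z, om z) of (a, b) \<Rightarrow> chi3 (a + b) * rho4 a b = 1" by (rule bspec[rotated])
  then show ?thesis by (simp add: eta_def)
qed

lemma abs_eta_le: "\<bar>eta z\<bar> \<le> 1"
proof -
  have "\<bar>chi3 x\<bar> \<le> 1" for x by (simp add: chi3_def)
  moreover have "\<bar>chi4 x\<bar> \<le> 1" for x by (simp add: chi4_def)
  then have "\<bar>rho4 x y\<bar> \<le> 1" for x y unfolding rho4_def by (simp split: if_splits)
  ultimately show ?thesis unfolding eta_def abs_mult by (intro mult_le_one) auto
qed

lemma eta_pm1:
  assumes "coprime (enorm z) 6"
  shows "eta z = 1 \<or> eta z = -1"
proof -
  have c: "coprime (eisnorm z) 6"
    using assms by (metis coprime_int_iff int_enorm of_nat_numeral)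
  have "\<not> 3 dvd re z + om z"
  proof
    assume "3 dvd re z + om z"
    then have "3 dvd (re z + om z) ^ 2" by (simp add: power2_eq_square)
    then have "3 dvd eisnorm z" by (simp only: cong_dvd_iff[OF eisnorm_mod_3])
    then have "is_unit (3::int)" by (rule coprime_common_divisor[OF c]) simp
    then show False by simp
  qed
  then have 1: "chi3 (re z + om z) = 1 \<or> chi3 (re z + om z) = -1"
  proof -
    have "(re z + om z) mod 3 = 1 \<or> (re z + om z) mod 3 = 2" using \<open>\<not> 3 dvd re z + om z\<close> by presburger
    then show ?thesis by (auto simp: chi3_def)
  qed
  have "odd (eisnorm z)"
  proof
    assume "even (eisnorm z)"
    then have "is_unit (2::int)" by (rule coprime_common_divisor[OF c]) simp
    then show False by simp
  qed
  then have "odd (re z) \<or> odd (om z)" by (auto simp: eisnorm_def)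
  moreover have o: "chi4 x = 1 \<or> chi4 x = -1" if "odd x" for x
  proof -
    have "x mod 4 = 1 \<or> x mod 4 = 3" using that by presburger
    then show ?thesis by (auto simp: chi4_def)
  qed
  ultimately have "rho4 (re z) (om z) = 1 \<or> rho4 (re z) (om z) = -1"
    using o[of "re z"] o[of "om z - re z"] o[of "- om z"] unfolding rho4_def by auto
  then show ?thesis using 1 by (auto simp: eta_def)
qed

lemma eta_cong:
  assumes "[re z = re w] (mod 12)" "[om z = om w] (mod 12)"
  shows "eta z = eta w"
proof -
  have c: "[re z = re w] (mod 4)" "[om z = om w] (mod 4)" "[re z = re w] (mod 3)" "[om z = om w] (mod 3)"
    by (rule cong_dvd_modulus[OF assms(1)] cong_dvd_modulus[OF assms(2)]; simp)+
  have "chi3 (re z + om z) = chi3 (re w + om w)" by (rule chi3_cong[OF cong_add[OF c(3,4)]])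
  moreover have "rho4 (re z) (om z) = rho4 (re w) (om w)"
    by (rule rho4_cong) (use c(1,2) in \<open>simp_all only: Cong.cong_def\<close>)
  ultimately show ?thesis by (simp only: eta_def)
qed

section \<open>Eisenstein primes above a rational prime\<close>

lemma prime_elem_if_prime_enorm:
  assumes "prime (enorm z)" shows "prime_elem z"
proof (rule irreducible_imp_prime_elem, rule irreducibleI)
  show "z \<noteq> 0" using assms enorm_eq_0_iff[of z] by auto
  show "\<not> z dvd 1" using assms enorm_eq_1_iff[of z] by auto
  fix a b assume "z = a * b"
  then have "enorm a * enorm b = enorm z" by (simp add: enorm_mult)
  then have "enorm a = 1 \<or> enorm b = 1" using assms by (metis prime_product)
  then show "a dvd 1 \<or> b dvd 1" by (simp only: enorm_eq_1_iff)
qed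

lemma enorm_normalize: "enorm (normalize z) = enorm z"
proof (cases "z = 0")
  case False
  have "enorm z = enorm (unit_factor z) * enorm (normalize z)" by (metis enorm_mult unit_factor_mult_normalize)
  moreover have "enorm (unit_factor z) = 1" using False by (simp only: enorm_eq_1_iff) auto
  ultimately show ?thesis by simp
qed auto

lemma eta_normalize: "eta (normalize z) = eta z"
proof (cases "z = 0")
  case False
  have "eta z = eta (unit_factor z) * eta (normalize z)" by (metis eta_mult unit_factor_mult_normalize)
  then show ?thesis using False eta_unit[of "unit_factor z"] by auto
qed auto

lemma cnj_unit: "u dvd 1 \<Longrightarrow> eiscnj u dvd 1"
  using enorm_eq_1_iff[of u] enorm_eq_1_iff[of "eiscnj u"] by simp

lemma normalize_cnj_normalize: "normalize (eiscnj (normalize z)) = normalize (eiscnj z)"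
proof (cases "z = 0")
  case False
  have "eiscnj z = eiscnj (unit_factor z) * eiscnj (normalize z)" by (metis eiscnj_mult unit_factor_mult_normalize)
  then show ?thesis using False cnj_unit[of "unit_factor z"] by (simp add: normalize_mult_unit_left)
qed auto

text \<open>Primes of degree one only: a rational prime q that stays prime has norm q^2 and is
  treated separately.\<close>

definition primes_above :: "nat \<Rightarrow> eis set" where
  "primes_above p = {z. prime z \<and> enorm z = p}"

lemma dvd_of_nat_enorm: "z dvd of_nat (enorm z)"
  by (metis dvd_triv_left int_enorm mult_eiscnj of_int_of_nat_eq)

lemma finite_primes_above:
  assumes "p > 0" shows "finite (primes_above p)"
proof (rule finite_subset)
  have "(of_nat p :: eis) \<noteq> 0" using assms by (simp add: eis_eq_iff)
  then show "primes_above p \<subseteq> prime_factors (of_nat p :: eis)"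
    using dvd_of_nat_enorm by (auto simp: primes_above_def prime_factors_dvd)
qed auto

lemma cnj_primes_above:
  assumes "prime p" "z \<in> primes_above p"
  shows "normalize (eiscnj z) \<in> primes_above p"
  using assms prime_elem_if_prime_enorm[of "eiscnj z"] by (simp add: primes_above_def enorm_normalize)

text \<open>The p-th coefficient of the L-function of \<open>eta\<close>, each ideal counted
  once.\<close>

definition trace_eta :: "nat \<Rightarrow> int" where
  "trace_eta p = (\<Sum>z\<in>primes_above p. eta z)"

text \<open>Conjugation permutes the primes above p, up to normalization, and changes the sign of
  \<open>eta\<close>, as the norm p is 3 modulo 4.\<close>

lemma trace_eta_3_mod_4:
  assumes p: "prime p" "p mod 4 = 3" shows "trace_eta p = 0"
proof -
  have ch: "chi4 (eisnorm z) = -1" if "z \<in> primes_above p" for z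
  proof -
    have "eisnorm z = int p" using that by (metis (mono_tags) int_enorm mem_Collect_eq primes_above_def)
    moreover have "int p mod 4 = 3" using p by (metis of_nat_mod of_nat_numeral)
    ultimately show ?thesis by (simp add: chi4_def)
  qed
  have inv: "normalize (eiscnj (normalize (eiscnj z))) = z" if "z \<in> primes_above p" for z
    using that by (simp add: normalize_cnj_normalize primes_above_def normalize_prime)
  have "(\<Sum>z\<in>primes_above p. eta z) = (\<Sum>z\<in>primes_above p. eta (normalize (eiscnj z)))"
    by (rule sum.reindex_bij_witness[where i = "\<lambda>z. normalize (eiscnj z)" and j = "\<lambda>z. normalize (eiscnj z)"])
       (use inv cnj_primes_above[OF p(1)] in auto)
  also have "\<dots> = (\<Sum>z\<in>primes_above p. - eta z)"
    by (intro sum.cong refl) (simp add: eta_normalize eta_cnj ch)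
  finally show ?thesis by (simp add: trace_eta_def sum_negf)
qed

text \<open>Norms are squares modulo 3, so p is not a norm at all and the sum is empty.\<close>

lemma trace_eta_2_mod_3:
  assumes "p mod 3 = 2" shows "trace_eta p = 0"
proof -
  have "primes_above p = {}"
  proof (rule ccontr)
    assume "primes_above p \<noteq> {}"
    then obtain z where "enorm z = p" by (auto simp: primes_above_def)
    then have "int p mod 3 = ((re z + om z)^2) mod 3" using eisnorm_mod_3[of z] by (metis Cong.cong_def int_enorm)
    moreover have "int p mod 3 = 2" using assms by (metis of_nat_mod of_nat_numeral)
    moreover have "(x ^ 2) mod 3 \<noteq> 2" for x :: int
    proof -
      have "x mod 3 = 0 \<or> x mod 3 = 1 \<or> x mod 3 = 2" by presburger
      moreover have "(x ^ 2) mod 3 = ((x mod 3) ^ 2) mod 3" by (simp add: power_mod)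
      ultimately show ?thesis by auto
    qed
    ultimately show False by simp
  qed
  then show ?thesis by (simp add: trace_eta_def)
qed

text \<open>A primitive root raised to the power (p-1)/3 is a cube root of unity other than
  1.\<close>

lemma cube_root_mod_prime:
  assumes p: "prime (p::nat)" "p mod 3 = 1"
  obtains x :: int where "int p dvd x^2 + x + 1"
proof -
  obtain g where g: "residue_primroot p g" using prime_primitive_root_exists[of p] p prime_gt_1_nat by blast
  define k where "k = (p - 1) div 3"
  have p1: "p > 1" using p prime_gt_1_nat by blast
  have k: "p - 1 = 3 * k"
  proof -
    have "3 dvd p - 1" using p p1 by (metis less_imp_le_nat mod_eq_dvd_iff_nat mod_less one_less_numeral_iff semiring_norm(77))
    then show ?thesis by (simp add: k_def)
  qed
  have k0: "0 < k" "k < p - 1" using k p1 by auto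
  have cop: "coprime g p" and ord: "ord p g = p - 1"
    using g p by (auto simp: residue_primroot_def totient_prime coprime_commute)
  have "[g ^ (3 * k) = 1] (mod p)" using ord_divides[of g "3 * k" p] ord k by simp
  moreover have "\<not> [g ^ k = 1] (mod p)" using ord_divides[of g k p] ord k0 by (auto dest: dvd_imp_le)
  ultimately have c: "[(int g ^ k) ^ 3 = 1] (mod int p)" "\<not> [int g ^ k = 1] (mod int p)"
    by (metis cong_int_iff of_nat_1 of_nat_power power_mult mult.commute)+
  define x where "x = int g ^ k"
  have "int p dvd x ^ 3 - 1" "\<not> int p dvd x - 1" using c by (auto simp: x_def cong_iff_dvd_diff)
  moreover have "x ^ 3 - 1 = (x - 1) * (x^2 + x + 1)" by (simp add: power2_eq_square power3_eq_cube algebra_simps)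
  ultimately have "int p dvd x^2 + x + 1"
    using p prime_dvd_mult_iff[of "int p" "x - 1" "x^2 + x + 1"] by simp
  then show ?thesis using that by blast
qed

text \<open>Since p divides x^2 + x + 1 = N(x - \<omega>) but neither of the conjugate factors, it
  is not prime in the ring; a proper factorization has two factors of norm p. Every prime of norm p
  divides p, the product of z and its conjugate, which yields the list.\<close>

lemma primes_above_1_mod_3:
  assumes p: "prime p" "p mod 3 = 1"
  obtains z where "z \<in> primes_above p" "primes_above p = {z, normalize (eiscnj z)}" "normalize (eiscnj z) \<noteq> z"
proof -
  obtain x where x: "int p dvd x^2 + x + 1" using cube_root_mod_prime[OF p] by blast
  let ?P = "of_nat p :: eis"
  have nP: "enorm ?P = p * p" by (simp add: enorm_def eisnorm_def power2_eq_square nat_mult_distrib)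
  have P0: "?P \<noteq> 0" using p prime_gt_0_nat[of p] by (simp add: eis_eq_iff)
  have p1: "p > 1" using p prime_gt_1_nat by blast
  have dvdP: "?P dvd y \<longleftrightarrow> int p dvd re y \<and> int p dvd om y" for y
  proof
    assume "?P dvd y"
    then obtain k where "y = ?P * k" by blast
    then show "int p dvd re y \<and> int p dvd om y" by simp
  next
    assume "int p dvd re y \<and> int p dvd om y"
    then obtain a b where "re y = int p * a" "om y = int p * b" by blast
    then have "y = ?P * Eis a b" by (simp add: eis_eq_iff)
    then show "?P dvd y" by simp
  qed
  have "\<not> prime_elem ?P"
  proof
    assume pe: "prime_elem ?P"
    define y where "y = Eis x (-1)"
    have ny: "eisnorm y = x^2 + x + 1" by (simp add: y_def eisnorm_def)
    have "?P dvd y * eiscnj y" unfolding mult_eiscnj dvdP eis_of_int ny using x by simp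
    then have "?P dvd y \<or> ?P dvd eiscnj y" by (simp only: prime_elem_dvd_mult_iff[OF pe])
    then have "int p dvd 1" unfolding dvdP by (auto simp: y_def)
    then show False using p1 by simp
  qed
  then have "\<not> irreducible ?P" using irreducible_imp_prime_elem by blast
  moreover have "\<not> ?P dvd 1" using nP p1 enorm_eq_1_iff[of ?P] by simp
  ultimately obtain a b where ab: "?P = a * b" "\<not> a dvd 1" "\<not> b dvd 1"
    using P0 by (auto simp: irreducible_def)
  have nab: "enorm a * enorm b = p ^ 2" using ab(1) nP by (metis enorm_mult power2_eq_square)
  have nab1: "enorm a \<noteq> 1" "enorm b \<noteq> 1" using ab enorm_eq_1_iff by auto
  obtain i where i: "i \<le> 2" "enorm a = p ^ i"
    using nab p divides_primepow_nat[of p "enorm a" 2] by (metis dvd_triv_left)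
  have "i \<noteq> 0" using i nab1 by (intro notI) simp
  moreover have "i \<noteq> 2" using i nab nab1 p1 by (intro notI) simp
  ultimately have na: "enorm a = p" using i by (simp add: le_Suc_eq numeral_2_eq_2)
  define z where "z = normalize a"
  have z: "z \<in> primes_above p"
    using na prime_elem_if_prime_enorm[of a] p by (simp add: z_def primes_above_def enorm_normalize)
  have zP: "z * eiscnj z = ?P"
    using z by (metis (mono_tags) int_enorm mem_Collect_eq mult_eiscnj of_int_of_nat_eq primes_above_def)
  have prz: "prime z" "prime (normalize (eiscnj z))"
    using z cnj_primes_above[OF p(1) z] by (auto simp: primes_above_def)
  have "w = z \<or> w = normalize (eiscnj z)" if w: "w \<in> primes_above p" for w
  proof -
    have prw: "prime w" "w dvd z * eiscnj z" using w dvd_of_nat_enorm[of w] zP by (auto simp: primes_above_def)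
    then have "w dvd z \<or> w dvd normalize (eiscnj z)" by (simp add: prime_dvd_mult_iff)
    then show ?thesis using prw prz primes_dvd_imp_eq by blast
  qed
  then have eq: "primes_above p = {z, normalize (eiscnj z)}" using z cnj_primes_above[OF p(1) z] by blast
  have "normalize (eiscnj z) \<noteq> z"
  proof
    assume "normalize (eiscnj z) = z"
    then have zd: "z dvd eiscnj z" by (metis dvd_normalize_iff dvd_refl)
    have nz: "eisnorm z = int p" using z by (metis (mono_tags) int_enorm mem_Collect_eq primes_above_def)
    have dv: "int p dvd eisnorm w" if "z dvd w" for w
      using that nz by (metis dvd_def eisnorm_mult)
    \<comment> \<open>If z were associated to its conjugate, it would divide their difference and
      sum, and p the norms 3 om^2 and (2 re - om)^2. As p is neither 2 nor 3, it divides both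
      coordinates, so p^2 divides N(z) = p.\<close>
    have "z dvd z - eiscnj z" "z dvd z + eiscnj z" using zd by simp_all
    then have "int p dvd eisnorm (z - eiscnj z)" "int p dvd eisnorm (z + eiscnj z)" using dv by blast+
    moreover have "eisnorm (z - eiscnj z) = 3 * (om z)^2" "eisnorm (z + eiscnj z) = (2 * re z - om z)^2"
      by (simp_all add: eisnorm_def power2_eq_square algebra_simps)
    moreover have pp: "prime (int p)" using p by simp
    moreover have "\<not> int p dvd 3"
    proof
      assume "int p dvd 3"
      then have "p dvd 3" by presburger
      then have "p = 3" using p by (simp add: primes_dvd_imp_eq)
      then show False using p by simp
    qed
    ultimately have "int p dvd om z" "int p dvd 2 * re z - om z"
      by (metis prime_dvd_mult_iff prime_dvd_power)+
    then have "int p dvd 2 * re z" "int p dvd om z" by (metis dvd_add diff_add_cancel)+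
    moreover have "\<not> int p dvd 2"
    proof
      assume "int p dvd 2"
      then have "p dvd 2" by presburger
      then have "p = 2" using p by (simp add: primes_dvd_imp_eq)
      then show False using p by simp
    qed
    ultimately have "int p dvd re z" "int p dvd om z" using pp by (metis prime_dvd_mult_iff)+
    then obtain a b where "re z = int p * a" "om z = int p * b" by blast
    then have "eisnorm z = int p * (int p * (a^2 - a * b + b^2))"
      by (simp add: eisnorm_def power2_eq_square algebra_simps)
    then have "int p * (a^2 - a * b + b^2) = 1" using nz p1 by simp
    then have "int p dvd 1" by (metis dvd_triv_left)
    then show False using p1 by simp
  qed
  then show ?thesis using that z eq by blast
qed

lemma trace_eta_1_mod_12:
  assumes p: "prime p" "p mod 12 = 1"
  obtains z where "enorm z = p" "trace_eta p = 2 * eta z" "eta z = 1 \<or> eta z = -1"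
proof -
  have p3: "p mod 3 = 1" "p mod 4 = 1" using p(2) by presburger+
  obtain z where z: "z \<in> primes_above p" "primes_above p = {z, normalize (eiscnj z)}" "normalize (eiscnj z) \<noteq> z"
    using primes_above_1_mod_3[OF p(1) p3(1)] by blast
  have nz: "enorm z = p" using z(1) by (simp add: primes_above_def)
  have "eisnorm z = int p" using nz by (metis int_enorm)
  moreover have "int p mod 4 = 1" using p3 by (metis of_nat_1 of_nat_mod of_nat_numeral)
  ultimately have "eta (normalize (eiscnj z)) = eta z" by (simp add: eta_normalize eta_cnj chi4_def)
  moreover have "trace_eta p = eta z + eta (normalize (eiscnj z))" unfolding trace_eta_def z(2) using z(3) by simp
  moreover have "coprime p 6"
  proof -
    have "odd p" "\<not> 3 dvd p" using p3 by presburger+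
    then have "coprime p 2" "coprime p 3" using prime_imp_coprime[of 3 p] by (auto simp: coprime_commute)
    then have "coprime p (2 * 3)" by (simp only: coprime_mult_right_iff)
    then show ?thesis by simp
  qed
  ultimately show ?thesis using that[of z] nz eta_pm1[of z] by simp
qed

lemma trace_eta_eq_0:
  assumes "prime p" "coprime p 12" "p mod 12 \<noteq> 1"
  shows "trace_eta p = 0"
proof -
  have "\<not> 2 dvd p" "\<not> 3 dvd p"
    using assms(2) coprime_common_divisor[of p 12 2] coprime_common_divisor[of p 12 3] by auto
  then have "p mod 3 = 2 \<or> p mod 4 = 3" using assms(3) by presburger
  then show ?thesis using assms(1) trace_eta_3_mod_4 trace_eta_2_mod_3 by blast
qed

section \<open>Its L-functions\<close>

interpretation eis_norm: normed_factorial enorm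
  by unfold_locales (simp_all only: enorm_mult enorm_eq_1_iff enorm_eq_0_iff enorm_summable)

definition theta :: "(nat \<Rightarrow> complex) \<Rightarrow> eis \<Rightarrow> complex" where
  "theta \<psi> z = of_int (eta z) * \<psi> (enorm z)"

lemma theta_character:
  assumes "\<psi> \<in> dchars M" "M > 0"
  shows "normed_character enorm (theta \<psi>)"
proof unfold_locales
  show "theta \<psi> (a * b) = theta \<psi> a * theta \<psi> b" for a b
    by (simp add: theta_def eta_mult enorm_mult dcharsD(2)[OF assms(1)])
  show "norm (theta \<psi> a) \<le> 1" for a
  proof -
    have "real_of_int \<bar>eta a\<bar> \<le> 1" using abs_eta_le[of a] by linarith
    moreover have "norm (\<psi> (enorm a)) \<le> 1" using norm_dchar[OF assms, of "enorm a"] by auto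
    ultimately show ?thesis unfolding theta_def norm_mult by (intro mult_le_one) auto
  qed
  show "theta \<psi> u = 1" if "is_unit u" for u
  proof -
    have "enorm u = 1" using that by (simp only: enorm_eq_1_iff)
    then show ?thesis unfolding theta_def eta_unit[OF that] using dcharsD(1)[OF assms(1)] by simp
  qed
qed

lemma theta_cong:
  assumes \<psi>: "\<psi> \<in> dchars M" and M: "12 dvd M"
    and "[re z = re w] (mod int M)" "[om z = om w] (mod int M)"
  shows "theta \<psi> z = theta \<psi> w"
proof -
  have "12 dvd int M" using M by presburger
  then have "eta z = eta w" using assms(3,4) by (intro eta_cong) (auto elim: cong_dvd_modulus)
  moreover have "[eisnorm z = eisnorm w] (mod int M)"
    unfolding eisnorm_def using assms(3,4) by (intro cong_add cong_diff cong_mult cong_pow)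
  then have "[enorm z = enorm w] (mod M)" by (metis cong_int_iff int_enorm)
  then have "\<psi> (enorm z) = \<psi> (enorm w)" by (metis Cong.cong_def dcharsD(3)[OF \<psi>])
  ultimately show ?thesis by (simp add: theta_def)
qed

text \<open>Multiplication by \<beta> of norm prime to M permutes the residues, so T =
  \<theta>(\<beta>) T. The same holds for the conjugate of \<beta>, and if N(\<beta>) = 3 (mod 4)
  the two values are opposite. Hence T = 0, whatever \<theta>(\<beta>) is.\<close>

lemma theta_residue_sum:
  assumes \<psi>: "\<psi> \<in> dchars M" and M: "12 dvd M" "M > 0"
  shows "(\<Sum>r\<in>{0..<int M} \<times> {0..<int M}. theta \<psi> (Eis (fst r) (snd r))) = 0"
proof -
  let ?R = "{0..<int M} \<times> {0..<int M}"
  let ?T = "\<Sum>r\<in>?R. theta \<psi> (Eis (fst r) (snd r))"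
  interpret normed_character enorm "theta \<psi>" by (rule theta_character[OF \<psi> M(2)])
  have inv: "?T = theta \<psi> \<beta> * ?T" if \<beta>: "coprime (eisnorm \<beta>) (int M)" for \<beta>
  proof -
    define g where "g = (\<lambda>r. (re (\<beta> * Eis (fst r) (snd r)) mod int M, om (\<beta> * Eis (fst r) (snd r)) mod int M))"
    \<comment> \<open>A difference that \<beta> sends to 0 modulo M is sent to 0 by N(\<beta>) as
      well, which is invertible modulo M.\<close>
    have inj: "inj_on g ?R"
    proof (rule inj_onI)
      fix r s assume r: "r \<in> ?R" "s \<in> ?R" "g r = g s"
      define d where "d = Eis (fst r) (snd r) - Eis (fst s) (snd s)"
      have "int M dvd re (\<beta> * d)" "int M dvd om (\<beta> * d)"
        using r(3) unfolding g_def d_def right_diff_distrib eis_sel(7,8) by (simp_all add: mod_eq_dvd_iff)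
      then have "int M dvd re (eiscnj \<beta> * (\<beta> * d))" "int M dvd om (eiscnj \<beta> * (\<beta> * d))"
        by (simp_all only: eis_sel(11,12) dvd_diff dvd_add dvd_mult)
      moreover have "eiscnj \<beta> * (\<beta> * d) = of_int (eisnorm \<beta>) * d"
        by (simp only: mult_eiscnj[symmetric] mult_ac)
      ultimately have "int M dvd eisnorm \<beta> * re d" "int M dvd eisnorm \<beta> * om d" by simp_all
      then have "int M dvd re d" "int M dvd om d"
        using \<beta> by (simp_all add: coprime_dvd_mult_right_iff coprime_commute)
      then have "[fst r = fst s] (mod int M)" "[snd r = snd s] (mod int M)"
        by (simp_all add: d_def cong_iff_dvd_diff)
      then show "r = s" using r(1,2) by (auto simp: Cong.cong_def prod_eq_iff)
    qed
    have "g ` ?R \<subseteq> ?R" using M(2) by (auto simp: g_def)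
    then have im: "g ` ?R = ?R" using inj by (intro endo_inj_surj) auto
    have "?T = (\<Sum>r\<in>?R. theta \<psi> (Eis (fst (g r)) (snd (g r))))"
      by (subst im[symmetric], subst sum.reindex[OF inj]) simp
    also have "\<dots> = (\<Sum>r\<in>?R. theta \<psi> (\<beta> * Eis (fst r) (snd r)))"
      by (intro sum.cong refl theta_cong[OF \<psi> M(1)]) (simp_all add: g_def Cong.cong_def)
    also have "\<dots> = theta \<psi> \<beta> * ?T" by (simp only: f_mult sum_distrib_left)
    finally show ?thesis .
  qed
  define m where "m = M div 2 ^ multiplicity 2 M"
  have m: "odd m" "M = 2 ^ multiplicity 2 M * m"
    using M(2) multiplicity_decompose[of M 2] by (auto simp: m_def multiplicity_dvd)
  \<comment> \<open>With m the odd part of M, the norm 1 - 2 m + 4 m^2 of 1 + 2 m \<omega> is odd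
    and prime to m, hence to M, and it is 3 modulo 4 because m is odd.\<close>
  define \<beta> where "\<beta> = Eis 1 (2 * int m)"
  have n\<beta>: "eisnorm \<beta> = 1 - 2 * int m + 4 * int m ^ 2" by (simp add: \<beta>_def eisnorm_def power2_eq_square)
  have "coprime (eisnorm \<beta>) (int m)"
  proof (rule coprimeI)
    fix q assume "q dvd eisnorm \<beta>" "q dvd int m"
    moreover have "1 = eisnorm \<beta> + (2 - 4 * int m) * int m" by (simp add: n\<beta> power2_eq_square algebra_simps)
    ultimately show "is_unit q" by (metis dvd_add dvd_mult)
  qed
  moreover have "odd (eisnorm \<beta>)" by (simp add: n\<beta>)
  then have "coprime (eisnorm \<beta>) (2 ^ multiplicity 2 M)" by (simp add: coprime_commute)
  ultimately have "coprime (eisnorm \<beta>) (2 ^ multiplicity 2 M * int m)" by (simp only: coprime_mult_right_iff)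
  also have "2 ^ multiplicity 2 M * int m = int M" using m(2) by (metis of_nat_mult of_nat_numeral of_nat_power)
  finally have cop: "coprime (eisnorm \<beta>) (int M)" .
  have "eisnorm \<beta> mod 4 = 3"
  proof -
    obtain l where "int m = 2 * l + 1" using m(1) by (metis even_of_nat oddE)
    then have "eisnorm \<beta> = 3 + 4 * (4 * l^2 + 3 * l)" unfolding n\<beta> by (simp add: power2_eq_square algebra_simps)
    then show ?thesis by (simp only: mod_mult_self2) simp
  qed
  then have neg: "theta \<psi> (eiscnj \<beta>) = - theta \<psi> \<beta>" by (simp add: theta_def eta_cnj chi4_def)
  define T where "T = ?T"
  have "T = theta \<psi> \<beta> * T" unfolding T_def by (rule inv[OF cop])
  moreover have "T = theta \<psi> (eiscnj \<beta>) * T" unfolding T_def by (rule inv) (simp only: eisnorm_cnj cop)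
  then have "T = - (theta \<psi> \<beta> * T)" unfolding neg by (simp only: mult_minus_left)
  moreover have "t = 0" if "t = y" "t = - y" for t y :: complex using that by simp
  ultimately have "T = 0" by blast
  then show ?thesis unfolding T_def .
qed

lemma residue_abs_bound:
  fixes M u r :: int assumes "M \<ge> 1" "0 \<le> r" "r < M"
  shows "\<bar>u\<bar> \<le> \<bar>M * u + r\<bar> + 1"
proof (cases "u \<ge> 0")
  case True
  have "1 * u \<le> M * u" using assms True by (intro mult_right_mono) auto
  then show ?thesis using True assms by linarith
next
  case False
  have "1 * (- u - 1) \<le> M * (- u - 1)" using assms False by (intro mult_right_mono) auto
  then have "- u - 1 \<le> - (M * u) - M" by (simp add: right_diff_distrib)
  then show ?thesis using False assms by linarith
qed

text \<open>The factor 81 is 3^2 from the passage between u and M u + r, times the 9 of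
  \<open>enorm_lower_bound\<close>.\<close>

lemma block_norm_lower:
  fixes M :: int assumes M: "M \<ge> 1" and r: "0 \<le> r1" "r1 < M" "0 \<le> r2" "r2 < M"
    and nz: "Eis (M * u1 + r1) (M * u2 + r2) \<noteq> 0"
  shows "(1 + \<bar>u1\<bar> + \<bar>u2\<bar>)^2 \<le> 81 * eisnorm (Eis (M * u1 + r1) (M * u2 + r2))"
proof -
  have "1 + \<bar>u1\<bar> + \<bar>u2\<bar> \<le> 3 * (1 + \<bar>M * u1 + r1\<bar> + \<bar>M * u2 + r2\<bar>)"
  proof -
    have lin: "1 + a + b \<le> 3 * (1 + A + B)" if "a \<le> A + 1" "b \<le> B + 1" "0 \<le> A" "0 \<le> B" for a b A B :: int
      using that by presburger
    show ?thesis
      by (rule lin[OF residue_abs_bound[OF M r(1,2)] residue_abs_bound[OF M r(3,4)] abs_ge_zero abs_ge_zero])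
  qed
  then have "(1 + \<bar>u1\<bar> + \<bar>u2\<bar>)^2 \<le> (3 * (1 + \<bar>M * u1 + r1\<bar> + \<bar>M * u2 + r2\<bar>))^2"
    by (intro power_mono) auto
  also have "\<dots> = 9 * (1 + \<bar>M * u1 + r1\<bar> + \<bar>M * u2 + r2\<bar>)^2" by (simp only: power_mult_distrib) simp
  also have "\<dots> \<le> 9 * (9 * eisnorm (Eis (M * u1 + r1) (M * u2 + r2)))"
    using enorm_lower_bound(2)[OF nz] by simp
  finally show ?thesis by simp
qed

text \<open>Up to N(r), the difference N(M u + r) - M^2 N(u) is bilinear in u and r, hence grows
  linearly in u. The added 1 keeps the comparison value positive at u = 0.\<close>

lemma block_norm_diff:
  fixes M :: int assumes M: "M \<ge> 1" and r: "0 \<le> r1" "r1 < M" "0 \<le> r2" "r2 < M"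
  shows "\<bar>eisnorm (Eis (M * u1 + r1) (M * u2 + r2)) - (M^2 * eisnorm (Eis u1 u2) + 1)\<bar>
           \<le> 3 * M^2 * (1 + \<bar>u1\<bar> + \<bar>u2\<bar>)"
proof -
  define T where "T = 2 * (u1 * r1) - u1 * r2 - u2 * r1 + 2 * (u2 * r2)"
  have b: "\<bar>u * r\<bar> \<le> \<bar>u\<bar> * M" if "0 \<le> r" "r < M" for u r
    using that by (auto simp: abs_mult intro!: mult_left_mono)
  have "\<bar>T\<bar> \<le> 3 * (\<bar>u1\<bar> * M) + 3 * (\<bar>u2\<bar> * M)"
    unfolding T_def using b[OF r(1,2), of u1] b[OF r(3,4), of u1] b[OF r(1,2), of u2] b[OF r(3,4), of u2] by linarith
  then have "\<bar>M * T\<bar> \<le> M * (3 * (\<bar>u1\<bar> * M) + 3 * (\<bar>u2\<bar> * M))"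
    using M by (simp add: abs_mult mult_left_mono)
  also have "\<dots> = 3 * M^2 * (\<bar>u1\<bar> + \<bar>u2\<bar>)" by (simp add: power2_eq_square algebra_simps)
  finally have 1: "\<bar>M * T\<bar> \<le> 3 * M^2 * (\<bar>u1\<bar> + \<bar>u2\<bar>)" .
  have M1: "1 \<le> M^2" using M by (simp add: one_le_power)
  have "r1^2 \<le> M^2" "r2^2 \<le> M^2" using r by (auto intro!: power_mono)
  moreover have "0 \<le> r1 * r2" using r by simp
  moreover have n0: "0 \<le> eisnorm (Eis r1 r2)" by simp
  ultimately have 2: "\<bar>eisnorm (Eis r1 r2) - 1\<bar> \<le> 3 * M^2" using M1 unfolding eisnorm_def eis.sel by linarith
  have "eisnorm (Eis (M * u1 + r1) (M * u2 + r2)) - (M^2 * eisnorm (Eis u1 u2) + 1) = M * T + (eisnorm (Eis r1 r2) - 1)"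
    by (simp add: eisnorm_def T_def power2_eq_square algebra_simps)
  also have "\<bar>\<dots>\<bar> \<le> 3 * M^2 * (\<bar>u1\<bar> + \<bar>u2\<bar>) + 3 * M^2" using 1 2 by linarith
  also have "\<dots> = 3 * M^2 * (1 + \<bar>u1\<bar> + \<bar>u2\<bar>)" by (simp add: algebra_simps)
  finally show ?thesis .
qed

text \<open>The blocks are the cells M u + r of the lattice. With W = (1 + |u1| + |u2|)^2 the norms
  in a block are of order W and vary by a multiple of W^(1/2); this two-dimensional case is what
  fixes the exponent 1/2 in \<open>block_series_holomorphic\<close>.\<close>

lemma theta_residue:
  assumes \<psi>: "\<psi> \<in> dchars M" and M: "12 dvd M" "M > 0"
  obtains k :: nat where
    "((\<lambda>x. of_real (x - 1) * prime_log_sum enorm (theta \<psi>) x) \<longlongrightarrow> - of_nat k) (at_right 1)"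
proof -
  interpret th: normed_character enorm "theta \<psi>" by (rule theta_character[OF \<psi> M(2)])
  let ?R = "{0..<int M} \<times> {0..<int M}"
  define c where "c = (\<lambda>r. theta \<psi> (Eis (fst r) (snd r)))"
  define e where "e = (\<lambda>u r. Eis (int M * fst u + fst r) (int M * snd u + snd r))"
  define X where "X = (\<lambda>u r. real (enorm (e u r)))"
  define X0 where "X0 = (\<lambda>u. real_of_int ((int M)^2 * eisnorm (Eis (fst u) (snd u)) + 1))"
  define W where "W = (\<lambda>u :: int \<times> int. real_of_int ((1 + \<bar>fst u\<bar> + \<bar>snd u\<bar>)^2))"
  define L where "L = (\<lambda>s. \<Sum>\<^sub>\<infinity>u. \<Sum>r\<in>?R. c r * of_real (X u r) powr (-s))"
  have M1: "int M \<ge> 1" using M(2) by simp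
  have ce: "theta \<psi> (e u r) = c r" for u r
    unfolding c_def e_def by (rule theta_cong[OF \<psi> M(1)]) (simp_all add: Cong.cong_def)
  \<comment> \<open>The element 0 lies in the block u = 0. Its norm 0 is not prime to M > 1, so its
    coefficient vanishes.\<close>
  have th0: "theta \<psi> 0 = 0"
  proof -
    have "M \<noteq> 1" using M(1) by (auto intro: notI)
    then have "\<psi> 0 = 0" by (intro dcharsD(4)[OF \<psi>]) simp
    then show ?thesis by (simp add: theta_def enorm_def)
  qed
  have W1: "W u \<ge> 1" for u
  proof -
    have "1 \<le> (1 + \<bar>fst u\<bar> + \<bar>snd u\<bar>)^2" by (rule one_le_power) simp
    then show ?thesis unfolding W_def by linarith
  qed
  have hol: "L holomorphic_on {s. Re s > 1/2}"
    unfolding L_def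
  proof (rule block_series_holomorphic(1)[where W = W and k = "1/81" and K = "3 * real M ^ 2" and ?X0.0 = X0])
    show "(\<Sum>r\<in>?R. c r) = 0" unfolding c_def by (rule theta_residue_sum[OF \<psi> M])
    show "X u r \<ge> 1/81 * W u" if "r \<in> ?R" "c r \<noteq> 0" for u r
    proof -
      have nz: "e u r \<noteq> 0" using that(2) th0 ce[of u r] by (metis)
      have "(1 + \<bar>fst u\<bar> + \<bar>snd u\<bar>)^2 \<le> 81 * eisnorm (e u r)"
        unfolding e_def by (rule block_norm_lower[OF M1]) (use that(1) nz in \<open>auto simp: e_def\<close>)
      then have "W u \<le> real_of_int (81 * eisnorm (e u r))" unfolding W_def by (simp only: of_int_le_iff)
      also have "\<dots> = 81 * X u r" by (simp add: X_def enorm_def)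
      finally show ?thesis by simp
    qed
    show "\<bar>X u r - X0 u\<bar> \<le> 3 * real M ^ 2 * W u powr (1/2)" if "r \<in> ?R" "c r \<noteq> 0" for u r
    proof -
      have "W u powr (1/2) = real_of_int (1 + \<bar>fst u\<bar> + \<bar>snd u\<bar>)"
        unfolding W_def by (simp add: powr_half_sqrt)
      moreover have "real_of_int \<bar>eisnorm (e u r) - ((int M)^2 * eisnorm (Eis (fst u) (snd u)) + 1)\<bar>
          \<le> real_of_int (3 * (int M)^2 * (1 + \<bar>fst u\<bar> + \<bar>snd u\<bar>))"
        unfolding of_int_le_iff e_def by (rule block_norm_diff[OF M1]) (use that(1) in auto)
      ultimately show ?thesis by (simp add: X_def X0_def enorm_def)
    qed
    show "X0 u \<ge> 1/81 * W u" for u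
    proof -
      define z where "z = Eis (fst u) (snd u)"
      have 1: "(1 + \<bar>re z\<bar> + \<bar>om z\<bar>)^2 \<le> 9 * (eisnorm z + 1)"
        using enorm_lower_bound(2)[of z] by (cases "z = 0") auto
      have 2: "1 * eisnorm z \<le> (int M)^2 * eisnorm z" using M1 by (intro mult_right_mono one_le_power) auto
      have lin: "w \<le> 81 * (m + 1)" if "w \<le> 9 * (n + 1)" "1 * n \<le> m" "0 \<le> n" for w n m :: int
        using that by presburger
      have "(1 + \<bar>re z\<bar> + \<bar>om z\<bar>)^2 \<le> 81 * ((int M)^2 * eisnorm z + 1)"
        by (rule lin[OF 1 2 eisnorm_nonneg])
      then have "W u \<le> real_of_int (81 * ((int M)^2 * eisnorm z + 1))"
        unfolding W_def of_int_le_iff z_def by simp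
      also have "\<dots> = 81 * X0 u" by (simp add: X0_def z_def)
      finally show ?thesis by simp
    qed
    show "(\<lambda>u. W u powr (-\<kappa>)) summable_on UNIV" if "\<kappa> > 1" for \<kappa>
    proof (rule summable_on_comparison_test[OF int2_powr_summable[OF that]])
      fix u :: "int \<times> int"
      have "(1 + \<bar>fst u\<bar>) * (1 + \<bar>snd u\<bar>) \<le> (1 + \<bar>fst u\<bar> + \<bar>snd u\<bar>)^2"
        by (simp add: power2_eq_square algebra_simps)
      then have "real_of_int ((1 + \<bar>fst u\<bar>) * (1 + \<bar>snd u\<bar>)) \<le> W u" unfolding W_def by (simp only: of_int_le_iff)
      then have "(1 + real_of_int \<bar>fst u\<bar>) * (1 + real_of_int \<bar>snd u\<bar>) \<le> W u" by simp
      then show "W u powr (-\<kappa>) \<le> (case u of (a, b) \<Rightarrow> ((1 + real_of_int \<bar>a\<bar>) * (1 + real_of_int \<bar>b\<bar>)) powr (-\<kappa>))"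
        using that by (cases u) (auto intro!: powr_mono2' mult_pos_pos)
    qed auto
  qed (use W1 in auto)
  have Leq: "L s = th.dseries s" if s: "Re s > 1" for s
  proof -
    have bij: "bij_betw (\<lambda>(u, r). e u r) (UNIV \<times> ?R) UNIV"
      by (rule bij_betwI[where g = "\<lambda>z. ((re z div int M, om z div int M), (re z mod int M, om z mod int M))"])
         (use M(2) in \<open>auto simp: e_def\<close>)
    have "((\<lambda>y. theta \<psi> (case y of (u, r) \<Rightarrow> e u r) * of_nat (enorm (case y of (u, r) \<Rightarrow> e u r)) powr (-s)) has_sum th.dseries s) (UNIV \<times> ?R)"
      using th.dseries_has_sum[OF s] by (rule iffD2[OF has_sum_reindex_bij_betw[OF bij]])
    then have "((\<lambda>u. \<Sum>r\<in>?R. c r * of_real (X u r) powr (-s)) has_sum th.dseries s) UNIV"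
    proof (rule has_sum_SigmaD)
      fix u :: "int \<times> int"
      show "((\<lambda>r. theta \<psi> (case (u, r) of (u, r) \<Rightarrow> e u r) * of_nat (enorm (case (u, r) of (u, r) \<Rightarrow> e u r)) powr (-s)) has_sum
         (\<Sum>r\<in>?R. c r * of_real (X u r) powr (-s))) ?R"
        by (intro has_sum_finiteI) (auto simp: ce X_def)
    qed
    then show ?thesis unfolding L_def by (rule infsumI)
  qed
  show ?thesis by (rule th.prime_sum_residue_nonpos[OF hol Leq]) (use that in auto)
qed

section \<open>From Eisenstein primes to rational primes\<close>

lemma inert_prime_eq:
  assumes z: "prime z" "\<not> prime (enorm z)"
  obtains q where "prime q" "z = normalize (of_nat q)"
proof -
  have "\<exists>q. prime q \<and> z dvd of_nat q" if "n > 0" "z dvd of_nat n" for n :: nat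
    using that
  proof (induction n rule: less_induct)
    case (less n)
    have "n \<noteq> 1"
    proof
      assume "n = 1"
      then have "z dvd 1" using less.prems(2) by simp
      then show False using z(1) not_prime_unit by blast
    qed
    then obtain q where q: "prime q" "q dvd n" using prime_factor_nat by blast
    then obtain m where m: "n = q * m" by blast
    then have "m > 0" using less.prems(1) by (cases m) auto
    then have m0: "m > 0" "m < n" using m prime_gt_1_nat[OF q(1)] by simp_all
    have "z dvd of_nat q * of_nat m" using less.prems m by simp
    then have "z dvd of_nat q \<or> z dvd of_nat m" using z(1) by (simp only: prime_dvd_mult_iff)
    then show ?case using q less.IH[OF m0(2,1)] by blast
  qed
  moreover have "enorm z > 0" using z(1) enorm_eq_0_iff[of z] by auto
  \<comment> \<open>Dividing its norm, z divides some rational prime q, and N(z) divides q^2. As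
    N(z) is neither 1 nor the prime q, it is q^2, and the cofactor of z in q is a unit.\<close>
  ultimately obtain q where q: "prime q" "z dvd of_nat q" using dvd_of_nat_enorm by blast
  then obtain w where w: "of_nat q = z * w" by blast
  have "enorm (of_nat q) = q ^ 2" by (simp add: enorm_def eisnorm_def nat_power_eq)
  then have nzw: "enorm z * enorm w = q ^ 2" using w by (metis enorm_mult)
  then obtain i where i: "i \<le> 2" "enorm z = q ^ i"
    using q(1) divides_primepow_nat[of q "enorm z" 2] by (metis dvd_triv_left)
  have "i \<noteq> 0"
  proof
    assume "i = 0"
    then have "enorm z = 1" using i by simp
    then have "z dvd 1" by (simp only: enorm_eq_1_iff)
    then show False using z(1) by auto
  qed
  moreover have "i \<noteq> 1" using i z(2) q(1) by (intro notI) simp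
  ultimately have "i = 2" using i(1) by linarith
  then have "enorm w = 1" using nzw i prime_gt_0_nat[OF q(1)] by simp
  then have "w dvd 1" by (simp only: enorm_eq_1_iff)
  then have "normalize (of_nat q) = normalize z" unfolding w by (simp add: normalize_mult_unit_right)
  then have "z = normalize (of_nat q)" using z(1) by (simp add: normalize_prime)
  then show ?thesis using that q(1) by blast
qed

text \<open>Such primes have norm q^2, so that at the exponent 1 their terms are among the terms 2
  log q / q^2 of a convergent series.\<close>

lemma inert_summable:
  "(\<lambda>z. ln (real (enorm z)) * real (enorm z) powr (-1)) summable_on {z. prime z \<and> \<not> prime (enorm z)}"
proof -
  let ?h = "\<lambda>q::nat. normalize (of_nat q :: eis)"
  have n: "enorm (?h q) = q ^ 2" for q
    by (simp add: enorm_normalize) (simp add: enorm_def eisnorm_def nat_power_eq)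
  have inj: "inj_on ?h {q. prime q}"
  proof (rule inj_onI)
    fix p q :: nat assume "?h p = ?h q"
    then have "p ^ 2 = q ^ 2" using n by metis
    then show "p = q" by (simp add: power_eq_iff_eq_base)
  qed
  have "(\<lambda>q. 2 * (ln (real q) * real q powr (-2))) summable_on {q::nat. prime q}"
    by (intro summable_on_cmult_right summable_on_subset_banach[OF nat_norm.N_ln_summable]) auto
  also have "?this \<longleftrightarrow> ((\<lambda>z. ln (real (enorm z)) * real (enorm z) powr (-1)) \<circ> ?h) summable_on {q. prime q}"
  proof (rule summable_on_cong)
    fix q :: nat assume "q \<in> {q. prime q}"
    then have q: "real q > 0" using prime_gt_0_nat by simp
    have pw: "(real q ^ 2) powr (-1) = real q powr (-2)"
      using q by (simp add: powr_minus powr_numeral)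
    show "2 * (ln (real q) * real q powr (-2)) = ((\<lambda>z. ln (real (enorm z)) * real (enorm z) powr (-1)) \<circ> ?h) q"
      unfolding o_def n of_nat_power ln_realpow pw by simp
  qed
  finally have "(\<lambda>z. ln (real (enorm z)) * real (enorm z) powr (-1)) summable_on (?h ` {q. prime q})"
    by (subst summable_on_reindex[OF inj])
  then show ?thesis
  proof (rule summable_on_subset_banach)
    show "{z. prime z \<and> \<not> prime (enorm z)} \<subseteq> ?h ` {q. prime q}"
    proof
      fix z assume z: "z \<in> {z. prime z \<and> \<not> prime (enorm z)}"
      obtain q where "prime q" "z = ?h q" by (rule inert_prime_eq[of z]) (use z in auto)
      then show "z \<in> ?h ` {q. prime q}" by simp
    qed
  qed
qed

definition eta_prime_sum :: "(nat \<Rightarrow> complex) \<Rightarrow> real \<Rightarrow> complex" where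
  "eta_prime_sum \<psi> x = (\<Sum>\<^sub>\<infinity>p\<in>{p. prime p}. \<psi> p * of_int (trace_eta p) * of_real (ln (real p) * real p powr (-x)))"

text \<open>The primes of degree one are grouped by their norm p; the finite sum of
  \<open>eta\<close> over the fibre is \<open>trace_eta p\<close>.\<close>

lemma eta_prime_sum_has_sum:
  assumes \<psi>: "\<psi> \<in> dchars M" "M > 0" and x: "x > 1"
  shows "((\<lambda>p. \<psi> p * of_int (trace_eta p) * of_real (ln (real p) * real p powr (-x))) has_sum eta_prime_sum \<psi> x) {p. prime p}"
    and "eta_prime_sum \<psi> x = (\<Sum>\<^sub>\<infinity>z\<in>{z. prime z \<and> prime (enorm z)}. theta \<psi> z * of_real (ln (real (enorm z)) * real (enorm z) powr (-x)))"
proof -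
  interpret th: normed_character enorm "theta \<psi>" by (rule theta_character[OF \<psi>])
  let ?Q = "{z. prime z \<and> prime (enorm z)}"
  let ?t = "\<lambda>z. theta \<psi> z * of_real (ln (real (enorm z)) * real (enorm z) powr (-x))"
  have hs: "(?t has_sum infsum ?t ?Q) ?Q" by (rule has_sum_infsum[OF th.prime_sum_summable[OF x]])
  have bij: "bij_betw snd (SIGMA p:{p. prime p}. primes_above p) ?Q"
    by (rule bij_betwI[where g = "\<lambda>z. (enorm z, z)"]) (auto simp: primes_above_def)
  have "((\<lambda>y. ?t (snd y)) has_sum infsum ?t ?Q) (SIGMA p:{p. prime p}. primes_above p)"
    using hs by (rule iffD2[OF has_sum_reindex_bij_betw[OF bij]])
  then have *: "((\<lambda>p. \<psi> p * of_int (trace_eta p) * of_real (ln (real p) * real p powr (-x))) has_sum infsum ?t ?Q) {p. prime p}"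
  proof (rule has_sum_SigmaD)
    fix p :: nat assume "p \<in> {p. prime p}"
    then have "finite (primes_above p)" using finite_primes_above prime_gt_0_nat by blast
    moreover have "(\<Sum>z\<in>primes_above p. ?t z) = (\<Sum>z\<in>primes_above p. \<psi> p * of_int (eta z) * of_real (ln (real p) * real p powr (-x)))"
      by (intro sum.cong refl) (simp add: theta_def primes_above_def)
    then have "(\<Sum>z\<in>primes_above p. ?t z) = \<psi> p * of_int (trace_eta p) * of_real (ln (real p) * real p powr (-x))"
      unfolding trace_eta_def of_int_sum sum_distrib_left sum_distrib_right .
    ultimately show "((\<lambda>z. ?t (snd (p, z))) has_sum (\<psi> p * of_int (trace_eta p) * of_real (ln (real p) * real p powr (-x)))) (primes_above p)"
      by (intro has_sum_finiteI) simp_all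
  qed
  then show "eta_prime_sum \<psi> x = infsum ?t ?Q" unfolding eta_prime_sum_def by (rule infsumI)
  with * show "((\<lambda>p. \<psi> p * of_int (trace_eta p) * of_real (ln (real p) * real p powr (-x))) has_sum eta_prime_sum \<psi> x) {p. prime p}"
    by (simp only:)
qed

text \<open>What separates the two sums are the primes of norm q^2, whose total is bounded for all x
  > 1 by the convergent sum at the exponent 1.\<close>

lemma eta_prime_sum_approx:
  assumes \<psi>: "\<psi> \<in> dchars M" "M > 0"
  obtains C where "\<And>x. x > 1 \<Longrightarrow> norm (prime_log_sum enorm (theta \<psi>) x - eta_prime_sum \<psi> x) \<le> C"
proof
  interpret th: normed_character enorm "theta \<psi>" by (rule theta_character[OF \<psi>])
  let ?Q = "{z. prime z \<and> prime (enorm z)}" and ?Q' = "{z. prime z \<and> \<not> prime (enorm z)}"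
  let ?b = "\<lambda>z. ln (real (enorm z)) * real (enorm z) powr (-1)"
  fix x :: real assume x: "x > 1"
  let ?t = "\<lambda>z. theta \<psi> z * of_real (ln (real (enorm z)) * real (enorm z) powr (-x))"
  have "{z :: eis. prime z} = ?Q \<union> ?Q'" by auto
  then have "prime_log_sum enorm (theta \<psi>) x = infsum ?t (?Q \<union> ?Q')" unfolding prime_log_sum_def by (simp only:)
  also have "\<dots> = infsum ?t ?Q + infsum ?t ?Q'"
    by (rule infsum_Un_disjoint[OF th.prime_sum_summable[OF x] th.prime_sum_summable[OF x]]) auto
  finally have "prime_log_sum enorm (theta \<psi>) x - eta_prime_sum \<psi> x = infsum ?t ?Q'"
    using eta_prime_sum_has_sum(2)[OF \<psi> x] by simp
  also have "norm \<dots> \<le> infsum ?b ?Q'"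
  proof (rule norm_infsum_le[OF has_sum_infsum[OF th.prime_sum_summable[OF x]] has_sum_infsum[OF inert_summable]])
    fix z assume "z \<in> ?Q'"
    then have "real (enorm z) \<ge> 1" using eis_norm.N_prime_ge_2[of z] by simp
    then have 1: "real (enorm z) powr (-x) \<le> real (enorm z) powr (-1)" using x by (intro powr_mono) auto
    have nn: "0 \<le> ln (real (enorm z)) * real (enorm z) powr (-x)"
      by (intro mult_nonneg_nonneg eis_norm.ln_N_nonneg) simp
    have "norm (?t z) = norm (theta \<psi> z) * (ln (real (enorm z)) * real (enorm z) powr (-x))"
      by (simp only: norm_mult norm_of_real abs_of_nonneg[OF nn])
    also have "\<dots> \<le> 1 * (ln (real (enorm z)) * real (enorm z) powr (-1))"
      by (intro mult_mono[OF th.f_norm mult_left_mono[OF 1 eis_norm.ln_N_nonneg]] nn) simp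
    finally have "norm (?t z) \<le> 1 * (ln (real (enorm z)) * real (enorm z) powr (-1))" .
    then show "norm (?t z) \<le> ?b z" by (simp only: mult_1)
  qed
  finally show "norm (prime_log_sum enorm (theta \<psi>) x - eta_prime_sum \<psi> x) \<le> infsum ?b ?Q'" .
qed

lemma trace_eta_cases:
  assumes "12 dvd M" "prime p" "\<psi> \<in> dchars M"
  shows "\<psi> p = 0 \<or> (p mod 12 = 1 \<and> \<bar>trace_eta p\<bar> = 2) \<or> trace_eta p = 0"
proof (cases "coprime p M")
  case True
  then have "coprime p 12" using coprime_divisors[OF dvd_refl assms(1)] by blast
  show ?thesis
  proof (cases "p mod 12 = 1")
    case True
    obtain z where "trace_eta p = 2 * eta z" "eta z = 1 \<or> eta z = -1"
      by (rule trace_eta_1_mod_12[OF assms(2) True])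
    then show ?thesis using True by auto
  qed (use trace_eta_eq_0[OF assms(2) \<open>coprime p 12\<close>] in simp)
qed (use dcharsD(4)[OF assms(3)] in auto)

text \<open>The positivity $a_p^2 + 2 \mathrm{Re} (\psi(p) a_p) \ge 0$, where $a_p$ is \<open>trace_eta p\<close> and $a_p^2$ has mean value $1$,
  excludes a zero of the $L$-function at $1$.\<close>

lemma eta_prime_sum_residue:
  assumes \<psi>: "\<psi> \<in> dchars M" and M: "12 dvd M" "M > 0"
  shows "((\<lambda>x. of_real (x - 1) * eta_prime_sum \<psi> x) \<longlongrightarrow> 0) (at_right 1)"
proof -
  obtain k :: nat where k: "((\<lambda>x. of_real (x - 1) * prime_log_sum enorm (theta \<psi>) x) \<longlongrightarrow> - of_nat k) (at_right 1)"
    using theta_residue[OF \<psi> M] by blast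
  obtain C where C: "\<And>x. x > 1 \<Longrightarrow> norm (prime_log_sum enorm (theta \<psi>) x - eta_prime_sum \<psi> x) \<le> C"
    using eta_prime_sum_approx[OF \<psi> M(2)] by blast
  have R0: "((\<lambda>x. of_real (x - 1) * (prime_log_sum enorm (theta \<psi>) x - eta_prime_sum \<psi> x)) \<longlongrightarrow> 0) (at_right 1)"
  proof (rule Lim_null_comparison)
    show "eventually (\<lambda>x. norm (of_real (x - 1) * (prime_log_sum enorm (theta \<psi>) x - eta_prime_sum \<psi> x)) \<le> (x - 1) * C) (at_right 1)"
      using eventually_gt_at_right_1
      by eventually_elim (use C in \<open>auto simp: norm_mult norm_of_real simp del: of_real_diff intro!: mult_left_mono\<close>)
    have "((\<lambda>x. (x - 1) * C) \<longlongrightarrow> (1 - 1) * C) (at_right 1)" by (intro tendsto_intros)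
    then show "((\<lambda>x. (x - 1) * C) \<longlongrightarrow> 0) (at_right 1)" by simp
  qed
  have "((\<lambda>x. of_real (x - 1) * prime_log_sum enorm (theta \<psi>) x - of_real (x - 1) * (prime_log_sum enorm (theta \<psi>) x - eta_prime_sum \<psi> x)) \<longlongrightarrow> - of_nat k - 0) (at_right 1)"
    by (intro tendsto_diff k R0)
  then have lim: "((\<lambda>x. of_real (x - 1) * eta_prime_sum \<psi> x) \<longlongrightarrow> - of_nat k) (at_right 1)"
    by (simp add: right_diff_distrib)
  let ?S = "\<lambda>x. \<Sum>\<^sub>\<infinity>p\<in>{p. prime p \<and> [p = 1] (mod 12)}. ln (real p) * real p powr (-x)"
  have "totient 12 = 4"
  proof -
    have "totient (3 * 2 ^ 2) = totient 3 * totient (2 ^ 2)"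
      by (rule totient_mult_coprime) (simp only: coprime_power_right_iff, simp)
    also have "totient (2 ^ 2) = 2" using totient_prime_power[of 2 2] by simp
    finally have "totient (3 * 2 ^ 2) = totient 3 * 2" .
    moreover have "totient 3 = (2 :: nat)" using totient_prime[of 3] by simp
    ultimately show ?thesis by simp
  qed
  then have S: "((\<lambda>x. (x - 1) * ?S x) \<longlongrightarrow> 1 / 4) (at_right 1)" using dirichlet_density[of 12 1] by simp
  \<comment> \<open>The 4 is the square of \<open>trace_eta p\<close>, which is 2 or -2 at the
    primes p = 1 (mod 12); at every other prime the second term vanishes.\<close>
  have nonneg: "4 * ?S x + 2 * Re (eta_prime_sum \<psi> x) \<ge> 0" if x: "x > 1" for x
  proof -
    let ?w = "\<lambda>p. ln (real p) * real p powr (-x)"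
    have "(?w has_sum ?S x) {p. prime p \<and> [p = 1] (mod 12)}"
      by (intro has_sum_infsum summable_on_subset_banach[OF nat_norm.N_ln_summable[OF x]]) auto
    then have "((\<lambda>p. if [p = 1] (mod 12) then ?w p else 0) has_sum ?S x) {p. prime p}"
      by (subst has_sum_cong_neutral[where T = "{p. prime p \<and> [p = 1] (mod 12)}" and g = ?w]) auto
    then have "((\<lambda>p. 4 * (if [p = 1] (mod 12) then ?w p else 0) + 2 * Re (\<psi> p * of_int (trace_eta p) * of_real (?w p)))
        has_sum (4 * ?S x + 2 * Re (eta_prime_sum \<psi> x))) {p. prime p}"
      by (intro has_sum_add has_sum_cmult_right has_sum_Re eta_prime_sum_has_sum(1)[OF \<psi> M(2) x])
    then show ?thesis
    proof (rule has_sum_nonneg)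
      fix p :: nat assume "p \<in> {p. prime p}"
      then have p: "prime p" by simp
      have w: "?w p \<ge> 0" using prime_gt_0_nat[OF p] by simp
      have eq: "Re (\<psi> p * of_int (trace_eta p) * of_real (?w p)) = Re (\<psi> p) * real_of_int (trace_eta p) * ?w p"
        by simp
      show "0 \<le> 4 * (if [p = 1] (mod 12) then ?w p else 0) + 2 * Re (\<psi> p * of_int (trace_eta p) * of_real (?w p))"
      proof (cases "p mod 12 = 1 \<and> \<bar>trace_eta p\<bar> = 2")
        case True
        have "\<bar>Re (\<psi> p)\<bar> \<le> 1" using norm_dchar[OF \<psi> M(2), of p] abs_Re_le_cmod[of "\<psi> p"] by (auto split: if_splits)
        moreover have "real_of_int (trace_eta p) = 2 \<or> real_of_int (trace_eta p) = -2" using True by auto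
        ultimately have "0 \<le> 4 + 2 * (Re (\<psi> p) * real_of_int (trace_eta p))" by (auto simp: abs_le_iff)
        then have "0 \<le> (4 + 2 * (Re (\<psi> p) * real_of_int (trace_eta p))) * ?w p" using w by (rule mult_nonneg_nonneg)
        moreover have "[p = 1] (mod 12)" using True by (simp add: Cong.cong_def)
        ultimately show ?thesis unfolding eq by (simp add: algebra_simps)
      next
        case False
        then have "\<psi> p = 0 \<or> trace_eta p = 0" using trace_eta_cases[OF M(1) p \<psi>] by blast
        then show ?thesis using w by auto
      qed
    qed
  qed
  have "((\<lambda>x. 4 * ((x - 1) * ?S x) + 2 * Re (of_real (x - 1) * eta_prime_sum \<psi> x)) \<longlongrightarrow> 4 * (1/4) + 2 * Re (- of_nat k)) (at_right 1)"
    by (intro tendsto_intros S lim)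
  moreover have "eventually (\<lambda>x. 0 \<le> 4 * ((x - 1) * ?S x) + 2 * Re (of_real (x - 1) * eta_prime_sum \<psi> x)) (at_right 1)"
    using eventually_gt_at_right_1
  proof eventually_elim
    case (elim x)
    have "0 \<le> (x - 1) * (4 * ?S x + 2 * Re (eta_prime_sum \<psi> x))"
      using nonneg[OF elim] elim by (intro mult_nonneg_nonneg) auto
    moreover have "Re (of_real (x - 1) * eta_prime_sum \<psi> x) = (x - 1) * Re (eta_prime_sum \<psi> x)" by (simp del: of_real_diff)
    ultimately show ?case by (simp only: distrib_left mult_ac)
  qed
  \<comment> \<open>That is 1 - 2 k >= 0 for a natural number k.\<close>
  ultimately have "0 \<le> 4 * (1/4) + 2 * Re (- of_nat k :: complex)"
    by (intro tendsto_lowerbound) auto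
  then have "2 * k \<le> 1" by simp
  then have "k = 0" by simp
  then show ?thesis using lim by simp
qed

text \<open>Otherwise \<open>trace_eta\<close> is 2 at all primes in the class of c, and the
  combination of twisted sums that isolates this class has mean value 2 by
  \<open>dirichlet_density\<close>; yet each of the twisted sums has mean value 0.\<close>

theorem exists_prime_eta_minus_1:
  assumes M: "12 dvd M" "M > 0" and c: "coprime c M" "c mod 12 = 1"
  obtains p z where "prime p" "[p = c] (mod M)" "enorm z = p" "eta z = -1"
proof (rule ccontr)
  note witness = that
  assume nex: "\<not> thesis"
  have M1: "M > 1" using M using dvd_imp_le[of 12 M] by linarith
  let ?S = "\<lambda>x. \<Sum>\<^sub>\<infinity>p\<in>{p. prime p \<and> [p = c] (mod M)}. ln (real p) * real p powr (-x)"
  have tr: "trace_eta p = 2" if p: "prime p" "[p = c] (mod M)" for p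
  proof -
    have "[p = c] (mod 12)" using p(2) M(1) by (rule cong_dvd_modulus_nat)
    then have "p mod 12 = 1" using c(2) by (simp add: Cong.cong_def)
    then obtain z where z: "enorm z = p" "trace_eta p = 2 * eta z" "eta z = 1 \<or> eta z = -1"
      by (rule trace_eta_1_mod_12[OF p(1)])
    have "eta z \<noteq> -1" using witness[OF p z(1)] nex by blast
    then show ?thesis using z by simp
  qed
  have eq: "(\<Sum>\<psi>\<in>dchars M. cnj (\<psi> c) * eta_prime_sum \<psi> x) = of_nat (totient M) * of_real (2 * ?S x)" if x: "x > 1" for x
  proof -
    let ?w = "\<lambda>p. ln (real p) * real p powr (-x)"
    have "((\<lambda>p. \<Sum>\<psi>\<in>dchars M. cnj (\<psi> c) * (\<psi> p * of_int (trace_eta p) * of_real (?w p))) has_sum (\<Sum>\<psi>\<in>dchars M. cnj (\<psi> c) * eta_prime_sum \<psi> x)) {p. prime p}"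
      by (intro has_sum_finite_sum has_sum_cmult_right eta_prime_sum_has_sum(1)[OF _ M(2) x])
    moreover have "(\<Sum>\<psi>\<in>dchars M. cnj (\<psi> c) * (\<psi> p * of_int (trace_eta p) * of_real (?w p))) =
       of_nat (totient M) * (if [p = c] (mod M) then of_int (trace_eta p) * of_real (?w p) else 0)" for p
    proof -
      have "(\<Sum>\<psi>\<in>dchars M. cnj (\<psi> c) * (\<psi> p * of_int (trace_eta p) * of_real (?w p))) = (\<Sum>\<psi>\<in>dchars M. cnj (\<psi> c) * \<psi> p) * (of_int (trace_eta p) * of_real (?w p))"
        by (simp only: sum_distrib_right mult.assoc)
      then show ?thesis by (simp add: dchars_orthogonality[OF M1 c(1)])
    qed
    ultimately have "((\<lambda>p. of_nat (totient M) * (if [p = c] (mod M) then of_int (trace_eta p) * of_real (?w p) else 0)) has_sum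
        (\<Sum>\<psi>\<in>dchars M. cnj (\<psi> c) * eta_prime_sum \<psi> x)) {p. prime p}" by (simp only:)
    moreover have "((\<lambda>p. complex_of_real (2 * ?w p)) has_sum complex_of_real (2 * ?S x)) {p. prime p \<and> [p = c] (mod M)}"
      by (intro has_sum_of_real has_sum_cmult_right has_sum_infsum summable_on_subset_banach[OF nat_norm.N_ln_summable[OF x]]) auto
    then have "((\<lambda>p. if [p = c] (mod M) then of_int (trace_eta p) * complex_of_real (?w p) else 0) has_sum of_real (2 * ?S x)) {p. prime p}"
      by (subst has_sum_cong_neutral[where T = "{p. prime p \<and> [p = c] (mod M)}" and g = "\<lambda>p. complex_of_real (2 * ?w p)"]) (auto simp: tr)
    then have "((\<lambda>p. of_nat (totient M) * (if [p = c] (mod M) then of_int (trace_eta p) * complex_of_real (?w p) else 0)) has_sum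
        (of_nat (totient M) * of_real (2 * ?S x))) {p. prime p}" by (rule has_sum_cmult_right)
    ultimately show ?thesis using has_sum_unique by blast
  qed
  have "((\<lambda>x. \<Sum>\<psi>\<in>dchars M. cnj (\<psi> c) * (of_real (x - 1) * eta_prime_sum \<psi> x)) \<longlongrightarrow> (\<Sum>\<psi>\<in>dchars M. cnj (\<psi> c) * 0)) (at_right 1)"
    by (intro tendsto_intros eta_prime_sum_residue[OF _ M])
  then have l1: "((\<lambda>x. \<Sum>\<psi>\<in>dchars M. cnj (\<psi> c) * (of_real (x - 1) * eta_prime_sum \<psi> x)) \<longlongrightarrow> 0) (at_right 1)" by simp
  have "((\<lambda>x. of_nat (totient M) * complex_of_real (2 * ((x - 1) * ?S x))) \<longlongrightarrow> of_nat (totient M) * of_real (2 * (1 / real (totient M)))) (at_right 1)"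
    by (intro tendsto_intros dirichlet_density M1 c)
  moreover have "eventually (\<lambda>x. of_nat (totient M) * complex_of_real (2 * ((x - 1) * ?S x)) =
        (\<Sum>\<psi>\<in>dchars M. cnj (\<psi> c) * (of_real (x - 1) * eta_prime_sum \<psi> x))) (at_right 1)"
    using eventually_gt_at_right_1
  proof eventually_elim
    case (elim x)
    have "(\<Sum>\<psi>\<in>dchars M. cnj (\<psi> c) * (of_real (x - 1) * eta_prime_sum \<psi> x)) = of_real (x - 1) * (\<Sum>\<psi>\<in>dchars M. cnj (\<psi> c) * eta_prime_sum \<psi> x)"
      by (simp only: sum_distrib_left mult_ac)
    also have "\<dots> = of_nat (totient M) * complex_of_real (2 * ((x - 1) * ?S x))"
      by (simp only: eq[OF elim] of_real_mult mult_ac)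
    finally show ?case by (rule sym)
  qed
  ultimately have "((\<lambda>x. \<Sum>\<psi>\<in>dchars M. cnj (\<psi> c) * (of_real (x - 1) * eta_prime_sum \<psi> x)) \<longlongrightarrow> of_nat (totient M) * of_real (2 * (1 / real (totient M)))) (at_right 1)"
    by (rule Lim_transform_eventually)
  with l1 have "0 = of_nat (totient M) * complex_of_real (2 * (1 / real (totient M)))"
    by (rule tendsto_unique[rotated]) simp
  moreover have "totient M > 0" using M by simp
  ultimately show False by simp
qed

section \<open>The quartic residue criterion\<close>

lemma Legendre_values: "Legendre a p = -1 \<or> Legendre a p = 0 \<or> Legendre a p = 1"
  by (simp add: Legendre_def)

text \<open>Two values among -1, 0, 1 differ by at most 2, hence are equal once congruent modulo p >
  2.\<close>

lemma Legendre_eqI: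
  assumes "p > 2" "[Legendre a q = x] (mod int p)" "x = -1 \<or> x = 0 \<or> x = 1"
  shows "Legendre a q = x"
proof (rule ccontr)
  assume ne: "Legendre a q \<noteq> x"
  have "int p dvd Legendre a q - x" using assms(2) by (simp add: cong_iff_dvd_diff)
  then have "\<bar>int p\<bar> \<le> \<bar>Legendre a q - x\<bar>" using ne by (intro dvd_imp_le_int) auto
  moreover have "\<bar>Legendre a q - x\<bar> \<le> 2" using assms(3) Legendre_values[of a q] by auto
  ultimately show False using assms(1) by simp
qed

lemma Legendre_mult:
  assumes p: "prime (p::nat)" "p > 2"
  shows "Legendre (a * b) p = Legendre a p * Legendre b p"
proof (rule Legendre_eqI[OF p(2)])
  have "[Legendre (a * b) p = (a * b) ^ ((p - 1) div 2)] (mod p)" by (rule euler_criterion[OF p])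
  also have "(a * b) ^ ((p - 1) div 2) = a ^ ((p - 1) div 2) * b ^ ((p - 1) div 2)" by (rule power_mult_distrib)
  also have "[\<dots> = Legendre a p * Legendre b p] (mod p)"
    by (intro cong_mult cong_sym[OF euler_criterion[OF p]])
  finally show "[Legendre (a * b) p = Legendre a p * Legendre b p] (mod p)" .
  show "Legendre a p * Legendre b p = -1 \<or> Legendre a p * Legendre b p = 0 \<or> Legendre a p * Legendre b p = 1"
    using Legendre_values[of a p] Legendre_values[of b p] by auto
qed

lemma Legendre_cong:
  assumes "[a = b] (mod p)" shows "Legendre a p = Legendre b p"
proof -
  have "[a = 0] (mod p) \<longleftrightarrow> [b = 0] (mod p)" using assms cong_sym cong_trans by blast
  moreover have "QuadRes p a \<longleftrightarrow> QuadRes p b" unfolding QuadRes_def using assms cong_sym cong_trans by blast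
  ultimately show ?thesis by (simp add: Legendre_def)
qed

lemma Legendre_square:
  assumes "prime (p::nat)" "\<not> int p dvd a" shows "Legendre (a ^ 2) p = 1"
proof -
  have "\<not> int p dvd a ^ 2" using assms prime_dvd_power[of "int p" a 2] by auto
  then have "\<not> [a ^ 2 = 0] (mod int p)" by (simp add: cong_0_iff)
  moreover have "QuadRes (int p) (a ^ 2)" unfolding QuadRes_def by (rule exI[of _ a]) (rule cong_refl)
  ultimately show ?thesis by (simp add: Legendre_def)
qed

lemma sqrt_minus_1_mod_prime:
  assumes p: "prime (p::nat)" "p mod 4 = 1"
  obtains i :: int where "[i ^ 2 = -1] (mod int p)"
proof -
  have p2: "p > 2" using p prime_ge_2_nat[of p] by (cases "p = 2") auto
  have "even ((p - 1) div 2)" using p(2) by presburger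
  then have "[Legendre (-1) p = 1] (mod p)" using euler_criterion[OF p(1) p2, of "-1"] by simp
  then have "Legendre (-1) p = 1" by (rule Legendre_eqI[OF p2]) simp
  then have "QuadRes (int p) (-1)" by (simp add: Legendre_def split: if_splits)
  then show ?thesis using that unfolding QuadRes_def by blast
qed

text \<open>From (1 + i)^2 = 2 i the symbols of 2 and i agree, and Euler's criterion gives
  i^((p-1)/2) = (-1)^((p-1)/4).\<close>

lemma Legendre_2:
  assumes p: "prime (p::nat)" "p mod 4 = 1"
  shows "Legendre 2 p = (if p mod 8 = 1 then 1 else -1)"
proof -
  have p2: "p > 2" using p prime_ge_2_nat[of p] by (cases "p = 2") auto
  obtain i :: int where i: "[i ^ 2 = -1] (mod int p)" using sqrt_minus_1_mod_prime[OF p] by blast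
  have nd2: "\<not> int p dvd 2" using p2 by (auto dest: zdvd_imp_le)
  have "\<not> int p dvd 1 + i"
  proof
    assume "int p dvd 1 + i"
    then have "int p dvd (1 + i) * (1 - i)" by simp
    moreover have "int p dvd i ^ 2 + 1" using i by (simp add: cong_iff_dvd_diff)
    ultimately have "int p dvd (1 + i) * (1 - i) + (i ^ 2 + 1)" by (rule dvd_add)
    also have "(1 + i) * (1 - i) + (i ^ 2 + 1) = 2" by (simp add: algebra_simps power2_eq_square)
    finally show False using nd2 by blast
  qed
  then have "Legendre ((1 + i) ^ 2) p = 1" by (rule Legendre_square[OF p(1)])
  moreover have "[(1 + i) ^ 2 = 2 * i] (mod int p)"
  proof -
    have "(1 + i) ^ 2 - 2 * i = i ^ 2 - (-1)" by (simp add: power2_eq_square algebra_simps)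
    then show ?thesis using i by (simp add: cong_iff_dvd_diff)
  qed
  ultimately have prod: "Legendre 2 p * Legendre i p = 1"
    using Legendre_cong[of "(1 + i) ^ 2" "2 * i" "int p"] Legendre_mult[OF p(1) p2, of 2 i] by simp
  define k where "k = (p - 1) div 4"
  have k: "(p - 1) div 2 = 2 * k" using p(2) unfolding k_def by presburger
  have "[Legendre i p = i ^ (2 * k)] (mod p)" using euler_criterion[OF p(1) p2, of i] k by simp
  also have "i ^ (2 * k) = (i ^ 2) ^ k" by (rule power_mult)
  also have "[(i ^ 2) ^ k = (-1) ^ k] (mod int p)" by (rule cong_pow[OF i])
  finally have "Legendre i p = (-1) ^ k"
    by (rule Legendre_eqI[OF p2]) (cases "even k"; simp)
  moreover have "even k \<longleftrightarrow> p mod 8 = 1" using p(2) unfolding k_def by presburger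
  ultimately show ?thesis using prod by (cases "even k") auto
qed

lemma Legendre_prime_swap:
  assumes p: "prime (p::nat)" "p mod 4 = 1" and q: "prime (q::nat)" "q > 2" "q \<noteq> p"
  shows "Legendre q p = Legendre p q"
proof -
  have p2: "p > 2" using p prime_ge_2_nat[of p] by (cases "p = 2") auto
  have "even ((p - 1) div 2)" using p(2) by presburger
  then have "even ((p - 1) div 2 * ((q - 1) div 2))" by simp
  then have "Legendre p q * Legendre q p = 1" using Quadratic_Reciprocity[OF p(1) p2 q(1,2)] q(3) by simp
  then show ?thesis using Legendre_values[of p q] Legendre_values[of q p] by auto
qed

lemma Legendre_eq_multiplicative:
  fixes g :: "nat \<Rightarrow> int"
  assumes p: "prime (p::nat)" "p > 2" and g: "g 1 = 1" "\<And>a b. g (a * b) = g a * g b"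
    and n: "n > 0" "\<And>q. prime q \<Longrightarrow> q dvd n \<Longrightarrow> Legendre (int q) p = g q"
  shows "Legendre (int n) p = g n"
  using n
proof (induction n rule: less_induct)
  case (less n)
  show ?case
  proof (cases "n = 1")
    case True
    have "\<not> int p dvd 1" using p(2) by simp
    then have "Legendre (1 ^ 2) p = 1" by (rule Legendre_square[OF p(1)])
    then show ?thesis using True g(1) by simp
  next
    case False
    then obtain q where q: "prime q" "q dvd n" using prime_factor_nat by blast
    then obtain m where m: "n = q * m" by blast
    then have "m > 0" using less.prems(1) by (cases m) auto
    then have "m < n" using m prime_gt_1_nat[OF q(1)] by simp
    have "Legendre (int m) p = g m"
      by (rule less.IH[OF \<open>m < n\<close> \<open>m > 0\<close>]) (use m less.prems(2) in auto)
    then show ?thesis using m g(2)[of q m] less.prems(2)[OF q] Legendre_mult[OF p, of "int q" "int m"] by simp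
  qed
qed

lemma chi4_mult: "chi4 (x * y) = chi4 x * chi4 y"
proof -
  have fin: "\<forall>a\<in>{0,1,2,3}. \<forall>b\<in>{0,1,2,3}. chi4 (a * b) = chi4 a * chi4 b"
    by (simp add: chi4_def)
  have mem: "x mod 4 \<in> {0,1,2,3}" for x :: int using int_mod_4_cases[of x] by auto
  have m: "chi4 (x mod 4) = chi4 x" for x by (simp add: chi4_def)
  have "chi4 (x * y) = chi4 ((x mod 4) * (y mod 4))"
    unfolding chi4_def mod_mult_eq ..
  also have "\<dots> = chi4 (x mod 4) * chi4 (y mod 4)" by (intro fin[rule_format] mem)
  finally show ?thesis by (simp only: m)
qed

text \<open>By reciprocity (3/q) (q/3) = (-1)^((q-1)/2), where (q/3) is \<open>chi3 q\<close> and
  the sign is \<open>chi4 q\<close>.\<close>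

lemma Legendre_3:
  assumes q: "prime (q::nat)" "q > 3"
  shows "Legendre 3 q = chi3 q * chi4 q"
proof -
  have rec: "Legendre 3 q * Legendre q 3 = (-1) ^ ((q - 1) div 2)"
    using Quadratic_Reciprocity[of 3 q] q by simp
  have "\<not> 3 dvd q" using q primes_dvd_imp_eq[of 3 q] by auto
  then have "q mod 3 = 1 \<or> q mod 3 = 2" by presburger
  then have q3: "int q mod 3 = 1 \<or> int q mod 3 = 2" by presburger
  have L3: "Legendre q 3 = chi3 q"
  proof (cases "int q mod 3 = 1")
    case True
    have "[1 ^ 2 = int q] (mod 3)" using True by (simp add: Cong.cong_def)
    then have "QuadRes 3 (int q)" unfolding QuadRes_def by blast
    moreover have "\<not> [int q = 0] (mod 3)" using True by (simp add: Cong.cong_def)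
    ultimately show ?thesis using True by (simp add: Legendre_def chi3_def)
  next
    case False
    then have m2: "int q mod 3 = 2" using q3 by simp
    have "\<not> QuadRes 3 (int q)"
    proof
      assume "QuadRes 3 (int q)"
      then obtain y where "[y ^ 2 = int q] (mod 3)" unfolding QuadRes_def by blast
      then have y: "(y * y) mod 3 = 2" using m2 by (simp add: Cong.cong_def power2_eq_square)
      have "y mod 3 = 0 \<or> y mod 3 = 1 \<or> y mod 3 = 2" by presburger
      then have "((y mod 3) * (y mod 3)) mod 3 \<noteq> 2" by (elim disjE) simp_all
      then show False using y by (simp only: mod_mult_eq)
    qed
    moreover have "\<not> [int q = 0] (mod 3)" using m2 by (simp add: Cong.cong_def)
    ultimately show ?thesis using m2 by (simp add: Legendre_def chi3_def)
  qed
  have "odd q" using q prime_odd_nat[of q] by simp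
  have "(-1) ^ ((q - 1) div 2) = chi4 q"
  proof (cases "q mod 4 = 1")
    case True
    then have "even ((q - 1) div 2)" "int q mod 4 = 1" by presburger+
    then show ?thesis by (simp add: chi4_def)
  next
    case False
    then have "q mod 4 = 3" using \<open>odd q\<close> by presburger
    then have "odd ((q - 1) div 2)" "int q mod 4 = 3" by presburger+
    then show ?thesis by (simp add: chi4_def)
  qed
  moreover have "chi3 q = 1 \<or> chi3 q = -1" using q3 by (auto simp: chi3_def)
  ultimately show ?thesis using rec L3 by auto
qed

text \<open>As p = 1 (mod 4), reciprocity gives (q/p) = (p/q) for odd primes q. If q divides v, then
  p = u^2 (mod q) and the symbol is 1; if q divides u, then p = 3 v^2 and it is (3/q) = chi3(q)
  chi4(q). There remain the power of 2 in v, and the signs, which are harmless since -1 is a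
  square.\<close>

lemma Legendre_representation:
  fixes u v :: int
  assumes p: "prime (p::nat)" "p mod 12 = 1" and uv: "int p = u ^ 2 + 3 * v ^ 2" and par: "odd u" "even v"
  shows "Legendre (u * v) p = chi3 u * chi4 (u + v)" "\<not> int p dvd u" "\<not> int p dvd v"
proof -
  have p4: "p mod 4 = 1" and p3: "p mod 3 = 1" using p(2) by presburger+
  have p2: "p > 2" using p prime_ge_2_nat[of p] by (cases "p = 2") auto
  have pp: "prime (int p)" using p(1) by simp
  have v0: "v \<noteq> 0"
  proof
    assume "v = 0"
    then have "int p = u * u" using uv by (simp add: power2_eq_square)
    then have "u dvd int p" "int p dvd u * u" by simp_all
    then have "int p dvd u" using pp by (simp add: prime_dvd_mult_iff)
    moreover have "u \<noteq> 0" using \<open>int p = u * u\<close> p2 by auto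
    ultimately have "\<bar>int p\<bar> \<le> \<bar>u\<bar>" by (intro dvd_imp_le_int)
    then have "int p * int p \<le> \<bar>u\<bar> * \<bar>u\<bar>" by (intro mult_mono) auto
    moreover have "\<bar>u\<bar> * \<bar>u\<bar> = int p" using \<open>int p = u * u\<close> by simp
    moreover have "int p * 2 \<le> int p * int p" using p2 by (intro mult_left_mono) auto
    ultimately show False using p2 by linarith
  qed
  have small: "\<not> int p dvd x" if "x \<noteq> 0" "x ^ 2 < int p ^ 2" for x :: int
  proof
    assume "int p dvd x"
    then have "\<bar>int p\<bar> \<le> \<bar>x\<bar>" using that(1) by (intro dvd_imp_le_int) auto
    then have "int p ^ 2 \<le> x ^ 2" using power_mono[of "\<bar>int p\<bar>" "\<bar>x\<bar>" 2] by simp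
    then show False using that(2) by simp
  qed
  have u0: "u \<noteq> 0" using par by auto
  have "1 \<le> u ^ 2" "1 \<le> v ^ 2" using u0 v0 by (simp_all add: int_one_le_iff_zero_less)
  then have "u ^ 2 < int p" "v ^ 2 < int p" unfolding uv by linarith+
  moreover have "int p * 1 \<le> int p * int p" using p2 by (intro mult_left_mono) auto
  ultimately have "u ^ 2 < int p ^ 2" "v ^ 2 < int p ^ 2" by (simp_all add: power2_eq_square)
  then show ndu: "\<not> int p dvd u" and ndv: "\<not> int p dvd v" using small u0 v0 by auto
  have cop: "\<not> (q dvd u \<and> q dvd v)" if "prime q" for q :: int
  proof
    assume q: "q dvd u \<and> q dvd v"
    then have "q dvd int p" unfolding uv by (simp add: power2_eq_square)
    then have "q = int p" using that pp by (simp add: primes_dvd_imp_eq)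
    then show False using q ndu by blast
  qed
  have odd_part: "Legendre (int n) p = 1" if n: "n > 0" "odd n" "int n dvd v" for n
  proof (rule Legendre_eq_multiplicative[where g = "\<lambda>_. 1"])
    fix q :: nat assume q: "prime q" "q dvd n"
    have qv: "int q dvd v" using q(2) n(3) by (meson dvd_trans int_dvd_int_iff)
    have "q \<noteq> 2" using q n by auto
    then have q2: "q > 2" using prime_ge_2_nat[OF q(1)] by simp
    have "q \<noteq> p" using qv ndv by auto
    have "[int p = u ^ 2] (mod int q)" using qv unfolding uv by (simp add: cong_iff_dvd_diff power2_eq_square)
    moreover have "\<not> int q dvd u" using cop[of "int q"] q(1) qv by auto
    ultimately have "Legendre p q = 1" using Legendre_cong[of "int p" "u ^ 2" "int q"] Legendre_square[OF q(1)] by simp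
    then show "Legendre (int q) p = 1" using Legendre_prime_swap[OF p(1) p4 q(1) q2 \<open>q \<noteq> p\<close>] by simp
  qed (use p p2 n in auto)
  define n where "n = nat \<bar>u\<bar>"
  have n: "int n = \<bar>u\<bar>" "n > 0" "odd n" using u0 par by (auto simp: n_def even_nat_iff)
  have Lu: "Legendre (int n) p = chi3 (int n) * chi4 (int n)"
  proof (rule Legendre_eq_multiplicative[where g = "\<lambda>n. chi3 (int n) * chi4 (int n)"])
    fix q :: nat assume q: "prime q" "q dvd n"
    have "int q dvd \<bar>u\<bar>" unfolding n(1)[symmetric] using q(2) by simp
    then have qu: "int q dvd u" by simp
    have "\<not> 3 dvd u"
    proof
      assume "3 dvd u"
      then have "3 dvd int p" unfolding uv by (simp add: power2_eq_square)
      then have "3 dvd p" by presburger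
      then show False using p3 by presburger
    qed
    then have "q \<noteq> 3" using qu by auto
    moreover have "q \<noteq> 2" using q n by auto
    moreover have "q \<noteq> 4" using q(1) by (intro notI) (auto simp: prime_nat_iff dest!: spec[of _ 2])
    ultimately have q3: "q > 3" using prime_ge_2_nat[OF q(1)] by simp
    have "q \<noteq> p" using qu ndu by auto
    have nqv: "\<not> int q dvd v" using cop[of "int q"] q(1) qu by auto
    have "[int p = 3 * v ^ 2] (mod int q)" using qu unfolding uv by (simp add: cong_iff_dvd_diff power2_eq_square)
    then have "Legendre p q = Legendre 3 q * Legendre (v ^ 2) q"
      using Legendre_cong[of "int p" "3 * v ^ 2" "int q"] Legendre_mult[OF q(1), of 3 "v ^ 2"] q3 by simp
    also have "\<dots> = chi3 q * chi4 q" using Legendre_3[OF q(1) q3] Legendre_square[OF q(1) nqv] by simp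
    finally show "Legendre (int q) p = chi3 (int q) * chi4 (int q)"
      using Legendre_prime_swap[OF p(1) p4 q(1) _ \<open>q \<noteq> p\<close>] q3 by simp
  next
    show "chi3 (int (a * b)) * chi4 (int (a * b)) = chi3 (int a) * chi4 (int a) * (chi3 (int b) * chi4 (int b))" for a b
      by (simp add: chi3_mult chi4_mult)
    show "chi3 (int 1) * chi4 (int 1) = 1" by (simp add: chi3_def chi4_def)
  qed (use p p2 n in auto)
  have m1: "Legendre (-1) p = 1"
  proof -
    have "even ((p - 1) div 2)" using p4 by presburger
    then have "[Legendre (-1) p = 1] (mod p)" using euler_criterion[OF p(1) p2, of "-1"] by simp
    then show ?thesis by (rule Legendre_eqI[OF p2]) simp
  qed
  have Labs: "Legendre \<bar>x\<bar> p = Legendre x p" for x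
    using m1 Legendre_mult[OF p(1) p2, of "-1" x] by (simp add: abs_if)
  have neg: "chi3 (- x) = - chi3 x" "chi4 (- x) = - chi4 x" for x
    using chi3_mult[of "-1" x] chi4_mult[of "-1" x] by (simp_all add: chi3_def[of "-1"] chi4_def[of "-1"])
  have Lu': "Legendre u p = chi3 u * chi4 u"
    using Lu Labs[of u] unfolding n(1) by (simp add: abs_if neg split: if_splits)
  obtain w where w: "v = 2 * w" using par by blast
  \<comment> \<open>An odd square is 1 modulo 8 and 3 v^2 = 12 w^2, so p modulo 8 shows the parity
    of w.\<close>
  have pm8: "int p mod 8 = 1 \<longleftrightarrow> even w"
  proof -
    obtain a where a: "u = 2 * a + 1" using par by (elim oddE)
    have "even (a * (a + 1))" by simp
    then obtain b where b: "a * (a + 1) = 2 * b" by blast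
    have "int p = 4 * (a * (a + 1)) + 1 + 12 * w ^ 2" unfolding uv a w by (simp add: power2_eq_square algebra_simps)
    moreover define W where "W = w ^ 2"
    ultimately have "int p = 8 * b + 1 + 12 * W" using b by simp
    moreover have "even W \<longleftrightarrow> even w" by (simp add: W_def)
    ultimately show ?thesis by presburger
  qed
  then have L2: "Legendre 2 p = (if even w then 1 else -1)"
  proof -
    have "p mod 8 = 1 \<longleftrightarrow> int p mod 8 = 1" by presburger
    then show ?thesis using Legendre_2[OF p(1) p4] pm8 by simp
  qed
  have Lv: "Legendre v p = (if even w then 1 else -1)"
  proof -
    define m where "m = nat \<bar>v\<bar>"
    have m: "int m = \<bar>v\<bar>" "m > 0" using v0 by (auto simp: m_def)
    obtain o' where o': "m = 2 ^ multiplicity 2 m * o'" "odd o'"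
      by (rule multiplicity_decompose'[of m 2]) (use m in auto)
    have Lo: "Legendre (int o') p = 1"
    proof (rule odd_part)
      show "o' > 0" using o'(2) by (cases o') auto
      have "int o' dvd int m" using o'(1) by (metis dvd_triv_right int_dvd_int_iff)
      then show "int o' dvd v" unfolding m(1) by simp
    qed (rule o'(2))
    have pow: "Legendre (2 ^ k) p = Legendre 2 p ^ k" for k
    proof (induction k)
      case 0
      have "\<not> int p dvd 1" using p2 by simp
      then show ?case using Legendre_square[OF p(1), of 1] by simp
    next
      case (Suc k)
      then show ?case using Legendre_mult[OF p(1) p2, of 2 "2 ^ k"] by simp
    qed
    have "Legendre v p = Legendre (int m) p" using Labs[of v] m(1) by simp
    also have "int m = 2 ^ multiplicity 2 m * int o'" using o'(1) by (metis of_nat_mult of_nat_numeral of_nat_power)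
    also have "Legendre (2 ^ multiplicity 2 m * int o') p = Legendre 2 p ^ multiplicity 2 m"
      using Legendre_mult[OF p(1) p2, of "2 ^ multiplicity 2 m" "int o'"] Lo pow by simp
    also have "\<dots> = (if even w then 1 else -1)"
    \<comment> \<open>If w is even, 2 is a square modulo p, so its exponent in v does not matter; if
      w is odd, the exponent is 1.\<close>
    proof (cases "even w")
      case False
      have "multiplicity 2 m = 1"
      proof -
        have "m = 2 * nat \<bar>w\<bar>" by (simp add: m_def w abs_mult nat_mult_distrib)
        moreover have "\<not> 2 dvd nat \<bar>w\<bar>" using False by (simp add: even_nat_iff)
        ultimately show ?thesis by (intro multiplicity_eqI) auto
      qed
      then show ?thesis using L2 False by simp
    qed (use L2 in simp)
    finally show ?thesis .
  qed
  \<comment> \<open>Adding v = 2 w to the odd number u flips \<open>chi4\<close> exactly when w is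
    odd, which absorbs the symbol of v.\<close>
  have "chi4 (u + v) = chi4 u * (if even w then 1 else -1)"
  proof (cases "even w")
    case True
    then obtain a where "w = 2 * a" by blast
    then have "(u + v) mod 4 = u mod 4" unfolding w by simp
    then show ?thesis using True by (simp add: chi4_def)
  next
    case False
    then have "(u + v) mod 4 = (u + 2) mod 4" unfolding w by presburger
    moreover have "u mod 4 = 1 \<or> u mod 4 = 3" using par(1) by presburger
    then have "(u mod 4 = 1 \<and> (u + 2) mod 4 = 3) \<or> (u mod 4 = 3 \<and> (u + 2) mod 4 = 1)" by presburger
    ultimately show ?thesis using False by (auto simp: chi4_def)
  qed
  then show "Legendre (u * v) p = chi3 u * chi4 (u + v)"
    using Legendre_mult[OF p(1) p2, of u v] Lu' Lv by simp
qed

text \<open>One of z, \<omega> z, \<omega>^2 z has an even \<omega>-coordinate 2 v, and it then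
  equals u + v sqrt(-3), because sqrt(-3) = 1 + 2 \<omega>. Here \<open>Eis (-1) (-1)\<close> is
  \<omega>^2. An odd v would make p = 3 (mod 4).\<close>

lemma eta_representation:
  assumes p: "p mod 12 = 1" "enorm z = p"
  obtains u v :: int where "int p = u ^ 2 + 3 * v ^ 2" "odd u" "even v" "eta z = chi3 u * chi4 (u + v)"
proof -
  have p4: "int p mod 4 = 1" using p(1) by presburger
  have "odd (eisnorm z)"
  proof -
    have "odd (int p)" using p4 by presburger
    then show ?thesis using p(2) by (metis int_enorm)
  qed
  then have "odd (re z) \<or> odd (om z)" by (auto simp: eisnorm_def)
  have units: "eta (Eis (-1) (-1)) = 1" "eta (Eis 0 1) = 1" "eisnorm (Eis (-1) (-1)) = 1" "eisnorm (Eis 0 1) = 1"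
    by (simp_all add: eta_def chi3_def rho4_def chi4_def eisnorm_def)
  obtain w where w: "odd (re w)" "even (om w)" "eta w = eta z" "eisnorm w = eisnorm z"
  proof (cases "odd (re z)")
    case True
    show ?thesis
    proof (cases "even (om z)")
      case om: True
      show ?thesis by (rule that[of z]) (use True om in auto)
    next
      case om: False
      show ?thesis by (rule that[of "z * Eis 0 1"]) (use True om units in \<open>auto simp: eta_mult eisnorm_mult\<close>)
    qed
  next
    case False
    then have "odd (om z)" using \<open>odd (re z) \<or> odd (om z)\<close> by simp
    then show ?thesis
      by (intro that[of "z * Eis (-1) (-1)"]) (use False units in \<open>auto simp: eta_mult eisnorm_mult\<close>)
  qed
  obtain v where v: "om w = 2 * v" using w(2) by blast
  define u where "u = re w - v"
  have e: "int p = u ^ 2 + 3 * v ^ 2"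
  proof -
    have "int p = eisnorm w" using p(2) w(4) by (metis int_enorm)
    then show ?thesis unfolding eisnorm_def u_def v by (simp add: power2_eq_square algebra_simps)
  qed
  have "even v"
  proof (rule ccontr)
    assume "odd v"
    then have "even u" using w(1) by (simp add: u_def)
    then obtain a where a: "u = 2 * a" by blast
    obtain b where b: "v = 2 * b + 1" using \<open>odd v\<close> by (elim oddE)
    have "int p = 3 + 4 * (a ^ 2 + 3 * b ^ 2 + 3 * b)" unfolding e a b by (simp add: power2_eq_square algebra_simps)
    then have "int p mod 4 = 3" by (simp only: mod_mult_self2) simp
    then show False using p4 by simp
  qed
  moreover from this have "odd u" using w(1) by (simp add: u_def)
  moreover have "eta w = chi3 u * chi4 (u + v)"
  proof -
    have "chi3 (re w + om w) = chi3 u" by (rule chi3_cong) (simp add: u_def v cong_iff_dvd_diff)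
    then show ?thesis using w(1,2) by (simp add: eta_def rho4_def u_def)
  qed
  ultimately show ?thesis using that e w(3) by simp
qed

theorem no_root_if_eta_minus_1:
  assumes p: "prime p" "p mod 12 = 1" and z: "enorm z = p" "eta z = -1"
  shows "\<not> (\<exists>y::int. [y ^ 8 + 360 * y ^ 4 - 48 = 0] (mod int p))"
proof
  assume "\<exists>y::int. [y ^ 8 + 360 * y ^ 4 - 48 = 0] (mod int p)"
  then obtain y :: int where y: "int p dvd y ^ 8 + 360 * y ^ 4 - 48" by (auto simp: cong_0_iff)
  obtain u v :: int where uv: "int p = u ^ 2 + 3 * v ^ 2" "odd u" "even v" "eta z = chi3 u * chi4 (u + v)"
    using eta_representation[OF p(2) z(1)] by blast
  note L = Legendre_representation[OF p uv(1-3)]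
  have Luv: "Legendre (u * v) p = -1" using L(1) uv(4) z(2) by simp
  have p4: "p mod 4 = 1" using p(2) by presburger
  have p2: "p > 2" using p prime_ge_2_nat[of p] by (cases "p = 2") auto
  have pp: "prime (int p)" using p(1) by simp
  obtain i :: int where i0: "[i ^ 2 = -1] (mod int p)" using sqrt_minus_1_mod_prime[OF p(1) p4] by blast
  then have i: "int p dvd i ^ 2 + 1" by (simp add: cong_iff_dvd_diff)
  have "coprime v (int p)" using pp L(3) by (metis coprime_commute prime_imp_coprime)
  then obtain v' where "[v * v' = 1] (mod int p)" using cong_solve_coprime_int by blast
  then have v': "int p dvd v * v' - 1" by (simp add: cong_iff_dvd_diff)
  \<comment> \<open>The sign \<sigma> covers both factors of the polynomial: s stands for u/v or
    -u/v, and t = i s for either square root of 3.\<close>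
  have square: False if s: "int p dvd s * v - \<sigma> * u" "\<sigma> = 1 \<or> \<sigma> = -1" and r: "int p dvd y ^ 4 + 180 - 104 * (i * s)" for s \<sigma>
  proof -
    define t where "t = i * s"
    \<comment> \<open>Since (2 - t)(2 + t) = 1 and (t + 1)^2 = 2 (2 + t), the relation y^4 = 4 t (2
      - t)^3 yields Z^2 = 16 t (2 - t)^3 (2 + t)^2 (t + 1)^2 = 32 t.\<close>
    define Z where "Z = 2 * y ^ 2 * (2 + t) * (t + 1)"
    have s2: "int p dvd s ^ 2 + 3"
    proof -
      have "v ^ 2 * (s ^ 2 + 3) = (s * v - \<sigma> * u) * (s * v + \<sigma> * u) + int p"
        unfolding uv(1) using s(2) by (auto simp: power2_eq_square algebra_simps)
      moreover have "int p dvd (s * v - \<sigma> * u) * (s * v + \<sigma> * u) + int p" using s(1) by simp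
      ultimately have "int p dvd v ^ 2 * (s ^ 2 + 3)" by (simp only:)
      then show ?thesis using pp L(3) by (metis prime_dvd_mult_iff prime_dvd_power)
    qed
    have t2: "int p dvd t ^ 2 - 3"
    proof -
      have "t ^ 2 - 3 = (i ^ 2 + 1) * s ^ 2 - (s ^ 2 + 3)" by (simp add: t_def power2_eq_square algebra_simps)
      then show ?thesis using i s2 by (simp only:) simp
    qed
    have Z2: "int p dvd Z ^ 2 - 32 * t"
    proof -
      \<comment> \<open>The cubic is the quotient on division by t^2 - 3, once y^4 is replaced by
        104 t - 180.\<close>
      have "Z ^ 2 - 32 * t = 4 * (2 + t) ^ 2 * (t + 1) ^ 2 * (y ^ 4 + 180 - 104 * t)
          + (t ^ 2 - 3) * (416 * t ^ 3 + 1776 * t ^ 2 + 2336 * t + 960)"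
      proof -
        define a where "a = y ^ 2"
        have "y ^ 4 = a ^ 2" by (simp add: a_def flip: power_mult)
        then show ?thesis unfolding Z_def a_def[symmetric]
          by (simp add: power2_eq_square power3_eq_cube algebra_simps)
      qed
      then show ?thesis using r t2 unfolding t_def[symmetric] by (simp only:) simp
    qed
    \<comment> \<open>As i^2 = -1 and (1 + i)^2 = 2 i, Y^2 = -2 i Z^2 v^2 = -64 i t v^2 = 64 s v^2,
      which is 64 \<sigma> u v modulo p.\<close>
    define Y where "Y = i * Z * (1 + i) * v"
    have "Y ^ 2 - 64 * s * v ^ 2 = (i ^ 2 + 1) * (v ^ 2 * ((i ^ 2 + 2 * i) * Z ^ 2 - 64 * s)) - 2 * i * v ^ 2 * (Z ^ 2 - 32 * t)"
      unfolding Y_def t_def by (simp add: power2_eq_square algebra_simps)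
    then have "int p dvd Y ^ 2 - 64 * s * v ^ 2" using i Z2 by (simp only: dvd_diff dvd_mult dvd_mult2)
    then have "int p dvd (Y ^ 2 - 64 * s * v ^ 2) + 64 * v * (s * v - \<sigma> * u)" using s(1) by simp
    also have "(Y ^ 2 - 64 * s * v ^ 2) + 64 * v * (s * v - \<sigma> * u) = Y ^ 2 - \<sigma> * (64 * (u * v))"
      by (simp add: power2_eq_square algebra_simps)
    finally have Y2: "[Y ^ 2 = \<sigma> * (8 ^ 2 * (u * v))] (mod int p)" by (simp add: cong_iff_dvd_diff)
    have "\<not> int p dvd i"
    proof
      assume "int p dvd i"
      then have "int p dvd i ^ 2 + 1 - i * i" using i by simp
      then show False using p2 by (simp add: power2_eq_square)
    qed
    then have m1: "Legendre (-1) p = 1"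
      using Legendre_cong[OF i0] Legendre_square[OF p(1), of i] by simp
    have n8: "\<not> int p dvd 8"
    proof
      assume "int p dvd 8"
      then have "int p dvd 2 ^ 3" by simp
      then have "int p dvd 2" using pp prime_dvd_power by blast
      then show False using p2 by (auto dest: zdvd_imp_le)
    qed
    \<comment> \<open>Neither the square 64 nor the sign \<sigma> affects the symbol, -1 being a
      square modulo p.\<close>
    have "Legendre (\<sigma> * (8 ^ 2 * (u * v))) p = -1"
      using s(2) m1 Luv Legendre_mult[OF p(1) p2, of "8 ^ 2" "u * v"] Legendre_square[OF p(1) n8]
        Legendre_mult[OF p(1) p2, of "-1" "8 ^ 2 * (u * v)"] by auto
    then have "Legendre (Y ^ 2) p = -1" using Legendre_cong[OF Y2] by simp
    moreover have "QuadRes (int p) (Y ^ 2)" unfolding QuadRes_def by (rule exI[of _ Y]) (rule cong_refl)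
    ultimately show False by (simp add: Legendre_def split: if_splits)
  qed
  define s where "s = u * v'"
  have sv: "int p dvd s * v - 1 * u"
  proof -
    have "s * v - 1 * u = u * (v * v' - 1)" by (simp add: s_def algebra_simps)
    then show ?thesis using v' by (simp only:) simp
  qed
  have s2: "int p dvd s ^ 2 + 3"
  proof -
    have "v ^ 2 * (s ^ 2 + 3) = (s * v - 1 * u) * (s * v + u) + int p"
      unfolding uv(1) by (simp add: power2_eq_square algebra_simps)
    moreover have "int p dvd (s * v - 1 * u) * (s * v + u) + int p" using sv by simp
    ultimately have "int p dvd v ^ 2 * (s ^ 2 + 3)" by (simp only:)
    then show ?thesis using pp L(3) by (metis prime_dvd_mult_iff prime_dvd_power)
  qed
  \<comment> \<open>The polynomial is (y^4 + 180)^2 - 3 * 104^2; the correction term, with 10816 =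
    104^2, replaces 3 by (i s)^2.\<close>
  have "(y ^ 4 + 180 - 104 * (i * s)) * (y ^ 4 + 180 - 104 * (i * (- s)))
      = (y ^ 8 + 360 * y ^ 4 - 48) - 10816 * ((i ^ 2 + 1) * s ^ 2 - (s ^ 2 + 3))"
  proof -
    define a where "a = y ^ 4"
    have "y ^ 8 = a ^ 2" by (simp add: a_def flip: power_mult)
    then show ?thesis unfolding a_def[symmetric] by (simp add: power2_eq_square algebra_simps)
  qed
  moreover have "int p dvd (y ^ 8 + 360 * y ^ 4 - 48) - 10816 * ((i ^ 2 + 1) * s ^ 2 - (s ^ 2 + 3))"
    by (rule dvd_diff[OF y dvd_mult[OF dvd_diff[OF dvd_mult2[OF i] s2]]])
  ultimately have "int p dvd (y ^ 4 + 180 - 104 * (i * s)) * (y ^ 4 + 180 - 104 * (i * (- s)))" by (simp only:)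
  then consider "int p dvd y ^ 4 + 180 - 104 * (i * s)" | "int p dvd y ^ 4 + 180 - 104 * (i * (- s))"
    using pp prime_dvd_mult_iff by blast
  then show False
  proof cases
    case 1
    then show False using square[OF sv] by simp
  next
    case 2
    have "(- s) * v - (- 1) * u = - (s * v - 1 * u)" by simp
    then have "int p dvd (- s) * v - (- 1) * u" using sv by (simp only: dvd_minus_iff)
    then show False using square[of "- s" "- 1"] 2 by simp
  qed
qed

theorem theorem5:
  fixes c d :: int
  assumes "d \<ge> 1" and "[c = 1] (mod 12)" and "gcd c d = 1"
  shows "\<exists>p::int. prime p \<and> [p = c] (mod 12 * d) \<and>
           \<not> (\<exists>y::int. [y ^ 8 + 360 * y ^ 4 - 48 = 0] (mod p))"
proof -
  define M where "M = nat (12 * d)"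
  \<comment> \<open>As c may be negative, its residue modulo 12 d serves as the natural number to
    which the characters apply.\<close>
  define c' where "c' = nat (c mod (12 * d))"
  have M: "int M = 12 * d" and c': "int c' = c mod (12 * d)"
    using assms(1) by (simp_all add: M_def c'_def)
  have M12: "12 dvd M" "M > 0"
    using assms(1) by (simp_all add: M_def nat_mult_distrib)
  have cM: "[int c' = c] (mod 12 * d)" unfolding c' by (simp add: Cong.cong_def)
  have "coprime c 12" using assms(2) by (metis cong_imp_coprime cong_sym coprime_1_left)
  moreover have "coprime c d" using assms(3) by (simp add: coprime_iff_gcd_eq_1)
  ultimately have "coprime c (12 * d)" by simp
  then have "coprime (int c') (12 * d)" using cM by (metis cong_imp_coprime cong_sym)
  then have cop: "coprime c' M" unfolding M[symmetric] by (simp only: coprime_int_iff)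
  have "[int c' = c] (mod 12)" using cM by (rule cong_dvd_modulus) simp
  then have "[int c' = 1] (mod 12)" using assms(2) by (rule cong_trans)
  then have "int c' mod 12 = 1" by (simp add: Cong.cong_def)
  then have c12: "c' mod 12 = 1" by presburger
  obtain p z where p: "prime p" "[p = c'] (mod M)" "enorm z = p" "eta z = -1"
    by (rule exists_prime_eta_minus_1[OF M12 cop c12])
  have "[p = c'] (mod 12)" using p(2) M12(1) by (rule cong_dvd_modulus_nat)
  then have p12: "p mod 12 = 1" using c12 by (simp add: Cong.cong_def)
  have "[int p = int c'] (mod int M)" using p(2) by (simp only: cong_int_iff)
  then have "[int p = c] (mod 12 * d)" unfolding M using cM by (rule cong_trans)
  then show ?thesis
    using p(1) no_root_if_eta_minus_1[OF p(1) p12 p(3,4)] by (intro exI[of _ "int p"]) simp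
qed

end
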